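(* Let $d$ be an integer, and assume a triangulated category $\mathcal T$ and $M\in\mathsf{silt}\,\mathcal T$ satisfy the conditions (T0), (T1), (T2), (T3) listed in the context. Take $X\in\mathsf{add}\,M$ and put $S:=\mathrm{top}\,H^0X$. Then the following conditions are equivalent. 1. $\mu_X^-(M)\ge\nu_d^{-1}M$. 2. $\mathrm{proj.dim}_M\,S<d$. 3. $\mu_X^-(M)\in\mathsf{silt}^d\,\mathcal T$ and $\mathcal T(S,S[d])=0$ holds.
   Context: $k$ is a field, categories are $k$-linear, $D=\mathrm{Hom}_k(-,k)$, and $\mathcal T(X,Y)$ denotes Hom spaces in $\mathcal T$. $M\in\mathcal T$ is silting if $\mathcal T(M,M[i])=0$ for all $i>0$ and $\mathcal T=\mathsf{thick}\,M$; $\mathsf{silt}\,\mathcal T$ is the class of silting objects. For $M,N\in\mathsf{silt}\,\mathcal T$, $M\ge N$ means $\mathcal T(M,N[i])=0$ for all $i>0$. Conditions: (T0) $\mathcal T$ is Hom-finite and Krull–Schmidt. (T1) $\mathcal T$ has a Serre functor $\nu$ (an autoequivalence with natural isomorphisms $\mathcal T(X,Y)\cong D\mathcal T(Y,\nu X)$); put $\nu_d:=\nu\circ[-d]$. (T2) $M$ admits a right adjacent t-structure: the pair $\mathcal T_M^{\le0}:=\{X\mid\mathcal T(M,X[i])=0\ \forall i>0\}$, $\mathcal T_M^{\ge0}:=\{X\mid\mathcal T(M,X[i])=0\ \forall i<0\}$ is a t-structure on $\mathcal T$; its heart is $\mathcal H_M:=\mathcal T_M^{\le0}\cap\mathcal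 T_M^{\ge0}$ and $H^0\colon\mathcal T\to\mathcal H_M$ is the associated cohomological functor. (T3) $M\in\mathsf{silt}^d\,\mathcal T$, where $\mathsf{silt}^d\,\mathcal T:=\{N\in\mathsf{silt}\,\mathcal T\mid N\ge\nu_d^{-1}N\}$. For $T\in\mathcal T_M^{\le0}$, $\mathrm{proj.dim}_M T\le m$ means $\mathcal T(T,H[i])=0$ for all $H\in\mathcal H_M$ and all $i>m$ (for $m\ge0$, equivalently $T\in\mathsf{add}\,M*\mathsf{add}\,M[1]*\cdots*\mathsf{add}\,M[m]$, where $\mathcal X*\mathcal Y$ is the class of middle terms $Z$ of triangles $X\to Z\to Y\to X[1]$ with $X\in\mathcal X,Y\in\mathcal Y$; for $m<0$ it means $T=0$). $\mathrm{proj.dim}_MS<d$ means $\mathrm{proj.dim}_MS\le d-1$. $\mathrm{top}\,H^0X$ is the largest semisimple quotient of $H^0X$ in $\mathcal H_M$. For $X\in\mathsf{add}\,M$ choose $Y\in\mathsf{add}\,M$ with $\mathsf{add}\,M=\mathsf{add}(X\oplus Y)$ and $(\mathsf{add}\,X)\cap(\mathsf{add}\,Y)=0$, take a left $(\mathsf{add}\,Y)$-approximation $X\to Y_0$ and a triangle $X\to Y_0\to X'\to X[1]$; the left mutation is $\mu_X^-(M):=X'\oplus Y$, a silting object (well defined up to additive closure). *)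

theory Defs
  imports "Jordan_Normal_Form.Missing_VectorSpace"
begin

section \<open>Linear categories\<close>

text \<open>
  The morphism spaces are \<open>K\<close>-vector spaces in the sense of the locale \<^locale>\<open>vectorspace\<close>;
  the ring multiplication and unit which a \<open>module\<close> record also carries play no role.
  As composition is not annotated with objects, a morphism is required to determine its
  source and target (\<open>Hom_disjoint\<close>).
\<close>

record ('o, 'a, 'k) lin_cat =
  Ob :: "'o set"
  Hom :: "'o \<Rightarrow> 'o \<Rightarrow> ('k, 'a) module"
  comp :: "'a \<Rightarrow> 'a \<Rightarrow> 'a"  (infixl "\<cdot>\<index>" 70)
  ident :: "'o \<Rightarrow> 'a"

abbreviation Mor :: "('o, 'a, 'k, 'z) lin_cat_scheme \<Rightarrow> 'o \<Rightarrow> 'o \<Rightarrow> 'a set" where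
  "Mor T X Y \<equiv> carrier (Hom T X Y)"

locale linear_category = field K for K :: "('k, 'r) ring_scheme" (structure) +
  fixes T :: "('o, 'a, 'k, 'z) lin_cat_scheme"
  assumes Hom_vectorspace: "\<lbrakk>X \<in> Ob T; Y \<in> Ob T\<rbrakk> \<Longrightarrow> vectorspace K (Hom T X Y)"
    and Hom_disjoint: "\<lbrakk>X \<in> Ob T; Y \<in> Ob T; X' \<in> Ob T; Y' \<in> Ob T;
          f \<in> Mor T X Y; f \<in> Mor T X' Y'\<rbrakk> \<Longrightarrow> X = X' \<and> Y = Y'"
    and ident_closed: "X \<in> Ob T \<Longrightarrow> ident T X \<in> Mor T X X"
    and comp_linear_left: "\<lbrakk>X \<in> Ob T; Y \<in> Ob T; Z \<in> Ob T; f \<in> Mor T X Y\<rbrakk> \<Longrightarrow>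
          (\<lambda>g. g \<cdot>\<^bsub>T\<^esub> f) \<in> module_hom K (Hom T Y Z) (Hom T X Z)"
    and comp_linear_right: "\<lbrakk>X \<in> Ob T; Y \<in> Ob T; Z \<in> Ob T; g \<in> Mor T Y Z\<rbrakk> \<Longrightarrow>
          (\<lambda>f. g \<cdot>\<^bsub>T\<^esub> f) \<in> module_hom K (Hom T X Y) (Hom T X Z)"
    and comp_assoc: "\<lbrakk>W \<in> Ob T; X \<in> Ob T; Y \<in> Ob T; Z \<in> Ob T;
          f \<in> Mor T W X; g \<in> Mor T X Y; h \<in> Mor T Y Z\<rbrakk> \<Longrightarrow>
          (h \<cdot>\<^bsub>T\<^esub> g) \<cdot>\<^bsub>T\<^esub> f = h \<cdot>\<^bsub>T\<^esub> (g \<cdot>\<^bsub>T\<^esub> f)"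
    and ident_left: "\<lbrakk>X \<in> Ob T; Y \<in> Ob T; f \<in> Mor T X Y\<rbrakk> \<Longrightarrow> ident T Y \<cdot>\<^bsub>T\<^esub> f = f"
    and ident_right: "\<lbrakk>X \<in> Ob T; Y \<in> Ob T; f \<in> Mor T X Y\<rbrakk> \<Longrightarrow> f \<cdot>\<^bsub>T\<^esub> ident T X = f"

definition Hom_vanishes :: "('o, 'a, 'k, 'z) lin_cat_scheme \<Rightarrow> 'o \<Rightarrow> 'o \<Rightarrow> bool" where
  "Hom_vanishes T X Y \<longleftrightarrow> Mor T X Y = {\<zero>\<^bsub>Hom T X Y\<^esub>}"

definition zero_object :: "('o, 'a, 'k, 'z) lin_cat_scheme \<Rightarrow> 'o \<Rightarrow> bool" where
  "zero_object T Z \<longleftrightarrow> Z \<in> Ob T \<and> (\<forall>Y\<in>Ob T. Hom_vanishes T Z Y \<and> Hom_vanishes T Y Z)"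

definition iso_arrow :: "('o, 'a, 'k, 'z) lin_cat_scheme \<Rightarrow> 'o \<Rightarrow> 'o \<Rightarrow> 'a \<Rightarrow> bool" where
  "iso_arrow T X Y f \<longleftrightarrow> f \<in> Mor T X Y \<and>
     (\<exists>g\<in>Mor T Y X. g \<cdot>\<^bsub>T\<^esub> f = ident T X \<and> f \<cdot>\<^bsub>T\<^esub> g = ident T Y)"

definition iso_closed :: "('o, 'a, 'k, 'z) lin_cat_scheme \<Rightarrow> 'o set \<Rightarrow> bool" where
  "iso_closed T C \<longleftrightarrow> (\<forall>X\<in>C. \<forall>Y\<in>Ob T. \<forall>f. iso_arrow T X Y f \<longrightarrow> Y \<in> C)"

text \<open>\<open>biproduct T Xs Z\<close>: \<open>Z\<close> is a direct sum of the objects in the list \<open>Xs\<close>.\<close>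

definition biproduct :: "('o, 'a, 'k, 'z) lin_cat_scheme \<Rightarrow> 'o list \<Rightarrow> 'o \<Rightarrow> bool" where
  "biproduct T Xs Z \<longleftrightarrow> set Xs \<subseteq> Ob T \<and> Z \<in> Ob T \<and>
     (\<exists>inc prj.
        (\<forall>i<length Xs. inc i \<in> Mor T (Xs ! i) Z \<and> prj i \<in> Mor T Z (Xs ! i)) \<and>
        (\<forall>i<length Xs. \<forall>j<length Xs.
           prj j \<cdot>\<^bsub>T\<^esub> inc i = (if i = j then ident T (Xs ! i) else \<zero>\<^bsub>Hom T (Xs ! i) (Xs ! j)\<^esub>)) \<and>
        finsum (Hom T Z Z) (\<lambda>i. inc i \<cdot>\<^bsub>T\<^esub> prj i) {..<length Xs} = ident T Z)"

locale additive_category = linear_category +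
  assumes finite_biproducts: "set Xs \<subseteq> Ob T \<Longrightarrow> \<exists>Z. biproduct T Xs Z"

definition add_closure :: "('o, 'a, 'k, 'z) lin_cat_scheme \<Rightarrow> 'o \<Rightarrow> 'o set" where
  "add_closure T M = {X \<in> Ob T. \<exists>W Z n. biproduct T [X, W] Z \<and> biproduct T (replicate n M) Z}"

definition Hom_finite :: "('k, 'r) ring_scheme \<Rightarrow> ('o, 'a, 'k, 'z) lin_cat_scheme \<Rightarrow> bool" where
  "Hom_finite K T \<longleftrightarrow> (\<forall>X\<in>Ob T. \<forall>Y\<in>Ob T. vectorspace.fin_dim K (Hom T X Y))"

definition End_ring :: "('o, 'a, 'k, 'z) lin_cat_scheme \<Rightarrow> 'o \<Rightarrow> 'a ring" where
  "End_ring T X = \<lparr>carrier = Mor T X X, mult = comp T, one = ident T X,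
     zero = \<zero>\<^bsub>Hom T X X\<^esub>, add = (\<oplus>\<^bsub>Hom T X X\<^esub>)\<rparr>"

definition local_ring :: "('b, 'c) ring_scheme \<Rightarrow> bool" where
  "local_ring R \<longleftrightarrow> ring R \<and> \<one>\<^bsub>R\<^esub> \<noteq> \<zero>\<^bsub>R\<^esub> \<and>
     (\<forall>a \<in> carrier R - Units R. \<forall>b \<in> carrier R - Units R. a \<oplus>\<^bsub>R\<^esub> b \<notin> Units R)"

definition Krull_Schmidt :: "('o, 'a, 'k, 'z) lin_cat_scheme \<Rightarrow> bool" where
  "Krull_Schmidt T \<longleftrightarrow>
     (\<forall>X\<in>Ob T. \<exists>Xs. biproduct T Xs X \<and> (\<forall>Y\<in>set Xs. local_ring (End_ring T Y)))"


section \<open>Linear endofunctors and Serre functors\<close>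

record ('o, 'a) endofun =
  on_ob :: "'o \<Rightarrow> 'o"
  on_mor :: "'a \<Rightarrow> 'a"

definition linear_endofunctor ::
  "('k, 'r) ring_scheme \<Rightarrow> ('o, 'a, 'k, 'z) lin_cat_scheme \<Rightarrow> ('o, 'a) endofun \<Rightarrow> bool" where
  "linear_endofunctor K T F \<longleftrightarrow>
     on_ob F \<in> Ob T \<rightarrow> Ob T \<and>
     (\<forall>X\<in>Ob T. \<forall>Y\<in>Ob T.
        on_mor F \<in> module_hom K (Hom T X Y) (Hom T (on_ob F X) (on_ob F Y))) \<and>
     (\<forall>X\<in>Ob T. on_mor F (ident T X) = ident T (on_ob F X)) \<and>
     (\<forall>X\<in>Ob T. \<forall>Y\<in>Ob T. \<forall>Z\<in>Ob T. \<forall>f\<in>Mor T X Y. \<forall>g\<in>Mor T Y Z.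
        on_mor F (g \<cdot>\<^bsub>T\<^esub> f) = on_mor F g \<cdot>\<^bsub>T\<^esub> on_mor F f)"

definition id_fun :: "('o, 'a) endofun" where
  "id_fun = \<lparr>on_ob = id, on_mor = id\<rparr>"

definition comp_fun :: "('o, 'a) endofun \<Rightarrow> ('o, 'a) endofun \<Rightarrow> ('o, 'a) endofun" where
  "comp_fun F G = \<lparr>on_ob = on_ob F \<circ> on_ob G, on_mor = on_mor F \<circ> on_mor G\<rparr>"

definition naturally_isomorphic ::
  "('o, 'a, 'k, 'z) lin_cat_scheme \<Rightarrow> ('o, 'a) endofun \<Rightarrow> ('o, 'a) endofun \<Rightarrow> bool" where
  "naturally_isomorphic T F G \<longleftrightarrow>
     (\<exists>\<eta>. (\<forall>X\<in>Ob T. iso_arrow T (on_ob F X) (on_ob G X) (\<eta> X)) \<and>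
          (\<forall>X\<in>Ob T. \<forall>Y\<in>Ob T. \<forall>f\<in>Mor T X Y.
             \<eta> Y \<cdot>\<^bsub>T\<^esub> on_mor F f = on_mor G f \<cdot>\<^bsub>T\<^esub> \<eta> X))"

definition quasi_inverse :: "('k, 'r) ring_scheme \<Rightarrow> ('o, 'a, 'k, 'z) lin_cat_scheme \<Rightarrow>
    ('o, 'a) endofun \<Rightarrow> ('o, 'a) endofun \<Rightarrow> bool" where
  "quasi_inverse K T F G \<longleftrightarrow> linear_endofunctor K T F \<and> linear_endofunctor K T G \<and>
     naturally_isomorphic T (comp_fun F G) id_fun \<and> naturally_isomorphic T (comp_fun G F) id_fun"

definition autoequivalence ::
  "('k, 'r) ring_scheme \<Rightarrow> ('o, 'a, 'k, 'z) lin_cat_scheme \<Rightarrow> ('o, 'a) endofun \<Rightarrow> bool" where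
  "autoequivalence K T F \<longleftrightarrow> (\<exists>G. quasi_inverse K T F G)"

definition regular_module :: "('k, 'r) ring_scheme \<Rightarrow> ('k, 'k) module" where
  "regular_module K = \<lparr>carrier = carrier K, mult = (\<otimes>\<^bsub>K\<^esub>), one = \<one>\<^bsub>K\<^esub>,
     zero = \<zero>\<^bsub>K\<^esub>, add = (\<oplus>\<^bsub>K\<^esub>), smult = (\<otimes>\<^bsub>K\<^esub>)\<rparr>"

text \<open>The dual space, with pointwise operations; linear forms are taken to be extensional
  functions so that they are determined by their values on \<open>V\<close>.\<close>

definition dual_space ::
  "('k, 'r) ring_scheme \<Rightarrow> ('k, 'b, 'c) module_scheme \<Rightarrow> ('k, 'b \<Rightarrow> 'k) module" where
  "dual_space K V = (ring.func_space K (carrier V))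
     \<lparr>carrier := extensional (carrier V) \<inter> module_hom K V (regular_module K)\<rparr>"

text \<open>The last two conjuncts say that \<open>\<Phi> X Y : Hom(X, Y) \<rightarrow> D Hom(Y, \<nu>X)\<close> is natural
  in \<open>X\<close> and in \<open>Y\<close>.\<close>

definition Serre_functor ::
  "('k, 'r) ring_scheme \<Rightarrow> ('o, 'a, 'k, 'z) lin_cat_scheme \<Rightarrow> ('o, 'a) endofun \<Rightarrow> bool" where
  "Serre_functor K T \<nu> \<longleftrightarrow> autoequivalence K T \<nu> \<and>
     (\<exists>\<Phi>.
        (\<forall>X\<in>Ob T. \<forall>Y\<in>Ob T.
           \<Phi> X Y \<in> module_hom K (Hom T X Y) (dual_space K (Hom T Y (on_ob \<nu> X))) \<and>
           bij_betw (\<Phi> X Y) (Mor T X Y) (carrier (dual_space K (Hom T Y (on_ob \<nu> X))))) \<and>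
        (\<forall>X\<in>Ob T. \<forall>X'\<in>Ob T. \<forall>Y\<in>Ob T.
           \<forall>a\<in>Mor T X' X. \<forall>f\<in>Mor T X Y. \<forall>g\<in>Mor T Y (on_ob \<nu> X').
             \<Phi> X' Y (f \<cdot>\<^bsub>T\<^esub> a) g = \<Phi> X Y f (on_mor \<nu> a \<cdot>\<^bsub>T\<^esub> g)) \<and>
        (\<forall>X\<in>Ob T. \<forall>Y\<in>Ob T. \<forall>Y'\<in>Ob T.
           \<forall>b\<in>Mor T Y Y'. \<forall>f\<in>Mor T X Y. \<forall>g\<in>Mor T Y' (on_ob \<nu> X).
             \<Phi> X Y' (b \<cdot>\<^bsub>T\<^esub> f) g = \<Phi> X Y f (g \<cdot>\<^bsub>T\<^esub> b)))"


section \<open>Triangulated categories\<close>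

text \<open>
  The shift is given by strictly compatible functors \<open>[n]\<close> for all integers \<open>n\<close>, i.e.
  \<open>[1]\<close> is an automorphism with inverse \<open>[-1]\<close>.
  \<open>dist T X Y Z f g h\<close> means that \<open>X \<rightarrow> Y \<rightarrow> Z \<rightarrow> X[1]\<close> is a distinguished triangle.
\<close>

record ('o, 'a, 'k) tri_cat = "('o, 'a, 'k) lin_cat" +
  Shift :: "int \<Rightarrow> ('o, 'a) endofun"
  dist :: "'o \<Rightarrow> 'o \<Rightarrow> 'o \<Rightarrow> 'a \<Rightarrow> 'a \<Rightarrow> 'a \<Rightarrow> bool"

abbreviation sh :: "('o, 'a, 'k, 'z) tri_cat_scheme \<Rightarrow> int \<Rightarrow> 'o \<Rightarrow> 'o" where
  "sh T n \<equiv> on_ob (Shift T n)"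

abbreviation sh_mor :: "('o, 'a, 'k, 'z) tri_cat_scheme \<Rightarrow> int \<Rightarrow> 'a \<Rightarrow> 'a" where
  "sh_mor T n \<equiv> on_mor (Shift T n)"

locale triangulated_category = additive_category K T
  for K :: "('k, 'r) ring_scheme" (structure) and T :: "('o, 'a, 'k, 'z) tri_cat_scheme" +
  assumes Shift_functor: "linear_endofunctor K T (Shift T n)"
    and Shift_zero: "X \<in> Ob T \<Longrightarrow> sh T 0 X = X"
    and Shift_zero_mor: "\<lbrakk>X \<in> Ob T; Y \<in> Ob T; f \<in> Mor T X Y\<rbrakk> \<Longrightarrow> sh_mor T 0 f = f"
    and Shift_add: "X \<in> Ob T \<Longrightarrow> sh T (m + n) X = sh T m (sh T n X)"
    and Shift_add_mor: "\<lbrakk>X \<in> Ob T; Y \<in> Ob T; f \<in> Mor T X Y\<rbrakk> \<Longrightarrow>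
          sh_mor T (m + n) f = sh_mor T m (sh_mor T n f)"
    and dist_closed: "dist T X Y Z f g h \<Longrightarrow> X \<in> Ob T \<and> Y \<in> Ob T \<and> Z \<in> Ob T \<and>
          f \<in> Mor T X Y \<and> g \<in> Mor T Y Z \<and> h \<in> Mor T Z (sh T 1 X)"
    and dist_iso: "\<lbrakk>dist T X Y Z f g h; X' \<in> Ob T; Y' \<in> Ob T; Z' \<in> Ob T;
          f' \<in> Mor T X' Y'; g' \<in> Mor T Y' Z'; h' \<in> Mor T Z' (sh T 1 X');
          iso_arrow T X X' a; iso_arrow T Y Y' b; iso_arrow T Z Z' c;
          b \<cdot>\<^bsub>T\<^esub> f = f' \<cdot>\<^bsub>T\<^esub> a; c \<cdot>\<^bsub>T\<^esub> g = g' \<cdot>\<^bsub>T\<^esub> b; sh_mor T 1 a \<cdot>\<^bsub>T\<^esub> h = h' \<cdot>\<^bsub>T\<^esub> c\<rbrakk> \<Longrightarrow>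
          dist T X' Y' Z' f' g' h'"
    and dist_ident: "\<lbrakk>X \<in> Ob T; zero_object T Z\<rbrakk> \<Longrightarrow>
          dist T X X Z (ident T X) \<zero>\<^bsub>Hom T X Z\<^esub> \<zero>\<^bsub>Hom T Z (sh T 1 X)\<^esub>"
    and dist_exists: "\<lbrakk>X \<in> Ob T; Y \<in> Ob T; f \<in> Mor T X Y\<rbrakk> \<Longrightarrow> \<exists>Z g h. dist T X Y Z f g h"
    and dist_rotate: "\<lbrakk>X \<in> Ob T; Y \<in> Ob T; Z \<in> Ob T;
          f \<in> Mor T X Y; g \<in> Mor T Y Z; h \<in> Mor T Z (sh T 1 X)\<rbrakk> \<Longrightarrow>
          dist T X Y Z f g h \<longleftrightarrow>
          dist T Y Z (sh T 1 X) g h (\<ominus>\<^bsub>Hom T (sh T 1 X) (sh T 1 Y)\<^esub> (sh_mor T 1 f))"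
    and dist_morphism: "\<lbrakk>dist T X Y Z f g h; dist T X' Y' Z' f' g' h';
          a \<in> Mor T X X'; b \<in> Mor T Y Y'; b \<cdot>\<^bsub>T\<^esub> f = f' \<cdot>\<^bsub>T\<^esub> a\<rbrakk> \<Longrightarrow>
          \<exists>c\<in>Mor T Z Z'. c \<cdot>\<^bsub>T\<^esub> g = g' \<cdot>\<^bsub>T\<^esub> b \<and> h' \<cdot>\<^bsub>T\<^esub> c = sh_mor T 1 a \<cdot>\<^bsub>T\<^esub> h"
    and octahedral: "\<lbrakk>dist T X Y Z' f i j; dist T Y Z X' g k l; dist T X Z Y' (g \<cdot>\<^bsub>T\<^esub> f) p q\<rbrakk> \<Longrightarrow>
          \<exists>u v. dist T Z' Y' X' u v (sh_mor T 1 i \<cdot>\<^bsub>T\<^esub> l) \<and>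
            u \<cdot>\<^bsub>T\<^esub> i = p \<cdot>\<^bsub>T\<^esub> g \<and> q \<cdot>\<^bsub>T\<^esub> u = j \<and> v \<cdot>\<^bsub>T\<^esub> p = k \<and> l \<cdot>\<^bsub>T\<^esub> v = sh_mor T 1 f \<cdot>\<^bsub>T\<^esub> q"

definition thick_subcategory :: "('o, 'a, 'k, 'z) tri_cat_scheme \<Rightarrow> 'o set \<Rightarrow> bool" where
  "thick_subcategory T C \<longleftrightarrow> C \<subseteq> Ob T \<and> iso_closed T C \<and> (\<forall>Z. zero_object T Z \<longrightarrow> Z \<in> C) \<and>
     (\<forall>X\<in>C. \<forall>n. sh T n X \<in> C) \<and>
     (\<forall>X Y Z f g h. dist T X Y Z f g h \<and> X \<in> C \<and> Y \<in> C \<longrightarrow> Z \<in> C) \<and>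
     (\<forall>X Y Z. biproduct T [X, Y] Z \<and> Z \<in> C \<longrightarrow> X \<in> C \<and> Y \<in> C)"

definition thick :: "('o, 'a, 'k, 'z) tri_cat_scheme \<Rightarrow> 'o \<Rightarrow> 'o set" where
  "thick T M = \<Inter>{C. thick_subcategory T C \<and> M \<in> C}"


section \<open>t-structures\<close>

text \<open>\<open>U\<close> and \<open>V\<close> are the classes \<open>\<le> 0\<close> and \<open>\<ge> 0\<close>. As \<open>U\<close> and \<open>V\<close> are strict and the shift is an
  automorphism, the classes \<open>\<le> n\<close> and \<open>\<ge> n\<close> are the images of \<open>U\<close> and \<open>V\<close> under \<open>[-n]\<close>.\<close>

definition t_structure :: "('o, 'a, 'k, 'z) tri_cat_scheme \<Rightarrow> 'o set \<Rightarrow> 'o set \<Rightarrow> bool" where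
  "t_structure T U V \<longleftrightarrow> U \<subseteq> Ob T \<and> V \<subseteq> Ob T \<and> iso_closed T U \<and> iso_closed T V \<and>
     (\<forall>X\<in>U. \<forall>Y\<in>sh T (-1) ` V. Hom_vanishes T X Y) \<and>
     U \<subseteq> sh T (-1) ` U \<and> sh T (-1) ` V \<subseteq> V \<and>
     (\<forall>X\<in>Ob T. \<exists>A\<in>U. \<exists>B\<in>sh T (-1) ` V. \<exists>f g h. dist T A X B f g h)"

text \<open>\<open>H\<close> is a value of the cohomological functor of \<open>(U, V)\<close> at \<open>X\<close>: here \<open>A\<close> is the truncation
  of \<open>X\<close> to degrees \<open>\<le> 0\<close> and \<open>H\<close> is the truncation of \<open>A\<close> to degrees \<open>\<ge> 0\<close>.\<close>

definition is_H0 ::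
  "('o, 'a, 'k, 'z) tri_cat_scheme \<Rightarrow> 'o set \<Rightarrow> 'o set \<Rightarrow> 'o \<Rightarrow> 'o \<Rightarrow> bool" where
  "is_H0 T U V X H \<longleftrightarrow>
     (\<exists>A\<in>U. \<exists>B\<in>sh T (-1) ` V. \<exists>C\<in>sh T 1 ` U. \<exists>f g h f' g' h'.
        dist T A X B f g h \<and> H \<in> V \<and> dist T C A H f' g' h')"


section \<open>Semisimple objects and tops in a full subcategory\<close>

text \<open>In this section \<open>C\<close> is a full subcategory given by its objects, and all notions are those of the
  category \<open>C\<close>; they will be applied to the heart of a t-structure, which is abelian.\<close>

definition mono_in :: "('o, 'a, 'k, 'z) lin_cat_scheme \<Rightarrow> 'o set \<Rightarrow> 'o \<Rightarrow> 'o \<Rightarrow> 'a \<Rightarrow> bool" where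
  "mono_in T C X Y f \<longleftrightarrow> X \<in> C \<and> Y \<in> C \<and> f \<in> Mor T X Y \<and>
     (\<forall>W\<in>C. \<forall>g\<in>Mor T W X. \<forall>h\<in>Mor T W X. f \<cdot>\<^bsub>T\<^esub> g = f \<cdot>\<^bsub>T\<^esub> h \<longrightarrow> g = h)"

definition epi_in :: "('o, 'a, 'k, 'z) lin_cat_scheme \<Rightarrow> 'o set \<Rightarrow> 'o \<Rightarrow> 'o \<Rightarrow> 'a \<Rightarrow> bool" where
  "epi_in T C X Y f \<longleftrightarrow> X \<in> C \<and> Y \<in> C \<and> f \<in> Mor T X Y \<and>
     (\<forall>Z\<in>C. \<forall>g\<in>Mor T Y Z. \<forall>h\<in>Mor T Y Z. g \<cdot>\<^bsub>T\<^esub> f = h \<cdot>\<^bsub>T\<^esub> f \<longrightarrow> g = h)"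

definition simple_in :: "('o, 'a, 'k, 'z) lin_cat_scheme \<Rightarrow> 'o set \<Rightarrow> 'o \<Rightarrow> bool" where
  "simple_in T C S \<longleftrightarrow> S \<in> C \<and> \<not> zero_object T S \<and>
     (\<forall>X f. mono_in T C X S f \<longrightarrow> zero_object T X \<or> iso_arrow T X S f)"

text \<open>Only finite direct sums are considered: in a Hom-finite category an infinite coproduct
  of nonzero objects cannot exist.\<close>

definition semisimple_in :: "('o, 'a, 'k, 'z) lin_cat_scheme \<Rightarrow> 'o set \<Rightarrow> 'o \<Rightarrow> bool" where
  "semisimple_in T C S \<longleftrightarrow> S \<in> C \<and> (\<exists>Ss. biproduct T Ss S \<and> (\<forall>S'\<in>set Ss. simple_in T C S'))"

text \<open>The largest semisimple quotient: every semisimple quotient factors through it.\<close>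

definition is_top :: "('o, 'a, 'k, 'z) lin_cat_scheme \<Rightarrow> 'o set \<Rightarrow> 'o \<Rightarrow> 'o \<Rightarrow> bool" where
  "is_top T C H S \<longleftrightarrow> semisimple_in T C S \<and>
     (\<exists>p. epi_in T C H S p \<and>
        (\<forall>S' q. semisimple_in T C S' \<and> epi_in T C H S' q \<longrightarrow> (\<exists>r\<in>Mor T S S'. q = r \<cdot>\<^bsub>T\<^esub> p)))"


section \<open>Silting objects\<close>

definition silt :: "('o, 'a, 'k, 'z) tri_cat_scheme \<Rightarrow> 'o set" where
  "silt T = {M \<in> Ob T. (\<forall>i>0. Hom_vanishes T M (sh T i M)) \<and> thick T M = Ob T}"

definition silt_ge :: "('o, 'a, 'k, 'z) tri_cat_scheme \<Rightarrow> 'o \<Rightarrow> 'o \<Rightarrow> bool" where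
  "silt_ge T M N \<longleftrightarrow> (\<forall>i>0. Hom_vanishes T M (sh T i N))"

definition aisle :: "('o, 'a, 'k, 'z) tri_cat_scheme \<Rightarrow> 'o \<Rightarrow> 'o set" where
  "aisle T M = {X \<in> Ob T. \<forall>i>0. Hom_vanishes T M (sh T i X)}"

definition coaisle :: "('o, 'a, 'k, 'z) tri_cat_scheme \<Rightarrow> 'o \<Rightarrow> 'o set" where
  "coaisle T M = {X \<in> Ob T. \<forall>i<0. Hom_vanishes T M (sh T i X)}"

definition heart :: "('o, 'a, 'k, 'z) tri_cat_scheme \<Rightarrow> 'o \<Rightarrow> 'o set" where
  "heart T M = aisle T M \<inter> coaisle T M"

text \<open>\<open>\<nu>\<^sub>d = \<nu> \<circ> [-d]\<close>\<close>

definition nu_d :: "('o, 'a, 'k, 'z) tri_cat_scheme \<Rightarrow> ('o, 'a) endofun \<Rightarrow> int \<Rightarrow> ('o, 'a) endofun" where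
  "nu_d T \<nu> d = comp_fun \<nu> (Shift T (- d))"

text \<open>Here \<open>G\<close> is a quasi-inverse of \<open>\<nu>\<^sub>d\<close>, through which \<open>d\<close> enters.\<close>

definition silt_d :: "('o, 'a, 'k, 'z) tri_cat_scheme \<Rightarrow> ('o, 'a) endofun \<Rightarrow> 'o set" where
  "silt_d T G = {N \<in> silt T. silt_ge T N (on_ob G N)}"

definition proj_dim_le :: "('o, 'a, 'k, 'z) tri_cat_scheme \<Rightarrow> 'o \<Rightarrow> 'o \<Rightarrow> int \<Rightarrow> bool" where
  "proj_dim_le T M X m \<longleftrightarrow>
     (if m < 0 then zero_object T X
      else \<forall>H\<in>heart T M. \<forall>i>m. Hom_vanishes T X (sh T i H))"

definition left_approximation ::
  "('o, 'a, 'k, 'z) lin_cat_scheme \<Rightarrow> 'o set \<Rightarrow> 'o \<Rightarrow> 'o \<Rightarrow> 'a \<Rightarrow> bool" where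
  "left_approximation T C X Y f \<longleftrightarrow> Y \<in> C \<and> f \<in> Mor T X Y \<and>
     (\<forall>Y'\<in>C. \<forall>g\<in>Mor T X Y'. \<exists>h\<in>Mor T Y Y'. g = h \<cdot>\<^bsub>T\<^esub> f)"

text \<open>\<open>N\<close> is a left mutation of \<open>M\<close> at \<open>X\<close>, for some choice of the complement \<open>Y\<close>,
  the approximation and the triangle.\<close>

definition is_left_mutation :: "('o, 'a, 'k, 'z) tri_cat_scheme \<Rightarrow> 'o \<Rightarrow> 'o \<Rightarrow> 'o \<Rightarrow> bool" where
  "is_left_mutation T M X N \<longleftrightarrow>
     (\<exists>Y P Y0 X' f g h.
        Y \<in> add_closure T M \<and> biproduct T [X, Y] P \<and> add_closure T P = add_closure T M \<and>
        (\<forall>Z \<in> add_closure T X \<inter> add_closure T Y. zero_object T Z) \<and>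
        left_approximation T (add_closure T Y) X Y0 f \<and> dist T X Y0 X' f g h \<and>
        biproduct T [X', Y] N)"

end

theory Submission
  imports Defs
begin

text \<open>
  Write \<open>G = \<nu>\<^sub>d\<^sup>-\<^sup>1\<close>. Serre duality enters only through the vanishing of morphism spaces:
  \<open>T(GZ, Q[d]) = 0\<close> iff \<open>T(Q, Z) = 0\<close>. Condition (T3) puts \<open>GM\<close> into the aisle, so \<open>T(S, M[i])\<close>
  vanishes for \<open>i > d\<close>, and devissage turns \<open>proj.dim S < d\<close> into \<open>T(S, M[d]) = 0\<close>,
  i.e. \<open>T(GM, S) = 0\<close>.

  For an object \<open>Z\<close> of the aisle, \<open>T(Z, S) = 0\<close> iff \<open>T(X', Z[1]) = 0\<close>: every morphism \<open>X \<rightarrow> Z\<close> factors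
  through \<open>add Y\<close> iff \<open>H\<^sup>0 Z\<close> has no simple quotient in \<open>add S\<close>. With \<open>Z = GM\<close> this is the equivalence of
  the first two conditions, and with \<open>Z = GN\<close> the third condition yields \<open>T(S, Y[d]) = 0\<close>. The cone
  of a right \<open>add Y\<close>-approximation of \<open>X\<close> is, up to an object of the shifted aisle, filtered by summands of \<open>S\<close>;
  so \<open>T(S, S[d]) = 0\<close> gives \<open>T(S, X[d]) = 0\<close>, hence \<open>T(S, M[d]) = 0\<close>.
\<close>

text \<open>Two facts that are usually quoted are neither assumed nor established: that the heart is
  abelian, and that \<open>\<nu>\<close> and \<open>G\<close> commute with shifts or preserve
  triangles. The first gap is closed with triangles: kernels and cokernels in the heart appear as
  shifted cones and truncations, \<open>le (-1) C\<close> for a cone \<open>C\<close> expresses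
  surjectivity, and \<open>M\<close> is projective because \<open>van M C\<close> for every such
  \<open>C\<close>. Finite length is replaced by induction on the dimension of
  \<open>T(M, L)\<close>, which is additive on short exact sequences of the heart. The second gap
  means that no devissage can be made in the argument of \<open>G\<close>: where
  \<open>T(N, GN[i]) = 0\<close> has to be proved, Serre duality is applied twice to turn it into
  \<open>T(\<nu>N, N[i + d]) = 0\<close>, and there the mutation triangle acts on the target.
  Approximations are built by iterated extensions, and of the approximating object only the
  vanishing that it inherits is recorded; the long exact sequences ask for no more.\<close>

section \<open>Linear algebra\<close>

text \<open>The functional is a coordinate with respect to a finite basis. In the Serre pairing it
  shows that a space whose dual is trivial is itself zero.\<close>

lemma (in vectorspace) nonzero_functional:
  assumes fd: "fin_dim" and nz: "carrier V \<noteq> {\<zero>\<^bsub>V\<^esub>}"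
  shows "\<exists>f \<in> extensional (carrier V) \<inter> module_hom K V (regular_module K). \<exists>v\<in>carrier V. f v \<noteq> \<zero>\<^bsub>K\<^esub>"
proof -
  obtain B where B: "finite B" "basis B" using finite_basis_exists[OF fd] by auto
  have BC: "B \<subseteq> carrier V" using B by (auto simp: basis_def)
  have "B \<noteq> {}"
  proof
    assume "B = {}"
    then have "span {} = carrier V" using B by (auto simp: basis_def)
    then show False using nz span_empty by simp
  qed
  then obtain b where b: "b \<in> B" by auto
  interpret l: linear_map K "func_space B" V "\<lambda>a. lincomb a B"
    by (rule lincomb_is_linear[OF B(1) BC])
  have ex1: "\<exists>!a. a \<in> B \<rightarrow>\<^sub>E carrier K \<and> lincomb a B = v" if "v \<in> carrier V" for v
    using basis_criterion[OF B(1) BC] B(2) that by blast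
  define co where "co v = (THE a. a \<in> B \<rightarrow>\<^sub>E carrier K \<and> lincomb a B = v)" for v
  have co: "co v \<in> B \<rightarrow>\<^sub>E carrier K" "lincomb (co v) B = v" if "v \<in> carrier V" for v
    using theI'[OF ex1[OF that]] unfolding co_def by auto
  have co_eq: "co v = a" if "a \<in> B \<rightarrow>\<^sub>E carrier K" "lincomb a B = v" "v \<in> carrier V" for a v
    using ex1[OF that(3)] that co[OF that(3)] by blast
  have cof: "carrier (func_space B) = B \<rightarrow>\<^sub>E carrier K" by (simp add: func_space_def)
  define f where "f = restrict (\<lambda>v. co v b) (carrier V)"
  have fv: "f v = co v b" if "v \<in> carrier V" for v using that by (simp add: f_def)
  have add: "co (v \<oplus>\<^bsub>V\<^esub> w) = co v \<oplus>\<^bsub>func_space B\<^esub> co w" if v: "v \<in> carrier V" and w: "w \<in> carrier V" for v w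
  proof (rule co_eq)
    show "co v \<oplus>\<^bsub>func_space B\<^esub> co w \<in> B \<rightarrow>\<^sub>E carrier K"
      using l.V.module.M.a_closed[unfolded cof] co v w by blast
    show "lincomb (co v \<oplus>\<^bsub>func_space B\<^esub> co w) B = v \<oplus>\<^bsub>V\<^esub> w"
      using l.T_add[unfolded cof] co v w by simp
    show "v \<oplus>\<^bsub>V\<^esub> w \<in> carrier V" using v w by simp
  qed
  have smult: "co (r \<odot>\<^bsub>V\<^esub> v) = r \<odot>\<^bsub>func_space B\<^esub> co v" if v: "v \<in> carrier V" and r: "r \<in> carrier K" for r v
  proof (rule co_eq)
    show "r \<odot>\<^bsub>func_space B\<^esub> co v \<in> B \<rightarrow>\<^sub>E carrier K"
      using l.V.module.smult_closed[unfolded cof] co v r by blast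
    show "lincomb (r \<odot>\<^bsub>func_space B\<^esub> co v) B = r \<odot>\<^bsub>V\<^esub> v"
      using l.T_smult[unfolded cof] co v r by simp
    show "r \<odot>\<^bsub>V\<^esub> v \<in> carrier V" using v r by simp
  qed
  have cob: "co v b \<in> carrier K" if "v \<in> carrier V" for v using PiE_mem[OF co(1)[OF that] b] .
  have hom: "f \<in> module_hom K V (regular_module K)"
    unfolding module_hom_def regular_module_def
    using b cob by (auto simp: fv add smult func_space_def)
  have "f b = \<one>\<^bsub>K\<^esub>"
  proof -
    \<comment> \<open>The Kronecker delta at \<open>b\<close> represents \<open>b\<close> itself, so
      uniqueness of coordinates gives \<open>f b = 1\<close>.\<close>
    let ?a = "restrict (\<lambda>x. if x = b then \<one>\<^bsub>K\<^esub> else \<zero>\<^bsub>K\<^esub>) B"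
    have bV: "b \<in> carrier V" using b BC by auto
    have "lincomb ?a B = (\<Oplus>\<^bsub>V\<^esub>x\<in>B. if x = b then b else \<zero>\<^bsub>V\<^esub>)"
      unfolding lincomb_def
      by (rule M.finsum_cong') (use BC bV in auto)
    also have "\<dots> = b"
      using M.finsum_singleton[of b B "\<lambda>_. b"] B b bV by (auto simp: eq_commute cong: if_cong)
    finally have "co b = ?a" by (intro co_eq) (use bV in auto)
    then show ?thesis using fv[OF bV] b by simp
  qed
  then have "f b \<noteq> \<zero>\<^bsub>K\<^esub>" using field.one_not_zero by simp
  moreover have "f \<in> extensional (carrier V)" by (simp add: f_def)
  ultimately show ?thesis using hom b BC by blast
qed

lemma (in vectorspace) dim_pos:
  assumes fd: "fin_dim" and nz: "carrier V \<noteq> {\<zero>\<^bsub>V\<^esub>}"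
  shows "dim > 0"
proof (rule ccontr)
  assume "\<not> dim > 0"
  obtain B where B: "finite B" "basis B" using finite_basis_exists[OF fd] by auto
  then have "B = {}" using dim_basis \<open>\<not> dim > 0\<close> by auto
  then have "span {} = carrier V" using B by (auto simp: basis_def)
  then show False using nz span_empty by simp
qed

text \<open>Rank-nullity twice: for \<open>i\<close>, whose kernel is trivial, and for
  \<open>p\<close>, whose kernel is the image of \<open>i\<close>.\<close>

lemma dim_short_exact:
  assumes U: "vectorspace K U" and V: "vectorspace K V" and W: "vectorspace K W"
    and i: "i \<in> module_hom K U V" and p: "p \<in> module_hom K V W"
    and fdU: "vectorspace.fin_dim K U" and fdV: "vectorspace.fin_dim K V"
    and inj: "inj_on i (carrier U)" and surj: "p ` carrier V = carrier W"
    and ex: "i ` carrier U = {v \<in> carrier V. p v = \<zero>\<^bsub>W\<^esub>}"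
  shows "vectorspace.dim K V = vectorspace.dim K U + vectorspace.dim K W"
proof -
  interpret U: vectorspace K U by fact
  interpret V: vectorspace K V by fact
  interpret W: vectorspace K W by fact
  interpret i: linear_map K U V i
    by (intro linear_map.intro U V mod_hom.intro mod_hom_axioms.intro i) unfold_locales
  interpret p: linear_map K V W p
    by (intro linear_map.intro V W mod_hom.intro mod_hom_axioms.intro p) unfold_locales
  have "p.kerT = i.imT" using ex by (simp add: p.ker_def i.im_def)
  moreover have "vectorspace.dim K (V.vs i.imT) = U.dim"
    using i.rank_nullity[OF fdU] i.inj_imp_dim_ker0[OF inj] by simp
  moreover have "p.imT = carrier W" using surj by (simp add: p.im_def)
  ultimately show ?thesis using p.rank_nullity[OF fdV] by simp
qed

section \<open>Linear categories\<close>

lemma (in mod_hom) hom_finsum: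
  assumes "finite A" "g \<in> A \<rightarrow> carrier M"
  shows "f (\<Oplus>\<^bsub>M\<^esub>a\<in>A. g a) = (\<Oplus>\<^bsub>N\<^esub>a\<in>A. f (g a))"
  using assms
proof (induction A rule: finite_induct)
  case (insert a A)
  then have g: "g \<in> A \<rightarrow> carrier M" "g a \<in> carrier M" by auto
  then have "f (\<Oplus>\<^bsub>M\<^esub>a\<in>insert a A. g a) = f (g a) \<oplus>\<^bsub>N\<^esub> f (\<Oplus>\<^bsub>M\<^esub>a\<in>A. g a)"
    using insert(1,2) by (simp add: M.M.finsum_insert M.M.finsum_closed)
  also have "\<dots> = f (g a) \<oplus>\<^bsub>N\<^esub> (\<Oplus>\<^bsub>N\<^esub>a\<in>A. f (g a))" using insert.IH g by simp
  also have "\<dots> = (\<Oplus>\<^bsub>N\<^esub>a\<in>insert a A. f (g a))"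
    using insert(1,2) g by (subst N.M.finsum_insert) auto
  finally show ?case .
qed simp

context linear_category
begin

abbreviation comp_T (infixl "\<star>" 70) where "g \<star> f \<equiv> g \<cdot>\<^bsub>T\<^esub> f"
abbreviation zero_T ("0[_,_]") where "0[X,Y] \<equiv> \<zero>\<^bsub>Hom T X Y\<^esub>"
abbreviation van where "van \<equiv> Hom_vanishes T"

lemma Hom_module:
  assumes "X \<in> Ob T" "Y \<in> Ob T"
  shows "module K (Hom T X Y)"
proof -
  interpret vectorspace K "Hom T X Y" using assms by (rule Hom_vectorspace)
  show ?thesis by unfold_locales
qed

lemma Hom_abelian_group:
  assumes "X \<in> Ob T" "Y \<in> Ob T"
  shows "abelian_group (Hom T X Y)"
  using Hom_module[OF assms] by (rule module.axioms(2))

lemma zero_closed: "\<lbrakk>X \<in> Ob T; Y \<in> Ob T\<rbrakk> \<Longrightarrow> 0[X,Y] \<in> Mor T X Y"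
  by (rule abelian_monoid.zero_closed[OF abelian_group.axioms(1)[OF Hom_abelian_group]])

lemma minus_closed: "\<lbrakk>X \<in> Ob T; Y \<in> Ob T; f \<in> Mor T X Y; g \<in> Mor T X Y\<rbrakk> \<Longrightarrow> f \<ominus>\<^bsub>Hom T X Y\<^esub> g \<in> Mor T X Y"
  by (rule abelian_group.minus_closed[OF Hom_abelian_group])

lemma neg_closed: "\<lbrakk>X \<in> Ob T; Y \<in> Ob T; f \<in> Mor T X Y\<rbrakk> \<Longrightarrow> \<ominus>\<^bsub>Hom T X Y\<^esub> f \<in> Mor T X Y"
  by (rule abelian_group.a_inv_closed[OF Hom_abelian_group])

lemma minus_eq_zero_iff:
  assumes "X \<in> Ob T" "Y \<in> Ob T" "f \<in> Mor T X Y" "g \<in> Mor T X Y"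
  shows "f \<ominus>\<^bsub>Hom T X Y\<^esub> g = 0[X,Y] \<longleftrightarrow> f = g"
proof -
  interpret H: abelian_group "Hom T X Y" using assms(1,2) by (rule Hom_abelian_group)
  show ?thesis using assms(3,4) by (rule H.minus_other_side)
qed

lemma neg_neg: "\<lbrakk>X \<in> Ob T; Y \<in> Ob T; f \<in> Mor T X Y\<rbrakk> \<Longrightarrow> \<ominus>\<^bsub>Hom T X Y\<^esub> (\<ominus>\<^bsub>Hom T X Y\<^esub> f) = f"
  by (rule abelian_group.minus_minus[OF Hom_abelian_group])

lemma neg_zero:
  assumes "X \<in> Ob T" "Y \<in> Ob T"
  shows "\<ominus>\<^bsub>Hom T X Y\<^esub> 0[X,Y] = 0[X,Y]"
proof -
  interpret H: abelian_group "Hom T X Y" using assms(1,2) by (rule Hom_abelian_group)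
  show ?thesis by simp
qed

lemma comp_closed:
  "\<lbrakk>X \<in> Ob T; Y \<in> Ob T; Z \<in> Ob T; f \<in> Mor T X Y; g \<in> Mor T Y Z\<rbrakk> \<Longrightarrow> g \<star> f \<in> Mor T X Z"
  using comp_linear_left[of X Y Z f] by (auto simp: module_hom_def)

lemma mod_homI: "\<lbrakk>X \<in> Ob T; Y \<in> Ob T; X' \<in> Ob T; Y' \<in> Ob T; \<phi> \<in> module_hom K (Hom T X Y) (Hom T X' Y')\<rbrakk>
    \<Longrightarrow> mod_hom K (Hom T X Y) (Hom T X' Y') \<phi>"
  by (intro mod_hom.intro mod_hom_axioms.intro Hom_module)

lemma mod_hom_left: "\<lbrakk>X \<in> Ob T; Y \<in> Ob T; Z \<in> Ob T; f \<in> Mor T X Y\<rbrakk> \<Longrightarrow> mod_hom K (Hom T Y Z) (Hom T X Z) (\<lambda>g. g \<star> f)"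
  using comp_linear_left by (simp add: mod_homI)

lemma mod_hom_right: "\<lbrakk>X \<in> Ob T; Y \<in> Ob T; Z \<in> Ob T; g \<in> Mor T Y Z\<rbrakk> \<Longrightarrow> mod_hom K (Hom T X Y) (Hom T X Z) (\<lambda>f. g \<star> f)"
  using comp_linear_right by (simp add: mod_homI)

lemma comp_zero_left: "\<lbrakk>X \<in> Ob T; Y \<in> Ob T; Z \<in> Ob T; f \<in> Mor T X Y\<rbrakk> \<Longrightarrow> 0[Y,Z] \<star> f = 0[X,Z]"
  by (rule mod_hom.f0_is_0[OF mod_hom_left])

lemma comp_zero_right: "\<lbrakk>X \<in> Ob T; Y \<in> Ob T; Z \<in> Ob T; g \<in> Mor T Y Z\<rbrakk> \<Longrightarrow> g \<star> 0[X,Y] = 0[X,Z]"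
  by (rule mod_hom.f0_is_0[OF mod_hom_right])

lemma comp_minus_left: "\<lbrakk>X \<in> Ob T; Y \<in> Ob T; Z \<in> Ob T; f \<in> Mor T X Y; g \<in> Mor T Y Z; h \<in> Mor T Y Z\<rbrakk>
    \<Longrightarrow> (g \<ominus>\<^bsub>Hom T Y Z\<^esub> h) \<star> f = g \<star> f \<ominus>\<^bsub>Hom T X Z\<^esub> h \<star> f"
  by (rule mod_hom.f_minus[OF mod_hom_left])

lemma comp_minus_right: "\<lbrakk>X \<in> Ob T; Y \<in> Ob T; Z \<in> Ob T; g \<in> Mor T Y Z; f \<in> Mor T X Y; h \<in> Mor T X Y\<rbrakk>
    \<Longrightarrow> g \<star> (f \<ominus>\<^bsub>Hom T X Y\<^esub> h) = g \<star> f \<ominus>\<^bsub>Hom T X Z\<^esub> g \<star> h"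
  by (rule mod_hom.f_minus[OF mod_hom_right])

lemma comp_neg_left: "\<lbrakk>X \<in> Ob T; Y \<in> Ob T; Z \<in> Ob T; f \<in> Mor T X Y; g \<in> Mor T Y Z\<rbrakk>
    \<Longrightarrow> (\<ominus>\<^bsub>Hom T Y Z\<^esub> g) \<star> f = \<ominus>\<^bsub>Hom T X Z\<^esub> (g \<star> f)"
  by (rule mod_hom.f_neg[OF mod_hom_left])

lemma comp_neg_right: "\<lbrakk>X \<in> Ob T; Y \<in> Ob T; Z \<in> Ob T; g \<in> Mor T Y Z; f \<in> Mor T X Y\<rbrakk>
    \<Longrightarrow> g \<star> (\<ominus>\<^bsub>Hom T X Y\<^esub> f) = \<ominus>\<^bsub>Hom T X Z\<^esub> (g \<star> f)"
  by (rule mod_hom.f_neg[OF mod_hom_right])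

lemma vanI: "\<lbrakk>X \<in> Ob T; Y \<in> Ob T; \<And>f. f \<in> Mor T X Y \<Longrightarrow> f = 0[X,Y]\<rbrakk> \<Longrightarrow> van X Y"
  using zero_closed by (auto simp: Hom_vanishes_def)

lemma vanD: "\<lbrakk>van X Y; f \<in> Mor T X Y\<rbrakk> \<Longrightarrow> f = 0[X,Y]"
  by (auto simp: Hom_vanishes_def)

lemma zero_object_iff:
  assumes X: "X \<in> Ob T"
  shows "zero_object T X \<longleftrightarrow> van X X"
proof
  assume v: "van X X"
  then have i: "ident T X = 0[X,X]" using vanD ident_closed X by blast
  show "zero_object T X"
    unfolding zero_object_def
  proof (intro conjI ballI X)
    fix Y assume Y: "Y \<in> Ob T"
    show "van X Y"
    proof (rule vanI[OF X Y])
      fix f assume f: "f \<in> Mor T X Y"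
      have "f = f \<star> 0[X,X]" using ident_right[OF X Y f] i by simp
      then show "f = 0[X,Y]" using comp_zero_right[OF X X Y f] by simp
    qed
    show "van Y X"
    proof (rule vanI[OF Y X])
      fix f assume f: "f \<in> Mor T Y X"
      have "f = 0[X,X] \<star> f" using ident_left[OF Y X f] i by simp
      then show "f = 0[Y,X]" using comp_zero_left[OF Y X X f] by simp
    qed
  qed
qed (auto simp: zero_object_def)

lemma zero_object_if_ident:
  assumes X: "X \<in> Ob T" and z: "ident T X = 0[X,X]"
  shows "zero_object T X"
  unfolding zero_object_iff[OF X]
proof (rule vanI[OF X X])
  fix f assume f: "f \<in> Mor T X X"
  show "f = 0[X,X]" using ident_right[OF X X f] comp_zero_right[OF X X X f] z by simp
qed

lemma van_retract:
  assumes X: "X \<in> Ob T" and Y: "Y \<in> Ob T" and i: "i \<in> Mor T X Y" and p: "p \<in> Mor T Y X"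
    and pi: "p \<star> i = ident T X" and W: "W \<in> Ob T"
  shows "van W Y \<Longrightarrow> van W X" "van Y W \<Longrightarrow> van X W"
proof -
  show "van W X" if v: "van W Y"
  proof (rule vanI[OF W X])
    fix f assume f: "f \<in> Mor T W X"
    have "f = p \<star> (i \<star> f)" using comp_assoc[OF W X Y X f i p] ident_left[OF W X f] pi by simp
    also have "i \<star> f = 0[W,Y]" using vanD[OF v] comp_closed[OF W X Y f i] by blast
    finally show "f = 0[W,X]" using comp_zero_right[OF W Y X p] by simp
  qed
  show "van X W" if v: "van Y W"
  proof (rule vanI[OF X W])
    fix f assume f: "f \<in> Mor T X W"
    have "f = (f \<star> p) \<star> i" using comp_assoc[OF X Y X W i p f] ident_right[OF X W f] pi by simp
    also have "f \<star> p = 0[Y,W]" using vanD[OF v] comp_closed[OF Y X W p f] by blast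
    finally show "f = 0[X,W]" using comp_zero_left[OF X Y W i] by simp
  qed
qed

lemma iso_arrowE:
  assumes "iso_arrow T X Y f"
  obtains g where "f \<in> Mor T X Y" "g \<in> Mor T Y X" "g \<star> f = ident T X" "f \<star> g = ident T Y"
  using assms by (auto simp: iso_arrow_def)

lemma iso_arrow_ident: "X \<in> Ob T \<Longrightarrow> iso_arrow T X X (ident T X)"
  unfolding iso_arrow_def using ident_closed ident_left by blast

text \<open>The decomposition of the identity of \<open>Z\<close> is traded for two cancellation
  rules: a morphism into or out of \<open>Z\<close> vanishes once all its components do. This spares
  later arguments the finite sum.\<close>

lemma biproductE:
  assumes "biproduct T Xs Z"
  obtains inc prj where "Z \<in> Ob T" "\<And>i. i < length Xs \<Longrightarrow> Xs ! i \<in> Ob T"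
    "\<And>i. i < length Xs \<Longrightarrow> inc i \<in> Mor T (Xs ! i) Z" "\<And>i. i < length Xs \<Longrightarrow> prj i \<in> Mor T Z (Xs ! i)"
    "\<And>i. i < length Xs \<Longrightarrow> prj i \<star> inc i = ident T (Xs ! i)"
    "\<And>W f. \<lbrakk>W \<in> Ob T; f \<in> Mor T W Z; \<And>i. i < length Xs \<Longrightarrow> prj i \<star> f = 0[W, Xs ! i]\<rbrakk> \<Longrightarrow> f = 0[W,Z]"
    "\<And>W f. \<lbrakk>W \<in> Ob T; f \<in> Mor T Z W; \<And>i. i < length Xs \<Longrightarrow> f \<star> inc i = 0[Xs ! i, W]\<rbrakk> \<Longrightarrow> f = 0[Z,W]"
proof -
  from assms obtain inc prj where Z: "Z \<in> Ob T" and Xs: "set Xs \<subseteq> Ob T"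
    and ip: "\<And>i. i < length Xs \<Longrightarrow> inc i \<in> Mor T (Xs ! i) Z \<and> prj i \<in> Mor T Z (Xs ! i)"
    and d: "\<And>i j. \<lbrakk>i < length Xs; j < length Xs\<rbrakk> \<Longrightarrow>
           prj j \<star> inc i = (if i = j then ident T (Xs ! i) else 0[Xs ! i, Xs ! j])"
    and s: "finsum (Hom T Z Z) (\<lambda>i. inc i \<star> prj i) {..<length Xs} = ident T Z"
    unfolding biproduct_def by blast
  have Xi: "\<And>i. i < length Xs \<Longrightarrow> Xs ! i \<in> Ob T" using Xs by auto
  have cl: "inc i \<star> prj i \<in> Mor T Z Z" if "i < length Xs" for i
    using comp_closed[OF Z Xi Z] ip that by blast
  show thesis
  proof (rule that[OF Z, of inc prj])
    fix W f assume W: "W \<in> Ob T" and f: "f \<in> Mor T W Z"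
      and z: "\<And>i. i < length Xs \<Longrightarrow> prj i \<star> f = 0[W, Xs ! i]"
    interpret h: mod_hom K "Hom T Z Z" "Hom T W Z" "\<lambda>g. g \<star> f" using mod_hom_left[OF W Z Z f] .
    have "f = finsum (Hom T Z Z) (\<lambda>i. inc i \<star> prj i) {..<length Xs} \<star> f"
      using ident_left[OF W Z f] s by simp
    also have "\<dots> = finsum (Hom T W Z) (\<lambda>i. (inc i \<star> prj i) \<star> f) {..<length Xs}"
      by (rule h.hom_finsum) (use cl in auto)
    also have "\<dots> = finsum (Hom T W Z) (\<lambda>i. 0[W,Z]) {..<length Xs}"
    proof (rule h.N.M.finsum_cong')
      fix i assume "i \<in> {..<length Xs}"
      then have i: "i < length Xs" by simp
      show "(inc i \<star> prj i) \<star> f = 0[W,Z]"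
        using comp_assoc[OF W Z Xi[OF i] Z f] ip[OF i] z[OF i] comp_zero_right[OF W Xi[OF i] Z] by simp
    qed auto
    finally show "f = 0[W,Z]" by simp
  next
    fix W f assume W: "W \<in> Ob T" and f: "f \<in> Mor T Z W"
      and z: "\<And>i. i < length Xs \<Longrightarrow> f \<star> inc i = 0[Xs ! i, W]"
    interpret h: mod_hom K "Hom T Z Z" "Hom T Z W" "\<lambda>g. f \<star> g" using mod_hom_right[OF Z Z W f] .
    have "f = f \<star> finsum (Hom T Z Z) (\<lambda>i. inc i \<star> prj i) {..<length Xs}"
      using ident_right[OF Z W f] s by simp
    also have "\<dots> = finsum (Hom T Z W) (\<lambda>i. f \<star> (inc i \<star> prj i)) {..<length Xs}"
      by (rule h.hom_finsum) (use cl in auto)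
    also have "\<dots> = finsum (Hom T Z W) (\<lambda>i. 0[Z,W]) {..<length Xs}"
    proof (rule h.N.M.finsum_cong')
      fix i assume "i \<in> {..<length Xs}"
      then have i: "i < length Xs" by simp
      show "f \<star> (inc i \<star> prj i) = 0[Z,W]"
        using comp_assoc[OF Z Xi[OF i] Z W _ _ f, symmetric] ip[OF i] z[OF i] comp_zero_left[OF Z Xi[OF i] W] by simp
    qed auto
    finally show "f = 0[Z,W]" by simp
  qed (use Xi ip d in auto)
qed

end

section \<open>Exact sequences of a triangle\<close>

lemma (in additive_category) zero_object_exists: "\<exists>Z. zero_object T Z"
proof -
  obtain Z where Z: "biproduct T [] Z" using finite_biproducts[of "[]"] by auto
  have "Z \<in> Ob T" using Z by (simp add: biproduct_def)
  moreover have "van Z Z"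
    using Z
  proof (rule biproductE, goal_cases)
    case (1 inc prj)
    then show ?case by (intro vanI) auto
  qed
  ultimately show ?thesis using zero_object_iff by blast
qed

context triangulated_category
begin

lemma sh_ob: "X \<in> Ob T \<Longrightarrow> sh T n X \<in> Ob T"
  using Shift_functor[of n] by (auto simp: linear_endofunctor_def)

lemma sh_hom: "\<lbrakk>X \<in> Ob T; Y \<in> Ob T\<rbrakk> \<Longrightarrow> sh_mor T n \<in> module_hom K (Hom T X Y) (Hom T (sh T n X) (sh T n Y))"
  using Shift_functor[of n] by (auto simp: linear_endofunctor_def)

lemma sh_mor_closed: "\<lbrakk>X \<in> Ob T; Y \<in> Ob T; f \<in> Mor T X Y\<rbrakk> \<Longrightarrow> sh_mor T n f \<in> Mor T (sh T n X) (sh T n Y)"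
  using sh_hom[of X Y n] by (auto simp: module_hom_def)

lemma sh_mor_comp: "\<lbrakk>X \<in> Ob T; Y \<in> Ob T; Z \<in> Ob T; f \<in> Mor T X Y; g \<in> Mor T Y Z\<rbrakk>
   \<Longrightarrow> sh_mor T n (g \<star> f) = sh_mor T n g \<star> sh_mor T n f"
  using Shift_functor[of n] by (auto simp: linear_endofunctor_def)

lemma sh_mor_ident: "X \<in> Ob T \<Longrightarrow> sh_mor T n (ident T X) = ident T (sh T n X)"
  using Shift_functor[of n] by (auto simp: linear_endofunctor_def)

lemma sh_mod_hom: "\<lbrakk>X \<in> Ob T; Y \<in> Ob T\<rbrakk> \<Longrightarrow> mod_hom K (Hom T X Y) (Hom T (sh T n X) (sh T n Y)) (sh_mor T n)"
  by (rule mod_homI) (auto simp: sh_ob sh_hom)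

lemma sh_mor_zero: "\<lbrakk>X \<in> Ob T; Y \<in> Ob T\<rbrakk> \<Longrightarrow> sh_mor T n 0[X,Y] = 0[sh T n X, sh T n Y]"
  by (rule mod_hom.f0_is_0[OF sh_mod_hom])

lemma sh_mor_neg: "\<lbrakk>X \<in> Ob T; Y \<in> Ob T; f \<in> Mor T X Y\<rbrakk>
   \<Longrightarrow> sh_mor T n (\<ominus>\<^bsub>Hom T X Y\<^esub> f) = \<ominus>\<^bsub>Hom T (sh T n X) (sh T n Y)\<^esub> sh_mor T n f"
  by (rule mod_hom.f_neg[OF sh_mod_hom])

lemma sh_sh: "X \<in> Ob T \<Longrightarrow> sh T m (sh T n X) = sh T (m + n) X"
  by (simp add: Shift_add)

lemma sh_mor_sh_mor: "\<lbrakk>X \<in> Ob T; Y \<in> Ob T; f \<in> Mor T X Y\<rbrakk> \<Longrightarrow> sh_mor T m (sh_mor T n f) = sh_mor T (m + n) f"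
  by (simp add: Shift_add_mor)

lemma van_shift:
  assumes X: "X \<in> Ob T" and Y: "Y \<in> Ob T" and v: "van X Y"
  shows "van (sh T n X) (sh T n Y)"
proof (rule vanI)
  fix f assume f: "f \<in> Mor T (sh T n X) (sh T n Y)"
  note [simp] = X Y sh_ob sh_sh Shift_zero
  have "sh_mor T (- n) f \<in> Mor T X Y"
    using sh_mor_closed[OF _ _ f, of "- n"] by simp
  then have "sh_mor T (- n) f = 0[X,Y]" by (rule vanD[OF v])
  then have "sh_mor T n (sh_mor T (- n) f) = 0[sh T n X, sh T n Y]" by (simp add: sh_mor_zero)
  moreover have "sh_mor T n (sh_mor T (- n) f) = f"
    using sh_mor_sh_mor[OF _ _ f, of n "- n"] Shift_zero_mor[OF _ _ f] by simp
  ultimately show "f = 0[sh T n X, sh T n Y]" by simp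
qed (auto simp: X Y sh_ob)

lemma van_sh_left:
  assumes X: "X \<in> Ob T" and Y: "Y \<in> Ob T"
  shows "van (sh T n X) Y \<longleftrightarrow> van X (sh T (- n) Y)"
proof
  assume "van (sh T n X) Y"
  from van_shift[OF _ Y this, of "- n"] show "van X (sh T (- n) Y)" by (simp add: X sh_ob sh_sh Shift_zero)
next
  assume "van X (sh T (- n) Y)"
  from van_shift[OF X _ this, of n] show "van (sh T n X) Y" by (simp add: Y sh_ob sh_sh Shift_zero)
qed

lemma zero_object_shift:
  assumes "zero_object T X"
  shows "zero_object T (sh T n X)"
proof -
  have X: "X \<in> Ob T" "van X X" using assms by (auto simp: zero_object_def)
  then show ?thesis using van_shift[of X X n] by (simp add: zero_object_iff sh_ob)
qed

lemma zero_object_ob: "zero_object T Z \<Longrightarrow> Z \<in> Ob T"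
  by (simp add: zero_object_def)

lemma zero_object_van: "\<lbrakk>zero_object T Z; X \<in> Ob T\<rbrakk> \<Longrightarrow> van Z X" "\<lbrakk>zero_object T Z; X \<in> Ob T\<rbrakk> \<Longrightarrow> van X Z"
  by (auto simp: zero_object_def)

lemma distD:
  assumes "dist T X Y Z f g h"
  shows "X \<in> Ob T" "Y \<in> Ob T" "Z \<in> Ob T" "f \<in> Mor T X Y" "g \<in> Mor T Y Z" "h \<in> Mor T Z (sh T 1 X)"
  using dist_closed[OF assms] by auto

lemma dist_rot:
  assumes d: "dist T X Y Z f g h"
  shows "dist T Y Z (sh T 1 X) g h (\<ominus>\<^bsub>Hom T (sh T 1 X) (sh T 1 Y)\<^esub> (sh_mor T 1 f))"
  using dist_rotate[OF distD[OF d]] d by blast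

lemma dist_inv_rot:
  assumes d: "dist T X Y Z f g h"
  shows "\<exists>h'. dist T (sh T (- 1) Z) X Y h' f g"
proof -
  note D = distD[OF d]
  note [simp] = D(1-3) sh_ob sh_sh Shift_zero
  let ?k = "sh_mor T (- 1) h"
  have k: "?k \<in> Mor T (sh T (- 1) Z) X" using sh_mor_closed[OF _ _ D(6), of "- 1"] by simp
  \<comment> \<open>The sign is chosen to cancel the one in \<open>dist_rotate\<close>, so that
    rotating forward returns \<open>h\<close>.\<close>
  let ?h' = "\<ominus>\<^bsub>Hom T (sh T (- 1) Z) X\<^esub> ?k"
  have h': "?h' \<in> Mor T (sh T (- 1) Z) X" using k by (simp add: neg_closed)
  have kk: "sh_mor T 1 ?k = h"
    using sh_mor_sh_mor[OF _ _ D(6), of 1 "- 1"] Shift_zero_mor[OF _ _ D(6)] by simp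
  have "sh_mor T 1 ?h' = \<ominus>\<^bsub>Hom T Z (sh T 1 X)\<^esub> h"
    using sh_mor_neg[OF _ _ k, of 1] kk by simp
  then have "\<ominus>\<^bsub>Hom T Z (sh T 1 X)\<^esub> (sh_mor T 1 ?h') = h"
    using neg_neg[OF _ _ D(6)] by simp
  then show ?thesis
    using dist_rotate[of "sh T (- 1) Z" X Y ?h' f g] h' D d by auto
qed

lemma dist_comp_zero:
  assumes d: "dist T X Y Z f g h"
  shows "g \<star> f = 0[X,Z]"
proof -
  note D = distD[OF d]
  obtain Q where Q: "zero_object T Q" using zero_object_exists by blast
  note Oo = zero_object_ob[OF Q]
  have "f \<star> ident T X = f \<star> ident T X" ..
  from dist_morphism[OF dist_ident[OF D(1) Q] d ident_closed[OF D(1)] D(4) this]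
  obtain c where c: "c \<in> Mor T Q Z" "c \<star> 0[X,Q] = g \<star> f" by blast
  then show ?thesis using comp_zero_right[OF D(1) Oo D(3) c(1)] by simp
qed

text \<open>Comparison with the triangle on the identity of \<open>W\<close>, with both triangles
  rotated once so that the fill-in is a morphism \<open>c : W[1] \<rightarrow> X[1]\<close>;
  shifting it back gives the factorization.\<close>

lemma exact_left:
  assumes d: "dist T X Y Z f g h" and W: "W \<in> Ob T" and \<phi>: "\<phi> \<in> Mor T W Y" and z: "g \<star> \<phi> = 0[W,Z]"
  shows "\<exists>\<psi>\<in>Mor T W X. \<phi> = f \<star> \<psi>"
proof -
  note D = distD[OF d]
  obtain Q where Q: "zero_object T Q" using zero_object_exists by blast
  note [simp] = zero_object_ob[OF Q] W D(1-3) sh_ob sh_sh Shift_zero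
  have a: "0[Q,Z] \<star> 0[W,Q] = g \<star> \<phi>" using z by (simp add: comp_zero_left zero_closed)
  have i: "\<ominus>\<^bsub>Hom T (sh T 1 W) (sh T 1 W)\<^esub> sh_mor T 1 (ident T W) \<in> Mor T (sh T 1 W) (sh T 1 W)"
    by (simp add: sh_mor_ident ident_closed neg_closed)
  obtain c where c: "c \<in> Mor T (sh T 1 W) (sh T 1 X)"
    and e: "(\<ominus>\<^bsub>Hom T (sh T 1 X) (sh T 1 Y)\<^esub> (sh_mor T 1 f)) \<star> c
      = sh_mor T 1 \<phi> \<star> (\<ominus>\<^bsub>Hom T (sh T 1 W) (sh T 1 W)\<^esub> sh_mor T 1 (ident T W))"
    using dist_morphism[OF dist_rot[OF dist_ident[OF W Q]] dist_rot[OF d] \<phi> zero_closed a] by auto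
  note f1 = sh_mor_closed[OF D(1,2,4), of 1] and p1 = sh_mor_closed[OF W D(2) \<phi>, of 1]
  have fc: "sh_mor T 1 f \<star> c \<in> Mor T (sh T 1 W) (sh T 1 Y)"
    by (rule comp_closed[OF _ _ _ c f1]) auto
  have "\<ominus>\<^bsub>Hom T (sh T 1 W) (sh T 1 Y)\<^esub> (sh_mor T 1 f \<star> c) = \<ominus>\<^bsub>Hom T (sh T 1 W) (sh T 1 Y)\<^esub> (sh_mor T 1 \<phi>)"
    using e by (simp add: comp_neg_left[OF _ _ _ c f1] comp_neg_right[OF _ _ _ p1] sh_mor_ident ident_closed ident_right[OF _ _ p1])
  then have e1: "sh_mor T 1 f \<star> c = sh_mor T 1 \<phi>"
    using neg_neg[OF _ _ fc] neg_neg[OF _ _ p1] by (metis W D(2) sh_ob)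
  let ?p = "sh_mor T (- 1) c"
  have p: "?p \<in> Mor T W X" using sh_mor_closed[OF _ _ c, of "- 1"] by simp
  have "f \<star> ?p = sh_mor T (- 1) (sh_mor T 1 f \<star> c)"
    using sh_mor_comp[OF _ _ _ c f1, of "- 1"] sh_mor_sh_mor[OF D(1,2,4), of "-1" 1] Shift_zero_mor[OF D(1,2,4)] by simp
  also have "\<dots> = \<phi>"
    using e1 sh_mor_sh_mor[OF W D(2) \<phi>, of "-1" 1] Shift_zero_mor[OF W D(2) \<phi>] by simp
  finally show ?thesis using p by metis
qed

text \<open>Comparison with the triangle \<open>Q[-1] \<rightarrow> W \<rightarrow> W\<close> over a
  zero object \<open>Q\<close>, whose second morphism is the identity; the fill-in is the
  factorization.\<close>

lemma exact_right:
  assumes d: "dist T X Y Z f g h" and W: "W \<in> Ob T" and \<phi>: "\<phi> \<in> Mor T Y W" and z: "\<phi> \<star> f = 0[X,W]"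
  shows "\<exists>\<psi>\<in>Mor T Z W. \<phi> = \<psi> \<star> g"
proof -
  note D = distD[OF d]
  obtain Q where Q: "zero_object T Q" using zero_object_exists by blast
  obtain h' where d': "dist T (sh T (- 1) Q) W W h' (ident T W) 0[W,Q]"
    using dist_inv_rot[OF dist_ident[OF W Q]] by blast
  note [simp] = zero_object_ob[OF Q] W D(1-3) sh_ob sh_sh Shift_zero
  have "h' \<star> 0[X, sh T (- 1) Q] = 0[X, W]"
    using distD(4)[OF d'] by (simp add: comp_zero_right)
  then have e: "\<phi> \<star> f = h' \<star> 0[X, sh T (- 1) Q]" using z by simp
  from dist_morphism[OF d d' zero_closed \<phi> e]
  obtain c where "c \<in> Mor T Z W" "c \<star> g = ident T W \<star> \<phi>" by auto
  then show ?thesis using ident_left[OF _ _ \<phi>] by (auto intro!: bexI[of _ c])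
qed

lemma van_mid:
  assumes d: "dist T X Y Z f g h" and W: "W \<in> Ob T"
  shows "\<lbrakk>van W X; van W Z\<rbrakk> \<Longrightarrow> van W Y" "\<lbrakk>van X W; van Z W\<rbrakk> \<Longrightarrow> van Y W"
proof -
  note D = distD[OF d]
  show "van W Y" if x: "van W X" and z: "van W Z"
  proof (rule vanI[OF W D(2)])
    fix \<phi> assume p: "\<phi> \<in> Mor T W Y"
    then have "g \<star> \<phi> = 0[W,Z]" using vanD[OF z] comp_closed[OF W D(2,3) p D(5)] by blast
    from exact_left[OF d W p this] obtain \<psi> where q: "\<psi> \<in> Mor T W X" "\<phi> = f \<star> \<psi>" by blast
    then show "\<phi> = 0[W,Y]" using vanD[OF x q(1)] comp_zero_right[OF W D(1,2,4)] by simp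
  qed
  show "van Y W" if x: "van X W" and z: "van Z W"
  proof (rule vanI[OF D(2) W])
    fix \<phi> assume p: "\<phi> \<in> Mor T Y W"
    then have "\<phi> \<star> f = 0[X,W]" using vanD[OF x] comp_closed[OF D(1,2) W D(4) p] by blast
    from exact_right[OF d W p this] obtain \<psi> where q: "\<psi> \<in> Mor T Z W" "\<phi> = \<psi> \<star> g" by blast
    then show "\<phi> = 0[Y,W]" using vanD[OF z q(1)] comp_zero_left[OF D(2,3) W D(5)] by simp
  qed
qed

lemma van_to_mid:
  assumes d: "dist T X Y Z f g h" and W: "W \<in> Ob T" and "van W (sh T n X)" "van W (sh T n Z)"
  shows "van W (sh T n Y)"
  using van_mid(1)[OF d sh_ob[OF W], of "- n"] assms distD[OF d] by (simp add: van_sh_left)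

lemma van_to_third:
  assumes d: "dist T X Y Z f g h" and W: "W \<in> Ob T" and "van W (sh T n Y)" "van W (sh T (n + 1) X)"
  shows "van W (sh T n Z)"
  using van_to_mid[OF dist_rot[OF d] W] assms distD[OF d] by (simp add: sh_sh)

lemma van_to_first:
  assumes d: "dist T X Y Z f g h" and W: "W \<in> Ob T" and "van W (sh T n Y)" "van W (sh T (n - 1) Z)"
  shows "van W (sh T n X)"
proof -
  obtain h' where d': "dist T (sh T (- 1) Z) X Y h' f g" using dist_inv_rot[OF d] by blast
  show ?thesis using van_to_mid[OF d' W] assms distD[OF d] by (simp add: sh_sh)
qed

lemma van_from_mid:
  assumes d: "dist T X Y Z f g h" and W: "W \<in> Ob T" and "van X (sh T n W)" "van Z (sh T n W)"
  shows "van Y (sh T n W)"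
  using van_mid(2)[OF d sh_ob[OF W]] assms by blast

lemma van_from_third:
  assumes d: "dist T X Y Z f g h" and W: "W \<in> Ob T" and "van Y (sh T n W)" "van X (sh T (n - 1) W)"
  shows "van Z (sh T n W)"
  using van_from_mid[OF dist_rot[OF d] W] assms distD[OF d] by (simp add: sh_sh sh_ob van_sh_left)

lemma van_from_first:
  assumes d: "dist T X Y Z f g h" and W: "W \<in> Ob T" and "van Y (sh T n W)" "van Z (sh T (n + 1) W)"
  shows "van X (sh T n W)"
proof -
  obtain h' where d': "dist T (sh T (- 1) Z) X Y h' f g" using dist_inv_rot[OF d] by blast
  show ?thesis using van_from_mid[OF d' W] assms distD[OF d] by (simp add: sh_sh sh_ob van_sh_left add.commute)
qed

end

section \<open>Retracts and approximations\<close>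

context linear_category
begin

text \<open>Less data than a biproduct with a named complement: vanishing passes to retracts at
  once, and \<open>retract_complement\<close> recovers the complement where
  \<open>add_closure\<close> or thickness asks for one.\<close>

definition retract where
  "retract X Y \<longleftrightarrow> X \<in> Ob T \<and> Y \<in> Ob T \<and> (\<exists>i\<in>Mor T X Y. \<exists>p\<in>Mor T Y X. p \<star> i = ident T X)"

lemma retractI: "\<lbrakk>X \<in> Ob T; Y \<in> Ob T; i \<in> Mor T X Y; p \<in> Mor T Y X; p \<star> i = ident T X\<rbrakk> \<Longrightarrow> retract X Y"
  by (auto simp: retract_def)

lemma retract_refl: "X \<in> Ob T \<Longrightarrow> retract X X"
  using retractI[OF _ _ ident_closed ident_closed] ident_left ident_closed by blast

lemma retract_van: "\<lbrakk>retract X Y; W \<in> Ob T; van W Y\<rbrakk> \<Longrightarrow> van W X" "\<lbrakk>retract X Y; W \<in> Ob T; van Y W\<rbrakk> \<Longrightarrow> van X W"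
  unfolding retract_def using van_retract by blast+

lemma iso_arrow_retract:
  assumes "X \<in> Ob T" "Y \<in> Ob T" "iso_arrow T X Y f"
  shows "retract X Y" "retract Y X"
  using assms by (auto simp: retract_def iso_arrow_def)

lemma biproduct_retract:
  assumes "biproduct T Xs Z" "X \<in> set Xs"
  shows "retract X Z"
  using assms(1)
proof (rule biproductE)
  fix inc prj
  assume *: "Z \<in> Ob T" "\<And>i. i < length Xs \<Longrightarrow> Xs ! i \<in> Ob T"
    "\<And>i. i < length Xs \<Longrightarrow> inc i \<in> Mor T (Xs ! i) Z" "\<And>i. i < length Xs \<Longrightarrow> prj i \<in> Mor T Z (Xs ! i)"
    "\<And>i. i < length Xs \<Longrightarrow> prj i \<star> inc i = ident T (Xs ! i)"
  obtain i where "i < length Xs" "X = Xs ! i" using assms(2) by (metis in_set_conv_nth)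
  then show ?thesis using retractI[OF *(2,1,3,4,5)] by simp
qed

lemma biproduct_nonzero_from:
  assumes b: "biproduct T Xs Z" and W: "W \<in> Ob T" and f: "f \<in> Mor T Z W" "f \<noteq> 0[Z,W]"
  shows "\<exists>X\<in>set Xs. \<exists>i\<in>Mor T X Z. \<exists>p\<in>Mor T Z X. p \<star> i = ident T X \<and> f \<star> i \<noteq> 0[X,W]"
  using b
proof (rule biproductE, goal_cases)
  case (1 inc prj)
  then obtain i where "i < length Xs" "f \<star> inc i \<noteq> 0[Xs ! i, W]" using W f by blast
  then show ?case using 1(3-5) nth_mem by blast
qed

lemma biproduct_nonzero_to:
  assumes b: "biproduct T Xs Z" and W: "W \<in> Ob T" and f: "f \<in> Mor T W Z" "f \<noteq> 0[W,Z]"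
  shows "\<exists>X\<in>set Xs. \<exists>i\<in>Mor T X Z. \<exists>p\<in>Mor T Z X. p \<star> i = ident T X \<and> p \<star> f \<noteq> 0[W,X]"
  using b
proof (rule biproductE, goal_cases)
  case (1 inc prj)
  then obtain i where "i < length Xs" "prj i \<star> f \<noteq> 0[W, Xs ! i]" using W f by blast
  then show ?case using 1(3-5) nth_mem by blast
qed

lemma biproduct_ob: "biproduct T Xs Z \<Longrightarrow> Z \<in> Ob T" "biproduct T Xs Z \<Longrightarrow> X \<in> set Xs \<Longrightarrow> X \<in> Ob T"
  by (auto simp: biproduct_def)

lemma biproduct_van_to:
  assumes b: "biproduct T Xs Z" and W: "W \<in> Ob T" and v: "\<And>X. X \<in> set Xs \<Longrightarrow> van W X"
  shows "van W Z"
proof (rule vanI[OF W biproduct_ob(1)[OF b]], rule ccontr)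
  fix f assume f: "f \<in> Mor T W Z" and n: "f \<noteq> 0[W,Z]"
  from biproduct_nonzero_to[OF b W this] obtain X p
    where X: "X \<in> set Xs" "p \<in> Mor T Z X" "p \<star> f \<noteq> 0[W,X]" by blast
  then show False
    using vanD[OF v[OF X(1)]] comp_closed[OF W biproduct_ob(1)[OF b] biproduct_ob(2)[OF b X(1)] f X(2)] by blast
qed

lemma biproduct_van_from:
  assumes b: "biproduct T Xs Z" and W: "W \<in> Ob T" and v: "\<And>X. X \<in> set Xs \<Longrightarrow> van X W"
  shows "van Z W"
proof (rule vanI[OF biproduct_ob(1)[OF b] W], rule ccontr)
  fix f assume f: "f \<in> Mor T Z W" and n: "f \<noteq> 0[Z,W]"
  from biproduct_nonzero_from[OF b W this] obtain X p
    where X: "X \<in> set Xs" "p \<in> Mor T X Z" "f \<star> p \<noteq> 0[X,W]" by blast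
  then show False
    using vanD[OF v[OF X(1)]] comp_closed[OF biproduct_ob(2)[OF b X(1)] biproduct_ob(1)[OF b] W X(2) f] by blast
qed

lemma add_closure_ob: "X \<in> add_closure T M \<Longrightarrow> X \<in> Ob T"
  by (simp add: add_closure_def)

lemma add_closure_van:
  assumes "X \<in> add_closure T M" "W \<in> Ob T"
  shows "van W M \<Longrightarrow> van W X" "van M W \<Longrightarrow> van X W"
proof -
  obtain U Z n where b: "biproduct T [X, U] Z" "biproduct T (replicate n M) Z"
    using assms(1) by (auto simp: add_closure_def)
  have r: "retract X Z" using biproduct_retract[OF b(1)] by simp
  show "van W X" if "van W M"
    using biproduct_van_to[OF b(2) assms(2)] that retract_van(1)[OF r assms(2)] by auto
  show "van X W" if "van M W"
    using biproduct_van_from[OF b(2) assms(2)] that retract_van(2)[OF r assms(2)] by auto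
qed

lemma biproduct_single:
  assumes X: "X \<in> Ob T"
  shows "biproduct T [X] X"
proof -
  interpret H: abelian_group "Hom T X X" by (rule Hom_abelian_group[OF X X])
  show ?thesis
    unfolding biproduct_def
  proof (intro conjI exI[of _ "\<lambda>_. ident T X"])
    have "(\<Oplus>\<^bsub>Hom T X X\<^esub>i\<in>{0::nat}. ident T X \<star> ident T X) = ident T X"
      using H.finsum_insert[of "{}" "0::nat" "\<lambda>_. ident T X"] ident_closed[OF X]
        ident_left[OF X X ident_closed[OF X]] by simp
    then show "(\<Oplus>\<^bsub>Hom T X X\<^esub>i\<in>{..<length [X]}. ident T X \<star> ident T X) = ident T X"
      by (simp add: lessThan_Suc)
  qed (simp_all add: X ident_closed ident_left[OF X X ident_closed[OF X]])
qed

lemma biproduct_pairI: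
  assumes X: "X \<in> Ob T" and W: "W \<in> Ob T" and Z: "Z \<in> Ob T"
    and i: "i \<in> Mor T X Z" and j: "j \<in> Mor T W Z" and p: "p \<in> Mor T Z X" and q: "q \<in> Mor T Z W"
    and pi: "p \<star> i = ident T X" and qj: "q \<star> j = ident T W" and pj: "p \<star> j = 0[W,X]" and qi: "q \<star> i = 0[X,W]"
    and s: "i \<star> p \<oplus>\<^bsub>Hom T Z Z\<^esub> j \<star> q = ident T Z"
  shows "biproduct T [X, W] Z"
proof -
  interpret H: abelian_group "Hom T Z Z" by (rule Hom_abelian_group[OF Z Z])
  have cl: "i \<star> p \<in> Mor T Z Z" "j \<star> q \<in> Mor T Z Z"
    using comp_closed[OF Z X Z p i] comp_closed[OF Z W Z q j] by auto
  have "finsum (Hom T Z Z) (\<lambda>k. (if k = 0 then i else j) \<star> (if k = 0 then p else q)) {..<Suc (Suc 0)} = ident T Z"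
    using cl s by (simp add: lessThan_Suc H.a_comm)
  then show ?thesis
    unfolding biproduct_def
    by (intro conjI exI[of _ "\<lambda>k. if k = 0 then i else j"] exI[of _ "\<lambda>k. if k = 0 then p else q"])
       (use assms in \<open>auto simp: less_Suc_eq\<close>)
qed

text \<open>Composing \<open>u\<close> with \<open>id - e\<close> gives zero, so
  \<open>id - e\<close> is no unit; since it and \<open>e\<close> sum to the identity, locality
  makes \<open>e\<close> a unit.\<close>

lemma local_End_unit:
  assumes l: "local_ring (End_ring T X)" and X: "X \<in> Ob T" and S: "S \<in> Ob T"
    and u: "u \<in> Mor T X S" "u \<noteq> 0[X,S]" and e: "e \<in> Mor T X X" "u \<star> e = u"
  shows "\<exists>e'\<in>Mor T X X. e' \<star> e = ident T X"
proof -
  interpret H: abelian_group "Hom T X X" by (rule Hom_abelian_group[OF X X])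
  have idX: "ident T X \<in> Mor T X X" using ident_closed[OF X] .
  let ?n = "ident T X \<ominus>\<^bsub>Hom T X X\<^esub> e"
  have n: "?n \<in> Mor T X X" using minus_closed[OF X X idX e(1)] .
  have un: "u \<star> ?n = 0[X,S]"
    using comp_minus_right[OF X X S u(1) idX e(1)] e(2) ident_right[OF X S u(1)] minus_eq_zero_iff[OF X S u(1) u(1)] by simp
  have U: "a \<in> Units (End_ring T X) \<longleftrightarrow> a \<in> Mor T X X \<and> (\<exists>b\<in>Mor T X X. b \<star> a = ident T X \<and> a \<star> b = ident T X)" for a
    by (auto simp: Units_def End_ring_def)
  have E: "carrier (End_ring T X) = Mor T X X" "add (End_ring T X) = add (Hom T X X)"
    by (simp_all add: End_ring_def)
  have L: "a \<oplus>\<^bsub>Hom T X X\<^esub> b \<notin> Units (End_ring T X)" if "a \<in> Mor T X X" "a \<notin> Units (End_ring T X)"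
    "b \<in> Mor T X X" "b \<notin> Units (End_ring T X)" for a b
    using l that unfolding local_ring_def E by blast
  have "?n \<notin> Units (End_ring T X)"
  proof
    assume "?n \<in> Units (End_ring T X)"
    then obtain b where b: "b \<in> Mor T X X" "?n \<star> b = ident T X" using U by auto
    have "u = (u \<star> ?n) \<star> b"
      using comp_assoc[OF X X X S b(1) n u(1)] b(2) ident_right[OF X S u(1)] by simp
    then show False using un u(2) comp_zero_left[OF X X S b(1)] by simp
  qed
  moreover have "e \<oplus>\<^bsub>Hom T X X\<^esub> ?n = ident T X"
    using H.a_lcomm[OF e(1) idX H.a_inv_closed[OF e(1)]] e(1) idX by (simp add: a_minus_def H.r_neg)
  moreover have "ident T X \<in> Units (End_ring T X)"
    using U idX ident_left[OF X X idX] by auto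
  ultimately have "e \<in> Units (End_ring T X)"
    using L e(1) n by metis
  then show ?thesis using U by auto
qed

text \<open>Composition with \<open>t \<star> s\<close> fixes \<open>u\<close>, so
  \<open>local_End_unit\<close> provides a left inverse of \<open>t \<star> s\<close>.\<close>

lemma local_End_retract:
  assumes l: "local_ring (End_ring T X)" and X: "X \<in> Ob T" and Y: "Y \<in> Ob T" and S: "S \<in> Ob T"
    and u: "u \<in> Mor T X S" "u \<noteq> 0[X,S]" and v: "v \<in> Mor T Y S"
    and s: "s \<in> Mor T X Y" "u = v \<star> s" and t: "t \<in> Mor T Y X" "v = u \<star> t"
  shows "retract X Y"
proof -
  have ts: "t \<star> s \<in> Mor T X X" using comp_closed[OF X Y X s(1) t(1)] .
  have "u \<star> (t \<star> s) = u" using comp_assoc[OF X Y X S s(1) t(1) u(1)] s(2)[symmetric] t(2)[symmetric] by simp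
  from local_End_unit[OF l X S u ts this] obtain e where e: "e \<in> Mor T X X" "e \<star> (t \<star> s) = ident T X" by blast
  have "(e \<star> t) \<star> s = ident T X" using comp_assoc[OF X Y X X s(1) t(1) e(1)] e(2) by simp
  then show ?thesis by (rule retractI[OF X Y s(1) comp_closed[OF Y X X t(1) e(1)]])
qed

end

section \<open>Split extensions and right approximations\<close>

context triangulated_category
begin

text \<open>The cone of the zero morphism \<open>M[-1] \<rightarrow> P\<close>: a direct sum that
  comes with its triangle, so that classes closed under extensions can be followed through the
  construction.\<close>

lemma split_extension:
  assumes P: "P \<in> Ob T" and M: "M \<in> Ob T"
  shows "\<exists>R a b h r s. dist T P R M a b h \<and> r \<in> Mor T R P \<and> s \<in> Mor T M R \<and>
    r \<star> a = ident T P \<and> b \<star> s = ident T M \<and> r \<star> s = 0[M,P]"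
proof -
  let ?M' = "sh T (- 1) M"
  have M': "?M' \<in> Ob T" "sh T 1 ?M' = M" using M by (simp_all add: sh_ob sh_sh Shift_zero)
  note sP = sh_ob[OF P, of 1]
  obtain R a b where d0: "dist T ?M' P R 0[?M',P] a b"
    using dist_exists[OF M'(1) P zero_closed[OF M'(1) P]] by (elim exE)
  have d: "dist T P R M a b (\<ominus>\<^bsub>Hom T M (sh T 1 P)\<^esub> sh_mor T 1 0[?M',P])"
    using dist_rot[OF d0] M'(2) by simp
  have z: "\<ominus>\<^bsub>Hom T M (sh T 1 P)\<^esub> sh_mor T 1 0[?M',P] = 0[M, sh T 1 P]"
    using sh_mor_zero[OF M'(1) P, of 1] M'(2) neg_zero[OF M sP] by simp
  note D = distD[OF d]
  note R = D(2)
  have "ident T P \<star> 0[?M',P] = 0[?M',P]" using ident_left[OF M'(1) P zero_closed[OF M'(1) P]] .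
  from exact_right[OF d0 P ident_closed[OF P] this]
  obtain r where r: "r \<in> Mor T R P" "r \<star> a = ident T P" by metis
  have "0[M, sh T 1 P] \<star> ident T M = 0[M, sh T 1 P]" using ident_right[OF M sP zero_closed[OF M sP]] .
  from exact_left[OF dist_rot[OF d] M ident_closed[OF M], unfolded z, OF this]
  obtain s where s: "s \<in> Mor T M R" "b \<star> s = ident T M" by metis
  have rs: "r \<star> s \<in> Mor T M P" using comp_closed[OF M R P s(1) r(1)] .
  have rsb: "(r \<star> s) \<star> b \<in> Mor T R P" using comp_closed[OF R M P D(5) rs] .
  \<comment> \<open>The retraction \<open>r\<close> and the section \<open>s\<close> were obtained
    independently; subtracting the part of \<open>r\<close> that goes through \<open>M\<close> makes
    it vanish on \<open>s\<close>.\<close>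
  define q where "q = r \<ominus>\<^bsub>Hom T R P\<^esub> (r \<star> s) \<star> b"
  interpret H: abelian_group "Hom T P P" by (rule Hom_abelian_group[OF P P])
  have "q \<in> Mor T R P" unfolding q_def using minus_closed[OF R P r(1) rsb] .
  moreover have "q \<star> s = 0[M,P]"
    unfolding q_def
    using comp_minus_left[OF M R P s(1) r(1) rsb] comp_assoc[OF M R M P s(1) D(5) rs] s(2) ident_right[OF M P rs]
      minus_eq_zero_iff[OF M P rs rs] by simp
  moreover have "((r \<star> s) \<star> b) \<star> a = 0[P,P]"
    using comp_assoc[OF P R M P D(4,5) rs] dist_comp_zero[OF d] comp_zero_right[OF P M P rs] by simp
  then have "q \<star> a = ident T P"
    unfolding q_def
    using comp_minus_left[OF P R P D(4) r(1) rsb] r(2) ident_closed[OF P] by (simp add: a_minus_def)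
  ultimately show ?thesis using d s by (intro exI conjI)
qed

lemma extend_split:
  assumes P: "P \<in> Ob T" and M: "M \<in> Ob T" and Z: "Z \<in> Ob T"
    and F: "\<Phi> \<in> Mor T P Z" and a: "a \<in> Mor T M Z"
  shows "\<exists>R i q k j F. dist T P R M i q k \<and> j \<in> Mor T M R \<and> F \<in> Mor T R Z \<and> F \<star> i = \<Phi> \<and> F \<star> j = a"
proof -
  obtain R i q k p j where d: "dist T P R M i q k" and p: "p \<in> Mor T R P" and j: "j \<in> Mor T M R"
    and pi: "p \<star> i = ident T P" and qj: "q \<star> j = ident T M" and pj: "p \<star> j = 0[M,P]"
    using split_extension[OF P M] by (elim exE conjE)
  note D = distD[OF d]
  note R = D(2) and i = D(4) and q = D(5)
  have qi: "q \<star> i = 0[P,M]" by (rule dist_comp_zero[OF d])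
  let ?F = "\<Phi> \<star> p \<oplus>\<^bsub>Hom T R Z\<^esub> a \<star> q"
  have c: "\<Phi> \<star> p \<in> Mor T R Z" "a \<star> q \<in> Mor T R Z"
    using comp_closed[OF R P Z p F] comp_closed[OF R M Z q a] by auto
  interpret HR: abelian_group "Hom T R Z" by (rule Hom_abelian_group[OF R Z])
  interpret HP: abelian_group "Hom T P Z" by (rule Hom_abelian_group[OF P Z])
  interpret HM: abelian_group "Hom T M Z" by (rule Hom_abelian_group[OF M Z])
  have F': "?F \<in> Mor T R Z" using c by simp
  have "?F \<star> i = (\<Phi> \<star> p) \<star> i \<oplus>\<^bsub>Hom T P Z\<^esub> (a \<star> q) \<star> i"
    using module_hom_add[OF comp_linear_left[OF P R Z i] c] .
  also have "\<dots> = \<Phi>"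
    using comp_assoc[OF P R P Z i p F] comp_assoc[OF P R M Z i q a] pi qi ident_right[OF P Z F]
      comp_zero_right[OF P M Z a] F by simp
  finally have F0: "?F \<star> i = \<Phi>" .
  have "?F \<star> j = (\<Phi> \<star> p) \<star> j \<oplus>\<^bsub>Hom T M Z\<^esub> (a \<star> q) \<star> j"
    using module_hom_add[OF comp_linear_left[OF M R Z j] c] .
  also have "\<dots> = a"
    using comp_assoc[OF M R P Z j p F] comp_assoc[OF M R M Z j q a] pj qj ident_right[OF M Z a]
      comp_zero_right[OF M P Z F] a by simp
  finally show ?thesis using d j F' F0 by (intro exI conjI)
qed

text \<open>Each element of \<open>A\<close> adds one copy of \<open>M\<close> by a split extension.
  The property \<open>Q\<close> is left abstract because it stands once for membership in a thick
  subcategory and once for inherited vanishing.\<close>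

lemma finite_right_approximation:
  assumes M: "M \<in> Ob T" and Z: "Z \<in> Ob T" and A: "finite A" "A \<subseteq> Mor T M Z"
    and Q_zero: "\<And>P. zero_object T P \<Longrightarrow> Q P"
    and Q_ext: "\<And>P R f g h. \<lbrakk>Q P; dist T P R M f g h\<rbrakk> \<Longrightarrow> Q R"
  shows "\<exists>P \<Phi>. P \<in> Ob T \<and> Q P \<and> \<Phi> \<in> Mor T P Z \<and> (\<forall>a\<in>A. \<exists>h\<in>Mor T M P. a = \<Phi> \<star> h)"
  using A
proof (induction A rule: finite_induct)
  case empty
  obtain P where P: "zero_object T P" using zero_object_exists by blast
  note Po = zero_object_ob[OF P]
  show ?case by (intro exI[of _ P] exI[of _ "0[P,Z]"]) (simp add: Po Q_zero[OF P] zero_closed[OF Po Z])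
next
  case (insert a A)
  have "A \<subseteq> Mor T M Z" using insert.prems by simp
  from insert.IH[OF this] obtain P \<Phi> where P: "P \<in> Ob T" and QP: "Q P" and F: "\<Phi> \<in> Mor T P Z"
    and fac: "\<forall>a\<in>A. \<exists>h\<in>Mor T M P. a = \<Phi> \<star> h" by (elim exE conjE)
  have a: "a \<in> Mor T M Z" using insert by simp
  obtain R i q k j F where d: "dist T P R M i q k" and j: "j \<in> Mor T M R" and F': "F \<in> Mor T R Z"
    and F0: "F \<star> i = \<Phi>" and F1: "F \<star> j = a"
    using extend_split[OF P M Z F a] by (elim exE conjE)
  note R = distD(2)[OF d] and i = distD(4)[OF d]
  have "\<exists>h\<in>Mor T M R. x = F \<star> h" if x: "x \<in> insert a A" for x
  proof (cases "x = a")
    case True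
    then show ?thesis using F1 j by metis
  next
    case False
    then obtain h where h: "h \<in> Mor T M P" "x = \<Phi> \<star> h" using fac x by blast
    have "F \<star> (i \<star> h) = x" using comp_assoc[OF M P R Z h(1) i F'] F0 h(2) by simp
    then show ?thesis using comp_closed[OF M P R h(1) i] by metis
  qed
  then show ?case using R Q_ext[OF QP d] F' by blast
qed

text \<open>The morphisms that factor through \<open>\<Phi>\<close> form a subspace, so it suffices
  to treat a finite spanning set.\<close>

lemma right_approximation:
  assumes M: "M \<in> Ob T" and Z: "Z \<in> Ob T" and fd: "vectorspace.fin_dim K (Hom T M Z)"
    and Q_zero: "\<And>P. zero_object T P \<Longrightarrow> Q P"
    and Q_ext: "\<And>P R f g h. \<lbrakk>Q P; dist T P R M f g h\<rbrakk> \<Longrightarrow> Q R"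
  shows "\<exists>P \<Phi>. P \<in> Ob T \<and> Q P \<and> \<Phi> \<in> Mor T P Z \<and> (\<forall>a\<in>Mor T M Z. \<exists>h\<in>Mor T M P. a = \<Phi> \<star> h)"
proof -
  interpret V: vectorspace K "Hom T M Z" using M Z by (rule Hom_vectorspace)
  obtain A where A: "finite A" "A \<subseteq> Mor T M Z" "V.span A = Mor T M Z"
    using fd by (auto simp: V.fin_dim_def)
  have "\<exists>P \<Phi>. P \<in> Ob T \<and> Q P \<and> \<Phi> \<in> Mor T P Z \<and> (\<forall>a\<in>A. \<exists>h\<in>Mor T M P. a = \<Phi> \<star> h)"
    by (rule finite_right_approximation[where Q = Q, OF M Z A(1,2)]) (erule Q_zero, erule (1) Q_ext)
  then obtain P \<Phi> where P: "P \<in> Ob T" "Q P" "\<Phi> \<in> Mor T P Z" "\<forall>a\<in>A. \<exists>h\<in>Mor T M P. a = \<Phi> \<star> h"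
    by (elim exE conjE)
  interpret h: mod_hom K "Hom T M P" "Hom T M Z" "\<lambda>h. \<Phi> \<star> h" by (rule mod_hom_right[OF M P(1) Z P(3)])
  have "A \<subseteq> h.im" using P(4) by (auto simp: h.im_def)
  then have "V.span A \<subseteq> h.im" using V.span_is_subset[OF _ h.im_is_submodule] by blast
  then have "\<forall>a\<in>Mor T M Z. \<exists>h\<in>Mor T M P. a = \<Phi> \<star> h" using A(3) by (auto simp: h.im_def)
  then show ?thesis using P by blast
qed

text \<open>The complement is the cone of the split monomorphism \<open>i\<close>: its connecting
  morphism \<open>h\<close> is zero, so \<open>g\<close> has a section.\<close>

lemma retract_complement:
  assumes "retract X Y"
  shows "\<exists>W. biproduct T [X, W] Y"
proof -
  obtain i p where X: "X \<in> Ob T" and Y: "Y \<in> Ob T" and i: "i \<in> Mor T X Y" and p: "p \<in> Mor T Y X"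
    and pi: "p \<star> i = ident T X" using assms by (auto simp: retract_def)
  obtain W g h where d: "dist T X Y W i g h" using dist_exists[OF X Y i] by blast
  note D = distD[OF d]
  note W = D(3) and g = D(5) and h = D(6)
  note sX = sh_ob[OF X, of 1] and sY = sh_ob[OF Y, of 1]
  note si = sh_mor_closed[OF X Y i, of 1] and sp = sh_mor_closed[OF Y X p, of 1]
  have "(\<ominus>\<^bsub>Hom T (sh T 1 X) (sh T 1 Y)\<^esub> sh_mor T 1 i) \<star> h = 0[W, sh T 1 Y]"
    using dist_comp_zero[OF dist_rot[OF dist_rot[OF d]]] .
  then have "\<ominus>\<^bsub>Hom T W (sh T 1 Y)\<^esub> (sh_mor T 1 i \<star> h) = 0[W, sh T 1 Y]"
    using comp_neg_left[OF W sX sY h si] by simp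
  then have ih: "sh_mor T 1 i \<star> h = 0[W, sh T 1 Y]"
    using neg_neg[OF W sY comp_closed[OF W sX sY h si]] neg_zero[OF W sY] by simp
  have "h = (sh_mor T 1 p \<star> sh_mor T 1 i) \<star> h"
    using sh_mor_comp[OF X Y X i p, of 1] pi sh_mor_ident[OF X] ident_left[OF W sX h] by simp
  also have "\<dots> = 0[W, sh T 1 X]"
    using comp_assoc[OF W sX sY sX h si sp] ih comp_zero_right[OF W sY sX sp] by simp
  finally have h0: "h = 0[W, sh T 1 X]" .
  have "h \<star> ident T W = 0[W, sh T 1 X]" using ident_right[OF W sX h] h0 by simp
  from exact_left[OF dist_rot[OF d] W ident_closed[OF W] this]
  obtain s where s: "s \<in> Mor T W Y" and gs: "g \<star> s = ident T W" by metis
  have gi: "g \<star> i = 0[X,W]" using dist_comp_zero[OF d] .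
  have ps: "p \<star> s \<in> Mor T W X" using comp_closed[OF W Y X s p] .
  have ips: "i \<star> (p \<star> s) \<in> Mor T W Y" using comp_closed[OF W X Y ps i] .
  \<comment> \<open>The section \<open>s\<close> is corrected by its part in \<open>X\<close>, so
    that \<open>p \<star> j = 0\<close>.\<close>
  define j where "j = s \<ominus>\<^bsub>Hom T W Y\<^esub> i \<star> (p \<star> s)"
  have j: "j \<in> Mor T W Y" unfolding j_def using minus_closed[OF W Y s ips] .
  have pj: "p \<star> j = 0[W,X]"
    unfolding j_def
    using comp_minus_right[OF W Y X p s ips] comp_assoc[OF W X Y X ps i p] pi ident_left[OF W X ps]
      minus_eq_zero_iff[OF W X ps ps] by simp
  have "g \<star> j = g \<star> s \<ominus>\<^bsub>Hom T W W\<^esub> g \<star> (i \<star> (p \<star> s))"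
    unfolding j_def using comp_minus_right[OF W Y W g s ips] .
  also have "g \<star> (i \<star> (p \<star> s)) = 0[W,W]"
    using comp_assoc[OF W X Y W ps i g] gi comp_zero_left[OF W X W ps] by simp
  finally have gj: "g \<star> j = ident T W"
    using gs ident_closed[OF W] Hom_abelian_group[OF W W] abelian_group.minus_other_side
    by (simp add: a_minus_def neg_zero[OF W W] abelian_monoid.r_zero[OF abelian_group.axioms(1)[OF Hom_abelian_group[OF W W]]])
  interpret HY: abelian_group "Hom T Y Y" by (rule Hom_abelian_group[OF Y Y])
  interpret HX: abelian_group "Hom T X Y" by (rule Hom_abelian_group[OF X Y])
  interpret HW: abelian_group "Hom T W Y" by (rule Hom_abelian_group[OF W Y])
  have ip: "i \<star> p \<in> Mor T Y Y" and jg: "j \<star> g \<in> Mor T Y Y"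
    using comp_closed[OF Y X Y p i] comp_closed[OF Y W Y g j] by auto
  let ?S = "i \<star> p \<oplus>\<^bsub>Hom T Y Y\<^esub> j \<star> g"
  have S: "?S \<in> Mor T Y Y" using ip jg by simp
  have idY: "ident T Y \<in> Mor T Y Y" using ident_closed[OF Y] .
  \<comment> \<open>The error \<open>r\<close> of the decomposition kills \<open>i\<close>, hence
    factors through \<open>g\<close>; it also kills the section \<open>j\<close> of
    \<open>g\<close>, hence is zero.\<close>
  define r where "r = ident T Y \<ominus>\<^bsub>Hom T Y Y\<^esub> ?S"
  have r: "r \<in> Mor T Y Y" unfolding r_def using minus_closed[OF Y Y idY S] .
  have "?S \<star> i = (i \<star> p) \<star> i \<oplus>\<^bsub>Hom T X Y\<^esub> (j \<star> g) \<star> i"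
    using module_hom_add[OF comp_linear_left[OF X Y Y i] ip jg] .
  also have "\<dots> = i"
    using comp_assoc[OF X Y X Y i p i] comp_assoc[OF X Y W Y i g j] pi gi ident_right[OF X Y i]
      comp_zero_right[OF X W Y j] i by simp
  finally have "?S \<star> i = i" .
  then have "r \<star> i = 0[X,Y]"
    unfolding r_def using comp_minus_left[OF X Y Y i idY S] ident_left[OF X Y i] minus_eq_zero_iff[OF X Y i i] by simp
  from exact_right[OF d Y r this] obtain k where k: "k \<in> Mor T W Y" and rk: "r = k \<star> g" by blast
  have "?S \<star> j = (i \<star> p) \<star> j \<oplus>\<^bsub>Hom T W Y\<^esub> (j \<star> g) \<star> j"
    using module_hom_add[OF comp_linear_left[OF W Y Y j] ip jg] .
  also have "\<dots> = j"
    using comp_assoc[OF W Y X Y j p i] comp_assoc[OF W Y W Y j g j] pj gj ident_right[OF W Y j]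
      comp_zero_right[OF W X Y i] j by simp
  finally have "?S \<star> j = j" .
  then have "r \<star> j = 0[W,Y]"
    unfolding r_def using comp_minus_left[OF W Y Y j idY S] ident_left[OF W Y j] minus_eq_zero_iff[OF W Y j j] by simp
  then have "k = 0[W,Y]"
    using rk comp_assoc[OF W Y W Y j g k] gj ident_right[OF W Y k] by simp
  then have "r = 0[Y,Y]" using rk comp_zero_left[OF Y W Y g] by simp
  then have "?S = ident T Y" unfolding r_def using minus_eq_zero_iff[OF Y Y idY S] by simp
  then show ?thesis using biproduct_pairI[OF X W Y i j p g pi gj pj gi] by blast
qed

lemma retract_add_closure:
  assumes "retract X Y"
  shows "X \<in> add_closure T Y"
proof -
  have "X \<in> Ob T" "Y \<in> Ob T" using assms by (auto simp: retract_def)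
  moreover obtain W where "biproduct T [X, W] Y" using retract_complement[OF assms] by blast
  moreover have "biproduct T (replicate 1 Y) Y" using biproduct_single[OF \<open>Y \<in> Ob T\<close>] by simp
  ultimately show ?thesis unfolding add_closure_def by blast
qed

section \<open>Thick subcategories\<close>

lemma thickD:
  assumes "thick_subcategory T C"
  shows thick_sub_ob: "X \<in> C \<Longrightarrow> X \<in> Ob T"
    and thick_zero: "zero_object T X \<Longrightarrow> X \<in> C"
    and thick_shift: "X \<in> C \<Longrightarrow> sh T n X \<in> C"
    and thick_cone: "\<lbrakk>dist T X Y Z f g h; X \<in> C; Y \<in> C\<rbrakk> \<Longrightarrow> Z \<in> C"
    and thick_summand: "\<lbrakk>biproduct T [X, Y] Z; Z \<in> C\<rbrakk> \<Longrightarrow> X \<in> C"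
proof -
  have *: "C \<subseteq> Ob T" "\<forall>Z. zero_object T Z \<longrightarrow> Z \<in> C" "\<forall>X\<in>C. \<forall>n. sh T n X \<in> C"
    "\<forall>X Y Z f g h. dist T X Y Z f g h \<and> X \<in> C \<and> Y \<in> C \<longrightarrow> Z \<in> C"
    "\<forall>X Y Z. biproduct T [X, Y] Z \<and> Z \<in> C \<longrightarrow> X \<in> C \<and> Y \<in> C"
    using assms unfolding thick_subcategory_def by - (elim conjE, assumption)+
  show "X \<in> C \<Longrightarrow> X \<in> Ob T" using *(1) by (rule subsetD)
  show "zero_object T X \<Longrightarrow> X \<in> C" using *(2) by simp
  show "X \<in> C \<Longrightarrow> sh T n X \<in> C" using *(3) by simp
  show "\<lbrakk>dist T X Y Z f g h; X \<in> C; Y \<in> C\<rbrakk> \<Longrightarrow> Z \<in> C" using *(4)[rule_format, of X Y Z f g h] by simp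
  show "\<lbrakk>biproduct T [X, Y] Z; Z \<in> C\<rbrakk> \<Longrightarrow> X \<in> C" using *(5)[rule_format, of X Y Z] by simp
qed

lemma thick_retract:
  assumes "thick_subcategory T C" "retract X Z" "Z \<in> C"
  shows "X \<in> C"
proof -
  obtain W where "biproduct T [X, W] Z" using retract_complement[OF assms(2)] by blast
  then show ?thesis by (rule thick_summand[OF assms(1) _ assms(3)])
qed

lemma thick_extension:
  assumes C: "thick_subcategory T C" and d: "dist T X Y Z f g h" and X: "X \<in> C" and Z: "Z \<in> C"
  shows "Y \<in> C"
proof -
  obtain h' where d': "dist T (sh T (- 1) Z) X Y h' f g" using dist_inv_rot[OF d] by blast
  show ?thesis by (rule thick_cone[OF C d' thick_shift[OF C Z] X])
qed

text \<open>The approximations from the single objects are glued by split extensions, which stay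
  inside \<open>C\<close>.\<close>

lemma thick_approximation:
  assumes C: "thick_subcategory T C" and fd: "Hom_finite K T" and Z: "Z \<in> Ob T" and Xs: "set Xs \<subseteq> C"
  shows "\<exists>P \<Phi>. P \<in> C \<and> \<Phi> \<in> Mor T P Z \<and> (\<forall>A\<in>set Xs. \<forall>x\<in>Mor T A Z. \<exists>h\<in>Mor T A P. x = \<Phi> \<star> h)"
  using Xs
proof (induction Xs)
  case Nil
  obtain P where P: "zero_object T P" using zero_object_exists by blast
  show ?case
    using thick_zero[OF C P] zero_closed[OF zero_object_ob[OF P] Z]
    by (intro exI[of _ P] exI[of _ "0[P,Z]"]) simp
next
  case (Cons A Xs)
  have AC: "A \<in> C" and "set Xs \<subseteq> C" using Cons.prems by auto
  from Cons.IH[OF this(2)] obtain P \<Phi> where P: "P \<in> C" "\<Phi> \<in> Mor T P Z"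
    and fac: "\<forall>A\<in>set Xs. \<forall>x\<in>Mor T A Z. \<exists>h\<in>Mor T A P. x = \<Phi> \<star> h"
    by (elim exE conjE)
  have A: "A \<in> Ob T" and Po: "P \<in> Ob T" using thick_sub_ob[OF C] AC P(1) by auto
  have fdA: "vectorspace.fin_dim K (Hom T A Z)" using fd A Z by (simp add: Hom_finite_def)
  have "\<exists>Q \<Psi>. Q \<in> Ob T \<and> Q \<in> C \<and> \<Psi> \<in> Mor T Q Z \<and> (\<forall>x\<in>Mor T A Z. \<exists>h\<in>Mor T A Q. x = \<Psi> \<star> h)"
    by (rule right_approximation[where Q = "\<lambda>P. P \<in> C", OF A Z fdA])
      (erule thick_zero[OF C], erule (1) thick_extension[OF C _ _ AC, rotated])
  then obtain Q \<Psi> where Q: "Q \<in> Ob T" "Q \<in> C" "\<Psi> \<in> Mor T Q Z"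
    and facA: "\<forall>x\<in>Mor T A Z. \<exists>h\<in>Mor T A Q. x = \<Psi> \<star> h"
    by (elim exE conjE)
  obtain R i q k j F where d: "dist T P R Q i q k" and j: "j \<in> Mor T Q R" and F': "F \<in> Mor T R Z"
    and F0: "F \<star> i = \<Phi>" and F1: "F \<star> j = \<Psi>"
    using extend_split[OF Po Q(1) Z P(2) Q(3)] by (elim exE conjE)
  note R = distD(2)[OF d] and i = distD(4)[OF d]
  have "\<exists>h\<in>Mor T B R. x = F \<star> h" if B: "B \<in> set (A # Xs)" and x: "x \<in> Mor T B Z" for B x
  proof (cases "B = A")
    case True
    then obtain h where h: "h \<in> Mor T B Q" "x = \<Psi> \<star> h" using facA x by blast
    have "F \<star> (j \<star> h) = x" using comp_assoc[OF _ Q(1) R Z h(1) j F'] F1 h(2) True A by simp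
    then show ?thesis using comp_closed[OF _ Q(1) R h(1) j] True A by metis
  next
    case False
    then have BX: "B \<in> set Xs" using B by simp
    then have Bo: "B \<in> Ob T" using thick_sub_ob[OF C] Cons.prems by auto
    obtain h where h: "h \<in> Mor T B P" "x = \<Phi> \<star> h" using fac x BX by blast
    have "F \<star> (i \<star> h) = x" using comp_assoc[OF Bo Po R Z h(1) i F'] F0 h(2) by simp
    then show ?thesis using comp_closed[OF Bo Po R h(1) i] by metis
  qed
  then show ?case using thick_extension[OF C d P(1) Q(2)] F' by blast
qed

text \<open>The definition of \<open>thick_subcategory\<close> does not list closure under finite
  direct sums. An approximation \<open>P \<rightarrow> Z\<close> from \<open>C\<close> catches all
  inclusions, so the next morphism \<open>g\<close> of its triangle is zero and \<open>Z\<close> is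
  a retract of \<open>P\<close>.\<close>

lemma thick_biproduct:
  assumes C: "thick_subcategory T C" and fd: "Hom_finite K T" and b: "biproduct T Xs Z" and Xs: "set Xs \<subseteq> C"
  shows "Z \<in> C"
proof -
  have Z: "Z \<in> Ob T" using biproduct_ob(1)[OF b] .
  obtain P \<Phi> where P: "P \<in> C" "\<Phi> \<in> Mor T P Z"
    and fac: "\<forall>A\<in>set Xs. \<forall>x\<in>Mor T A Z. \<exists>h\<in>Mor T A P. x = \<Phi> \<star> h"
    using thick_approximation[OF C fd Z Xs] by (elim exE conjE)
  have Po: "P \<in> Ob T" by (rule thick_sub_ob[OF C P(1)])
  obtain W g h where d: "dist T P Z W \<Phi> g h" using dist_exists[OF Po Z P(2)] by blast
  note D = distD[OF d]
  have "g = 0[Z,W]"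
  proof (rule ccontr)
    assume "g \<noteq> 0[Z,W]"
    from biproduct_nonzero_from[OF b D(3,5) this]
    obtain A i where A: "A \<in> set Xs" and i: "i \<in> Mor T A Z" "g \<star> i \<noteq> 0[A,W]"
      by (elim bexE conjE)
    have Ao: "A \<in> Ob T" using biproduct_ob(2)[OF b A] .
    obtain k where k: "k \<in> Mor T A P" "i = \<Phi> \<star> k" using fac A i(1) by blast
    then have "g \<star> i = 0[A,W]"
      using comp_assoc[OF Ao D(1,2,3) k(1) D(4,5)] dist_comp_zero[OF d] comp_zero_left[OF Ao D(1,3) k(1)] by simp
    then show False using i(2) by simp
  qed
  then have "g \<star> ident T Z = 0[Z,W]" using ident_right[OF D(2,3,5)] by simp
  from exact_left[OF d Z ident_closed[OF Z] this]
  obtain s where "s \<in> Mor T Z P" "ident T Z = \<Phi> \<star> s" by blast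
  then have "retract Z P" using retractI[OF Z Po _ P(2)] by simp
  then show ?thesis using thick_retract[OF C _ P(1)] by blast
qed

lemma add_closure_subset_thick:
  assumes C: "thick_subcategory T C" and fd: "Hom_finite K T" and M: "M \<in> C" and X: "X \<in> add_closure T M"
  shows "X \<in> C"
proof -
  obtain U Z n where b: "biproduct T [X, U] Z" "biproduct T (replicate n M) Z"
    using X by (auto simp: add_closure_def)
  have "set (replicate n M) \<subseteq> C" using M by (simp add: set_replicate_conv_if)
  then have "Z \<in> C" using thick_biproduct[OF C fd b(2)] by blast
  then show ?thesis by (rule thick_summand[OF C b(1)])
qed

section \<open>Isomorphisms, cancellation and factorization along a triangle\<close>

lemma iso_if_third_zero:
  assumes d: "dist T X Y Z f g h" and z: "zero_object T Z"
  shows "iso_arrow T X Y f"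
proof -
  note D = distD[OF d]
  have "g \<star> ident T Y = 0[Y,Z]"
    using vanD[OF zero_object_van(2)[OF z D(2)]] ident_right[OF D(2,3,5)] D(5) by simp
  from exact_left[OF d D(2) ident_closed[OF D(2)] this]
  obtain s where s: "s \<in> Mor T Y X" "f \<star> s = ident T Y" by metis
  obtain h' where d': "dist T (sh T (- 1) Z) X Y h' f g" using dist_inv_rot[OF d] by blast
  note Z' = zero_object_shift[OF z, of "- 1"]
  have "h' = 0[sh T (- 1) Z, X]" using vanD[OF zero_object_van(1)[OF Z' D(1)]] distD(4)[OF d'] by blast
  then have "ident T X \<star> h' = 0[sh T (- 1) Z, X]"
    using ident_left[OF _ D(1) distD(4)[OF d']] zero_object_ob[OF Z'] by simp
  from exact_right[OF d' D(1) ident_closed[OF D(1)] this]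
  obtain t where t: "t \<in> Mor T Y X" "t \<star> f = ident T X" by metis
  have "t = t \<star> (f \<star> s)" using s ident_right[OF D(2,1) t(1)] by simp
  also have "\<dots> = s" using comp_assoc[OF D(2,1,2,1) s(1) D(4) t(1)] t(2) ident_left[OF D(2,1) s(1)] by simp
  finally show ?thesis using s t D(4) by (auto simp: iso_arrow_def)
qed

lemma iso_if_first_zero:
  assumes d: "dist T X Y Z f g h" and z: "zero_object T X"
  shows "iso_arrow T Y Z g"
  using iso_if_third_zero[OF dist_rot[OF d] zero_object_shift[OF z]] .

lemma mono_if_van:
  assumes d: "dist T X Y Z f g h" and W: "W \<in> Ob T" and v: "van W (sh T (- 1) Z)"
    and a: "a \<in> Mor T W X" and b: "b \<in> Mor T W X" and e: "f \<star> a = f \<star> b"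
  shows "a = b"
proof -
  note D = distD[OF d]
  obtain h' where d': "dist T (sh T (- 1) Z) X Y h' f g" using dist_inv_rot[OF d] by blast
  note D' = distD[OF d']
  note ab = minus_closed[OF W D(1) a b]
  have "f \<star> (a \<ominus>\<^bsub>Hom T W X\<^esub> b) = 0[W,Y]"
    using comp_minus_right[OF W D(1,2,4) a b] e minus_eq_zero_iff[OF W D(2) comp_closed[OF W D(1,2) b D(4)] comp_closed[OF W D(1,2) b D(4)]] by simp
  from exact_left[OF d' W ab this] obtain \<psi> where \<psi>: "\<psi> \<in> Mor T W (sh T (- 1) Z)" "a \<ominus>\<^bsub>Hom T W X\<^esub> b = h' \<star> \<psi>" by blast
  then have "a \<ominus>\<^bsub>Hom T W X\<^esub> b = 0[W,X]"
    using vanD[OF v \<psi>(1)] comp_zero_right[OF W D'(1,2,4)] by simp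
  then show ?thesis using minus_eq_zero_iff[OF W D(1) a b] by simp
qed

lemma epi_if_van:
  assumes d: "dist T X Y Z f g h" and W: "W \<in> Ob T" and v: "van Z W"
    and a: "a \<in> Mor T Y W" and b: "b \<in> Mor T Y W" and e: "a \<star> f = b \<star> f"
  shows "a = b"
proof -
  note D = distD[OF d]
  note ab = minus_closed[OF D(2) W a b]
  have "(a \<ominus>\<^bsub>Hom T Y W\<^esub> b) \<star> f = 0[X,W]"
    using comp_minus_left[OF D(1,2) W D(4) a b] e minus_eq_zero_iff[OF D(1) W comp_closed[OF D(1,2) W D(4) b] comp_closed[OF D(1,2) W D(4) b]] by simp
  from exact_right[OF d W ab this] obtain \<psi> where \<psi>: "\<psi> \<in> Mor T Z W" "a \<ominus>\<^bsub>Hom T Y W\<^esub> b = \<psi> \<star> g" by blast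
  then have "a \<ominus>\<^bsub>Hom T Y W\<^esub> b = 0[Y,W]"
    using vanD[OF v \<psi>(1)] comp_zero_left[OF D(2,3) W D(5)] by simp
  then show ?thesis using minus_eq_zero_iff[OF D(2) W a b] by simp
qed

lemma zero_if_iso:
  assumes d: "dist T X Y Z f g h" and i: "iso_arrow T X Y f"
  shows "g = 0[Y,Z]"
proof -
  note D = distD[OF d]
  obtain s where s: "s \<in> Mor T Y X" "f \<star> s = ident T Y" using i by (auto simp: iso_arrow_def)
  have "g = (g \<star> f) \<star> s"
    using comp_assoc[OF D(2,1,2,3) s(1) D(4,5)] s(2) ident_right[OF D(2,3,5)] by simp
  then show ?thesis using dist_comp_zero[OF d] comp_zero_left[OF D(2,1,3) s(1)] by simp
qed

lemma lift_through:
  assumes d: "dist T X Y Z f g h" and W: "W \<in> Ob T" and v: "van W Z" and a: "a \<in> Mor T W Y"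
  shows "\<exists>b\<in>Mor T W X. a = f \<star> b"
  using exact_left[OF d W a] vanD[OF v] comp_closed[OF W distD(2,3)[OF d] a distD(5)[OF d]] by blast

lemma extend_through:
  assumes d: "dist T X Y Z f g h" and W: "W \<in> Ob T" and v: "van X W" and a: "a \<in> Mor T Y W"
  shows "\<exists>b\<in>Mor T Z W. a = b \<star> g"
  using exact_right[OF d W a] vanD[OF v] comp_closed[OF distD(1,2)[OF d] W distD(4)[OF d] a] by blast

text \<open>Three rotations; the morphisms acquire signs, so only their existence is
  recorded.\<close>

lemma dist_shift1:
  assumes d: "dist T X Y Z f g h"
  shows "\<exists>f' g' h'. dist T (sh T 1 X) (sh T 1 Y) (sh T 1 Z) f' g' h'"
  using dist_rot[OF dist_rot[OF dist_rot[OF d]]] by blast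

text \<open>The objects with property \<open>P\<close> form a thick subcategory containing
  \<open>M\<close>. The single case of retracts covers both isomorphic copies and direct
  summands.\<close>

lemma thick_induct [consumes 3, case_names base zero shift cone summand]:
  assumes M: "thick T M = Ob T" and Mo: "M \<in> Ob T" and X: "X \<in> Ob T"
    and base: "P M"
    and zero: "\<And>Z. zero_object T Z \<Longrightarrow> P Z"
    and shift: "\<And>X n. \<lbrakk>X \<in> Ob T; P X\<rbrakk> \<Longrightarrow> P (sh T n X)"
    and cone: "\<And>X Y Z f g h. \<lbrakk>dist T X Y Z f g h; P X; P Y\<rbrakk> \<Longrightarrow> P Z"
    and summand: "\<And>X Y. \<lbrakk>retract X Y; P Y\<rbrakk> \<Longrightarrow> P X"
  shows "P X"
proof -
  let ?C = "{X \<in> Ob T. P X}"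
  have "thick_subcategory T ?C"
    unfolding thick_subcategory_def
  proof (intro conjI allI impI ballI)
    show "iso_closed T ?C"
      unfolding iso_closed_def
    proof (intro ballI allI impI)
      fix X Y f assume X: "X \<in> ?C" and Y: "Y \<in> Ob T" and f: "iso_arrow T X Y f"
      have "retract Y X" using iso_arrow_retract(2)[OF _ Y f] X by simp
      from summand[OF this] show "Y \<in> ?C" using X Y by simp
    qed
  next
    fix X Y Z assume b: "biproduct T [X, Y] Z \<and> Z \<in> ?C"
    then have "retract X Z" "retract Y Z" by (auto intro: biproduct_retract)
    then show "X \<in> ?C" "Y \<in> ?C" using b summand[of X Z] summand[of Y Z] by (simp_all add: retract_def)
  next
    fix X Y Z f g h assume "dist T X Y Z f g h \<and> X \<in> ?C \<and> Y \<in> ?C"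
    then show "Z \<in> ?C" using cone[of X Y Z f g h] distD(3)[of X Y Z f g h] by simp
  next
    show "Z \<in> ?C" if "zero_object T Z" for Z using zero[OF that] zero_object_ob[OF that] by simp
    show "sh T n X \<in> ?C" if "X \<in> ?C" for X n using shift[of X n] sh_ob[of X n] that by simp
  qed simp
  then have "thick T M \<subseteq> ?C" unfolding thick_def by (intro Inter_lower CollectI conjI) (simp_all add: Mo base)
  then show ?thesis using M X by auto
qed

end

section \<open>The heart of a silting object\<close>

locale silting_t_structure = triangulated_category K T
  for K :: "('k, 'r) ring_scheme" (structure) and T :: "('o, 'a, 'k, 'z) tri_cat_scheme" +
  fixes M :: 'o
  assumes silting: "M \<in> silt T"
    and t_str: "t_structure T (aisle T M) (coaisle T M)"
    and Hom_fin: "Hom_finite K T"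
begin

text \<open>The classes \<open>\<le> n\<close> and \<open>\<ge> n\<close> of the t-structure, in cohomological degrees.\<close>

definition le where "le n X \<longleftrightarrow> X \<in> Ob T \<and> (\<forall>i>n. van M (sh T i X))"
definition ge where "ge n X \<longleftrightarrow> X \<in> Ob T \<and> (\<forall>i<n. van M (sh T i X))"

lemma M_ob: "M \<in> Ob T" and thick_M: "thick T M = Ob T"
  using silting by (auto simp: silt_def)

lemma aisle_eq: "aisle T M = {X. le 0 X}" by (auto simp: aisle_def le_def)
lemma coaisle_eq: "coaisle T M = {X. ge 0 X}" by (auto simp: coaisle_def ge_def)
lemma heart_iff: "X \<in> heart T M \<longleftrightarrow> le 0 X \<and> ge 0 X" by (simp add: heart_def aisle_eq coaisle_eq)

lemma le_ob: "le n X \<Longrightarrow> X \<in> Ob T" and ge_ob: "ge n X \<Longrightarrow> X \<in> Ob T"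
  by (auto simp: le_def ge_def)

lemma le_M: "le 0 M"
  using silting by (auto simp: le_def silt_def)

lemma le_mono: "\<lbrakk>le m X; m \<le> n\<rbrakk> \<Longrightarrow> le n X" by (auto simp: le_def)
lemma ge_mono: "\<lbrakk>ge m X; n \<le> m\<rbrakk> \<Longrightarrow> ge n X" by (auto simp: ge_def)

lemma le_sh: "\<lbrakk>X \<in> Ob T; le (n + k) X\<rbrakk> \<Longrightarrow> le n (sh T k X)"
  by (auto simp: le_def sh_ob sh_sh)

lemma ge_sh: "\<lbrakk>X \<in> Ob T; ge (n + k) X\<rbrakk> \<Longrightarrow> ge n (sh T k X)"
  by (auto simp: ge_def sh_ob sh_sh)

lemma le_mid: "\<lbrakk>dist T X Y Z f g h; le n X; le n Z\<rbrakk> \<Longrightarrow> le n Y"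
  using van_to_mid[OF _ M_ob] by (auto simp: le_def dest: distD)

lemma le_third: "\<lbrakk>dist T X Y Z f g h; le n Y; le (n + 1) X\<rbrakk> \<Longrightarrow> le n Z"
  using van_to_third[OF _ M_ob] by (auto simp: le_def dest: distD)

lemma ge_first: "\<lbrakk>dist T X Y Z f g h; ge n Y; ge (n - 1) Z\<rbrakk> \<Longrightarrow> ge n X"
  using van_to_first[OF _ M_ob] by (auto simp: ge_def dest: distD)

lemma t_str_van: "\<lbrakk>le 0 X; ge 0 Y\<rbrakk> \<Longrightarrow> van X (sh T (- 1) Y)"
  using t_str by (simp add: t_structure_def aisle_eq coaisle_eq)

lemma t_str_truncation:
  assumes "X \<in> Ob T"
  shows "\<exists>A B f g h. le 0 A \<and> ge 0 B \<and> dist T A X (sh T (- 1) B) f g h"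
proof -
  have "\<exists>A\<in>{X. le 0 X}. \<exists>B\<in>sh T (- 1) ` {Y. ge 0 Y}. \<exists>f g h. dist T A X B f g h"
    using t_str assms by (simp add: t_structure_def aisle_eq coaisle_eq)
  then obtain A B Y f g h where "le 0 A" "ge 0 Y" "B = sh T (- 1) Y" "dist T A X B f g h"
    by (elim bexE imageE exE) simp
  then show ?thesis by (intro exI conjI) simp_all
qed

lemma van_le_ge:
  assumes X: "le n X" and Y: "ge m Y" and nm: "n < m"
  shows "van X Y"
proof -
  note Xo = le_ob[OF X] and Yo = ge_ob[OF Y]
  have "le 0 (sh T n X)" "ge 0 (sh T (n + 1) Y)"
    using le_sh[OF Xo, of 0 n] X ge_sh[OF Yo, of 0 "n + 1"] ge_mono[OF Y, of "n + 1"] nm by auto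
  then have "van (sh T n X) (sh T (- 1) (sh T (n + 1) Y))"
    by (rule t_str_van)
  then show ?thesis using Xo Yo by (simp add: sh_sh sh_ob van_sh_left Shift_zero)
qed

text \<open>The t-structure cuts between degrees 0 and 1; applying it to \<open>X[-1]\<close> and
  shifting back moves the cut to between -1 and 0.\<close>

lemma truncation:
  assumes X: "X \<in> Ob T"
  shows "\<exists>A B f g h. dist T A X B f g h \<and> le (- 1) A \<and> ge 0 B"
proof -
  obtain A Y f g h where A: "le 0 A" and Y: "ge 0 Y" and d: "dist T A (sh T (- 1) X) (sh T (- 1) Y) f g h"
    using t_str_truncation[OF sh_ob[OF X, of "- 1"]] by (elim exE conjE)
  from dist_shift1[OF d] obtain f' g' h' where
    d': "dist T (sh T 1 A) (sh T 1 (sh T (- 1) X)) (sh T 1 (sh T (- 1) Y)) f' g' h'" by (elim exE)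
  have "sh T 1 (sh T (- 1) X) = X" "sh T 1 (sh T (- 1) Y) = Y"
    using X ge_ob[OF Y] by (simp_all add: sh_sh Shift_zero)
  then have "dist T (sh T 1 A) X Y f' g' h'" using d' by simp
  moreover have "le (- 1) (sh T 1 A)" using le_sh[OF le_ob[OF A], of "- 1" 1] A by simp
  ultimately show ?thesis using Y by (intro exI conjI)
qed

lemma truncation_le:
  assumes X: "le 0 X"
  shows "\<exists>A B f g h. dist T A X B f g h \<and> le (- 1) A \<and> le 0 B \<and> ge 0 B"
proof -
  obtain A B f g h where d: "dist T A X B f g h" and A: "le (- 1) A" and B: "ge 0 B"
    using truncation[OF le_ob[OF X]] by (elim exE conjE)
  have "le 0 B" using le_third[OF d X] le_mono[OF A, of "0 + 1"] by simp
  then show ?thesis using d A B by (intro exI conjI)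
qed

text \<open>If \<open>van M L\<close>, then \<open>L\<close> is in degrees \<le> -1 and \<ge> 0 at
  once, so its identity is zero.\<close>

lemma heart_zero_iff:
  assumes "le 0 L" "ge 0 L"
  shows "zero_object T L \<longleftrightarrow> van M L"
proof
  assume v: "van M L"
  have "van M (sh T i L)" if "i > - 1" for i
  proof (cases "i = 0")
    case True then show ?thesis using v le_ob[OF assms(1)] by (simp add: Shift_zero)
  next
    case False then show ?thesis using assms(1) that by (simp add: le_def)
  qed
  then have "le (- 1) L" using assms by (simp add: le_def)
  from van_le_ge[OF this assms(2)] show "zero_object T L"
    using zero_object_iff[OF le_ob[OF assms(1)]] by simp
next
  assume "zero_object T L" then show "van M L" using M_ob by (rule zero_object_van)
qed

section \<open>Simple objects of the heart\<close>

abbreviation simple where "simple \<equiv> simple_in T (heart T M)"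

lemma simpleD: "simple S \<Longrightarrow> le 0 S" "simple S \<Longrightarrow> ge 0 S" "simple S \<Longrightarrow> S \<in> Ob T" "simple S \<Longrightarrow> \<not> zero_object T S"
  by (auto simp: simple_in_def heart_iff le_ob)

text \<open>\<open>F\<close> plays the role of the kernel of \<open>q\<close>: two morphisms from
  the heart that agree after \<open>k\<close> differ by one through \<open>L[-1]\<close>, which is
  in degrees \<ge> 1.\<close>

lemma heart_mono:
  assumes d: "dist T F S L k q m" and F: "le 0 F" and S: "le 0 S" "ge 0 S" and L: "ge 0 L"
  shows "mono_in T (heart T M) F S k"
proof -
  note D = distD[OF d]
  have F': "ge 0 F" using ge_first[OF d S(2)] ge_mono[OF L, of "0 - 1"] by simp
  show ?thesis
    unfolding mono_in_def
  proof (intro conjI ballI impI)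
    fix W a b assume W: "W \<in> heart T M" and ab: "a \<in> Mor T W F" "b \<in> Mor T W F" "k \<star> a = k \<star> b"
    have W0: "le 0 W" using W by (simp add: heart_iff)
    have "van W (sh T (- 1) L)"
      using van_le_ge[OF W0 ge_sh[OF D(3), of 1 "- 1"]] L by simp
    from mono_if_van[OF d le_ob[OF W0] this ab] show "a = b" .
  qed (use F F' S D in \<open>auto simp: heart_iff\<close>)
qed

lemma simple_kernel:
  assumes d: "dist T F S L k q m" and F: "le 0 F" and S: "simple S" and L: "ge 0 L"
  shows "zero_object T F \<or> iso_arrow T F S k"
  using heart_mono[OF d F simpleD(1,2)[OF S] L] S unfolding simple_in_def by blast

text \<open>In the language of the heart: a nonzero morphism to a simple object is surjective.\<close>

lemma cone_to_simple:
  assumes Z: "le 0 Z" and S: "simple S" and d: "dist T Z S C v g h" and v: "v \<noteq> 0[Z,S]"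
  shows "le (- 1) C"
proof -
  note D = distD[OF d]
  have C: "le 0 C" using le_third[OF d simpleD(1)[OF S]] le_mono[OF Z, of "0 + 1"] by simp
  \<comment> \<open>\<open>L\<close> is \<open>H^0\<close> of the cone, that is, the cokernel of
    \<open>v\<close> in the heart; the aim is to show that it is zero.\<close>
  obtain A L a b c where t: "dist T A C L a b c" and A: "le (- 1) A" and L: "le 0 L" "ge 0 L"
    using truncation_le[OF C] by blast
  note Dt = distD[OF t]
  have q: "b \<star> g \<in> Mor T S L" using comp_closed[OF D(2,3) Dt(3) D(5) Dt(5)] .
  obtain E p r where e: "dist T S L E (b \<star> g) p r" using dist_exists[OF D(2) Dt(3) q] by blast
  \<comment> \<open>The octahedron of \<open>S \<rightarrow> C \<rightarrow> L\<close> exhibits the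
    cone \<open>E\<close> as an extension of \<open>A[1]\<close> by \<open>Z[1]\<close>. Hence
    \<open>E[-1]\<close> is in degrees \<le> 0 and serves as the kernel of
    \<open>b \<star> g\<close>, to which simplicity applies.\<close>
  obtain u w x where o: "dist T (sh T 1 Z) E (sh T 1 A) u w x"
    using octahedral[OF dist_rot[OF d] dist_rot[OF t] e] by blast
  have E: "le (- 1) E"
    using le_mid[OF o, of "- 1"] le_sh[OF D(1), of "- 1" 1] le_sh[OF Dt(1), of "- 1" 1] Z le_mono[OF A, of 0] by simp
  obtain k where k: "dist T (sh T (- 1) E) S L k (b \<star> g) p" using dist_inv_rot[OF e] by blast
  have F: "le 0 (sh T (- 1) E)" using le_sh[OF le_ob[OF E], of 0 "- 1"] E by simp
  have "zero_object T L"
    using simple_kernel[OF k F S L(2)]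
  proof
    \<comment> \<open>Composing \<open>v\<close> with \<open>b \<star> g\<close> gives zero, so
      \<open>v\<close> factors through this kernel; a zero kernel contradicts
      \<open>v \<noteq> 0\<close>.\<close>
    assume z: "zero_object T (sh T (- 1) E)"
    note Fo = zero_object_ob[OF z]
    have "(b \<star> g) \<star> v = 0[Z,L]"
      using comp_assoc[OF D(1,2,3) Dt(3) D(4,5) Dt(5)] dist_comp_zero[OF d] comp_zero_right[OF D(1,3) Dt(3) Dt(5)] by simp
    from exact_left[OF k D(1,4) this] obtain \<psi> where \<psi>: "\<psi> \<in> Mor T Z (sh T (- 1) E)" "v = k \<star> \<psi>" by blast
    have "v = 0[Z,S]"
      using \<psi>(2) vanD[OF zero_object_van(2)[OF z D(1)] \<psi>(1)] comp_zero_right[OF D(1) Fo D(2) distD(4)[OF k]] by simp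
    then show ?thesis using v by simp
  next
    \<comment> \<open>If the kernel is all of \<open>S\<close>, then \<open>b\<close> factors
      through \<open>Z[1]\<close>, from which there is no nonzero morphism to \<open>L\<close>. With
      \<open>b = 0\<close>, the identity of \<open>L\<close> factors through \<open>A[1]\<close> and
      vanishes.\<close>
    assume i: "iso_arrow T (sh T (- 1) E) S k"
    have 0: "b \<star> g = 0[S,L]" using zero_if_iso[OF k i] .
    have "van (sh T 1 Z) L"
      using van_le_ge[OF le_sh[OF D(1), of "- 1" 1] L(2)] Z by simp
    have b0: "b = 0[C,L]"
    proof -
      have "\<exists>\<psi>\<in>Mor T (sh T 1 Z) L. b = \<psi> \<star> h" using exact_right[OF dist_rot[OF d] Dt(3,5) 0] .
      then obtain \<psi> where \<psi>: "\<psi> \<in> Mor T (sh T 1 Z) L" "b = \<psi> \<star> h" by blast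
      then show ?thesis
        using vanD[OF \<open>van (sh T 1 Z) L\<close> \<psi>(1)] comp_zero_left[OF D(3) sh_ob[OF D(1)] Dt(3) D(6)] by simp
    qed
    have "ident T L \<star> b = 0[C,L]" using b0 ident_left[OF Dt(2,3,5)] by simp
    from exact_right[OF dist_rot[OF t] Dt(3) ident_closed[OF Dt(3)] this]
    obtain \<psi> where \<psi>: "\<psi> \<in> Mor T (sh T 1 A) L" "ident T L = \<psi> \<star> c" by blast
    have "van (sh T 1 A) L" using van_le_ge[OF le_sh[OF Dt(1), of "- 1" 1] L(2)] le_mono[OF A, of 0] by simp
    then have "ident T L = 0[L,L]"
      using \<psi> vanD comp_zero_left[OF Dt(3) sh_ob[OF Dt(1)] Dt(3) Dt(6)] by metis
    then show ?thesis using zero_object_if_ident[OF Dt(3)] by blast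
  qed
  then have "van M (sh T i L)" for i using zero_object_van(2)[OF zero_object_shift M_ob] by blast
  then have "le (- 1) L" using Dt(3) by (simp add: le_def)
  then show ?thesis using le_mid[OF t A] by blast
qed

text \<open>Schur's lemma. The cone of \<open>c\<close> is in degrees \<le> -1, so its shift by -1
  is a kernel; if this kernel were all of \<open>S\<close>, then \<open>c\<close> would be
  zero.\<close>

lemma simple_nonzero_iso:
  assumes S: "simple S" and S': "simple S'" and c: "c \<in> Mor T S S'" "c \<noteq> 0[S,S']"
  shows "iso_arrow T S S' c"
proof -
  obtain C g h where d: "dist T S S' C c g h" using dist_exists[OF simpleD(3)[OF S] simpleD(3)[OF S'] c(1)] by blast
  have C: "le (- 1) C" using cone_to_simple[OF simpleD(1)[OF S] S' d c(2)] .
  obtain k where k: "dist T (sh T (- 1) C) S S' k c g" using dist_inv_rot[OF d] by blast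
  have F: "le 0 (sh T (- 1) C)" using le_sh[OF le_ob[OF C], of 0 "- 1"] C by simp
  have "\<not> iso_arrow T (sh T (- 1) C) S k" using zero_if_iso[OF k] c(2) by blast
  then show ?thesis using simple_kernel[OF k F S simpleD(2)[OF S']] iso_if_first_zero[OF k] by blast
qed

section \<open>Finite length, measured by the dimension of \<open>T(M, L)\<close>\<close>

abbreviation dimM where "dimM L \<equiv> vectorspace.dim K (Hom T M L)"

lemma fd: "\<lbrakk>X \<in> Ob T; Y \<in> Ob T\<rbrakk> \<Longrightarrow> vectorspace.fin_dim K (Hom T X Y)"
  using Hom_fin by (simp add: Hom_finite_def)

lemma dimM_pos:
  assumes "le 0 L" "ge 0 L" "\<not> zero_object T L"
  shows "dimM L > 0"
proof -
  interpret V: vectorspace K "Hom T M L" using M_ob le_ob[OF assms(1)] by (rule Hom_vectorspace)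
  show ?thesis
    using V.dim_pos fd[OF M_ob le_ob[OF assms(1)]] heart_zero_iff[OF assms(1,2)] assms(3) by (simp add: Hom_vanishes_def)
qed

text \<open>\<open>T(M, Q[-1])\<close> and \<open>T(M, F[1])\<close> vanish, so
  \<open>T(M, -)\<close> turns the triangle into a short exact sequence.\<close>

lemma dimM_add:
  assumes d: "dist T F L Q f g h" and F: "le 0 F" and Q: "ge 0 Q"
  shows "dimM L = dimM F + dimM Q"
proof (rule dim_short_exact[where i = "\<lambda>a. f \<star> a" and p = "\<lambda>a. g \<star> a"])
  note D = distD[OF d]
  show "vectorspace K (Hom T M F)" "vectorspace K (Hom T M L)" "vectorspace K (Hom T M Q)"
    by (rule Hom_vectorspace[OF M_ob]; fact D)+
  show "vectorspace.fin_dim K (Hom T M F)" "vectorspace.fin_dim K (Hom T M L)"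
    by (rule fd[OF M_ob]; fact D)+
  show "(\<lambda>a. f \<star> a) \<in> module_hom K (Hom T M F) (Hom T M L)" by (rule comp_linear_right[OF M_ob D(1,2,4)])
  show "(\<lambda>a. g \<star> a) \<in> module_hom K (Hom T M L) (Hom T M Q)" by (rule comp_linear_right[OF M_ob D(2,3,5)])
  have v1: "van M (sh T (- 1) Q)" and v2: "van M (sh T 1 F)" using F Q by (auto simp: le_def ge_def)
  show "inj_on (\<lambda>a. f \<star> a) (Mor T M F)"
    using mono_if_van[OF d M_ob v1] by (auto intro: inj_onI)
  show "(\<lambda>a. g \<star> a) ` Mor T M L = Mor T M Q"
    using lift_through[OF dist_rot[OF d] M_ob v2] comp_closed[OF M_ob D(2,3) _ D(5)] by blast
  show "(\<lambda>a. f \<star> a) ` Mor T M F = {v \<in> Mor T M L. g \<star> v = 0[M,Q]}"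
  proof (intro equalityI subsetI)
    fix x assume "x \<in> (\<lambda>a. f \<star> a) ` Mor T M F"
    then obtain a where a: "a \<in> Mor T M F" "x = f \<star> a" by blast
    have "g \<star> x = 0[M,Q]"
      using a comp_assoc[OF M_ob D(1,2,3) a(1) D(4,5)] dist_comp_zero[OF d] comp_zero_left[OF M_ob D(1,3) a(1)] by simp
    then show "x \<in> {v \<in> Mor T M L. g \<star> v = 0[M,Q]}" using a comp_closed[OF M_ob D(1,2) _ D(4)] by blast
  next
    fix x assume "x \<in> {v \<in> Mor T M L. g \<star> v = 0[M,Q]}"
    then show "x \<in> (\<lambda>a. f \<star> a) ` Mor T M F" using exact_left[OF d M_ob] by blast
  qed
qed

lemma mono_inD: "\<lbrakk>mono_in T C X Y f; W \<in> C; a \<in> Mor T W X; b \<in> Mor T W X; f \<star> a = f \<star> b\<rbrakk> \<Longrightarrow> a = b"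
  unfolding mono_in_def by blast

text \<open>For a monomorphism of the heart, \<open>M \<rightarrow> E \<rightarrow> F\<close> vanishes since it factors through the
  truncation of \<open>E\<close>, which lies in the heart; hence the cone of a monomorphism is its cokernel.\<close>

lemma heart_cokernel:
  assumes m: "mono_in T (heart T M) F L f" and d: "dist T F L Q f g h"
  shows "le 0 Q \<and> ge 0 Q"
proof -
  note D = distD[OF d]
  have F: "le 0 F" "ge 0 F" and L: "le 0 L" "ge 0 L" using m by (auto simp: mono_in_def heart_iff)
  have Q0: "le 0 Q" using le_third[OF d L(1)] le_mono[OF F(1), of "0 + 1"] by simp
  obtain k where k: "dist T (sh T (- 1) Q) F L k f g" using dist_inv_rot[OF d] by blast
  let ?E = "sh T (- 1) Q"
  note Dk = distD[OF k]
  have E: "ge 0 ?E" using ge_first[OF k F(2)] ge_mono[OF L(2), of "0 - 1"] by simp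
  obtain A Y a b c where A: "le 0 A" and Y: "ge 0 Y" and t: "dist T A ?E (sh T (- 1) Y) a b c"
    using t_str_truncation[OF Dk(1)] by (elim exE conjE)
  note Dt = distD[OF t]
  have B: "ge 1 (sh T (- 1) Y)" using ge_sh[OF ge_ob[OF Y], of 1 "- 1"] Y by simp
  have A': "ge 0 A" using ge_first[OF t E] ge_mono[OF B, of "0 - 1"] by simp
  have ka: "k \<star> a = 0[A,F]"
  proof -
    have "f \<star> (k \<star> a) = 0[A,L]"
      using comp_assoc[OF Dt(1,2) Dk(2,3) Dt(4) Dk(4,5)] dist_comp_zero[OF k] comp_zero_left[OF Dt(1,2) Dk(3) Dt(4)] by simp
    moreover have "f \<star> 0[A,F] = 0[A,L]" using comp_zero_right[OF Dt(1) Dk(2,3,5)] .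
    ultimately show ?thesis
      using mono_inD[OF m _ comp_closed[OF Dt(1,2) Dk(2) Dt(4) Dk(4)] zero_closed[OF Dt(1) Dk(2)]] A A'
      by (simp add: heart_iff)
  qed
  have "van M ?E"
  proof (rule vanI[OF M_ob Dk(1)])
    fix x assume x: "x \<in> Mor T M ?E"
    have "van M (sh T (- 1) Y)" using van_le_ge[OF le_M B] by simp
    from lift_through[OF t M_ob this x] obtain y where y: "y \<in> Mor T M A" "x = a \<star> y" by blast
    have kx: "k \<star> x = k \<star> 0[M, ?E]"
      using y comp_assoc[OF M_ob Dt(1,2) Dk(2) y(1) Dt(4) Dk(4)] ka comp_zero_left[OF M_ob Dt(1) Dk(2) y(1)]
        comp_zero_right[OF M_ob Dk(1,2,4)] by simp
    \<comment> \<open>This vanishing makes composition with \<open>k\<close> injective on morphisms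
      from \<open>M\<close>, so \<open>k \<star> x = 0\<close> gives \<open>x = 0\<close>.\<close>
    have "van M (sh T (- 1) L)" using L(2) by (simp add: ge_def)
    from mono_if_van[OF k M_ob this x zero_closed[OF M_ob Dk(1)] kx] show "x = 0[M, ?E]" .
  qed
  then have v: "van M (sh T (- 1) Q)" .
  have "van M (sh T i Q)" if "i < 0" for i
  proof (cases "i = - 1")
    case True then show ?thesis using v by simp
  next
    case False
    then have "i + 1 < 0" using that by simp
    then have "van M (sh T (i + 1) ?E)" using E by (simp add: ge_def)
    then show ?thesis using D(3) by (simp add: sh_sh)
  qed
  then have "ge 0 Q" using D(3) by (simp add: ge_def)
  then show ?thesis using Q0 by simp
qed

text \<open>Induction on \<open>dimM L\<close>: a nonzero proper subobject leaves a nonzero quotient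
  of smaller dimension, and a nonzero morphism from that quotient stays nonzero on
  \<open>L\<close>.\<close>

lemma simple_quotient:
  assumes "le 0 L" "ge 0 L" "\<not> zero_object T L"
  shows "\<exists>S \<phi>. simple S \<and> \<phi> \<in> Mor T L S \<and> \<phi> \<noteq> 0[L,S]"
  using assms
proof (induction "dimM L" arbitrary: L rule: less_induct)
  case less
  note L = less.prems
  note Lo = le_ob[OF L(1)]
  show ?case
  proof (cases "simple L")
    case True
    have "ident T L \<noteq> 0[L,L]" using zero_object_if_ident[OF Lo] L(3) by blast
    then show ?thesis using True ident_closed[OF Lo] by blast
  next
    case False
    then obtain F f where m: "mono_in T (heart T M) F L f" and nz: "\<not> zero_object T F" and ni: "\<not> iso_arrow T F L f"
      using L unfolding simple_in_def heart_iff by blast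
    have F: "le 0 F" "ge 0 F" and f: "f \<in> Mor T F L" using m by (auto simp: mono_in_def heart_iff)
    obtain Q g h where d: "dist T F L Q f g h" using dist_exists[OF le_ob[OF F(1)] Lo f] by blast
    note D = distD[OF d]
    have Q: "le 0 Q" "ge 0 Q" using heart_cokernel[OF m d] by auto
    have "\<not> zero_object T Q" using iso_if_third_zero[OF d] ni by blast
    moreover have "dimM Q < dimM L" using dimM_add[OF d F(1) Q(2)] dimM_pos[OF F nz] by simp
    ultimately obtain S \<phi> where S: "simple S" and p: "\<phi> \<in> Mor T Q S" "\<phi> \<noteq> 0[Q,S]"
      using less.hyps Q by blast
    note So = simpleD(3)[OF S]
    have v: "van (sh T 1 F) S" using van_le_ge[OF le_sh[OF D(1), of "- 1" 1] simpleD(2)[OF S]] F(1) by simp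
    have "\<phi> \<star> g \<noteq> 0[L,S]"
    proof
      assume "\<phi> \<star> g = 0[L,S]"
      then have "\<phi> \<star> g = 0[Q,S] \<star> g" using comp_zero_left[OF D(2,3) So D(5)] by simp
      from epi_if_van[OF dist_rot[OF d] So v p(1) zero_closed[OF D(3) So] this] p(2) show False by blast
    qed
    then show ?thesis using S comp_closed[OF D(2,3) So D(5) p(1)] by blast
  qed
qed

section \<open>Vanishing in high degrees and projective dimension\<close>

lemma eventually_van_le:
  assumes S: "S \<in> Ob T"
  shows "\<exists>n. \<forall>Z i. le 0 Z \<and> i \<ge> n \<longrightarrow> van S (sh T i Z)"
  \<comment> \<open>Induction over the thick closure of \<open>M\<close> in the variable
    \<open>S\<close>. The bound has to be uniform in \<open>Z\<close>, because the devissage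
    replaces \<open>Z\<close> at every step.\<close>
  using thick_M M_ob S
proof (induction rule: thick_induct)
  case base
  show ?case by (rule exI[of _ 1]) (simp add: le_def)
next
  case (zero Z)
  have "van Z (sh T i W)" if "le 0 W" for i W
    using zero_object_van(1)[OF zero sh_ob[OF le_ob[OF that]]] .
  then show ?case by simp
next
  case (shift X k)
  then obtain n where n: "\<forall>Z i. le 0 Z \<and> i \<ge> n \<longrightarrow> van X (sh T i Z)" by blast
  have "van (sh T k X) (sh T i Z)" if "le 0 Z" "i \<ge> n + k" for Z i
    using n that shift(1) le_ob[OF that(1)] by (simp add: van_sh_left sh_ob sh_sh)
  then show ?case by blast
next
  case (cone X Y Z f g h)
  then obtain n m where n: "\<forall>Z i. le 0 Z \<and> i \<ge> n \<longrightarrow> van X (sh T i Z)" and m: "\<forall>Z i. le 0 Z \<and> i \<ge> m \<longrightarrow> van Y (sh T i Z)"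
    by blast
  have "van Z (sh T i W)" if "le 0 W" "i \<ge> max (n + 1) m" for W i
    using van_from_third[OF cone(1) le_ob[OF that(1)], of i] n m that by simp
  then show ?case by blast
next
  case (summand X Y)
  then obtain n where n: "\<forall>Z i. le 0 Z \<and> i \<ge> n \<longrightarrow> van Y (sh T i Z)" by blast
  have "van X (sh T i Z)" if "le 0 Z" "i \<ge> n" for Z i
    using retract_van(2)[OF summand(1) sh_ob[OF le_ob[OF that(1)]]] n that by simp
  then show ?case by blast
qed

text \<open>Descending induction on \<open>i\<close>, starting from the bound of \<open>eventually_van_le\<close>.\<close>

lemma van_devissage:
  assumes S: "S \<in> Ob T" and P: "\<And>W i. \<lbrakk>P W; i \<ge> d\<rbrakk> \<Longrightarrow> van S (sh T i W)"
    and step: "\<And>Z. le 0 Z \<Longrightarrow> \<exists>A B f g h. dist T A Z B f g h \<and> (P A \<or> le (- 1) A) \<and> (P B \<or> le (- 1) B)"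
    and Z: "le 0 Z" and i: "i \<ge> d"
  shows "van S (sh T i Z)"
proof -
  obtain n where n: "\<forall>Z i. le 0 Z \<and> i \<ge> n \<longrightarrow> van S (sh T i Z)" using eventually_van_le[OF S] by blast
  show ?thesis using Z i
  proof (induction "nat (n - i)" arbitrary: Z i rule: less_induct)
    case less
    show ?case
    proof (cases "i \<ge> n")
      case True then show ?thesis using n less.prems by blast
    next
      case False
      obtain A B f g h where d: "dist T A Z B f g h" and A: "P A \<or> le (- 1) A" and B: "P B \<or> le (- 1) B"
        using step[OF less.prems(1)] by blast
      have *: "van S (sh T i W)" if "P W \<or> le (- 1) W" for W
        using that
      proof
        assume "P W" then show ?thesis using P less.prems(2) by blast
      next
        \<comment> \<open>Degree \<open>i\<close> of \<open>W\<close> is degree \<open>i + 1\<close>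
          of \<open>W[-1]\<close>, which is in the aisle again and one degree closer to the bound
          \<open>n\<close>.\<close>
        assume W: "le (- 1) W"
        then have "le 0 (sh T (- 1) W)" using le_sh[OF le_ob[OF W], of 0 "- 1"] by simp
        then have "van S (sh T (i + 1) (sh T (- 1) W))"
          using less.hyps[of "i + 1"] less.prems(2) False by simp
        then show ?thesis using le_ob[OF W] by (simp add: sh_sh)
      qed
      show ?thesis using van_to_mid[OF d S *[OF A] *[OF B]] .
    qed
  qed
qed

text \<open>A morphism \<open>N \<rightarrow> C\<close> lifts to \<open>Z\<close> by
  \<open>T(N, P[1]) = 0\<close>, then factors through \<open>P\<close>, hence is zero. That
  \<open>P\<close> is an iterated extension of copies of \<open>N\<close> is remembered only through
  the vanishing it inherits.\<close>

lemma right_approximation_triangle: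
  assumes N: "N \<in> Ob T" and Z: "Z \<in> Ob T" and NN: "van N (sh T 1 N)"
  shows "\<exists>P C f g h. dist T P Z C f g h \<and> van N C \<and>
    (\<forall>W\<in>Ob T. (van W N \<longrightarrow> van W P) \<and> (van N W \<longrightarrow> van P W))"
proof -
  let ?Q = "\<lambda>P. \<forall>W\<in>Ob T. (van W N \<longrightarrow> van W P) \<and> (van N W \<longrightarrow> van P W)"
  have Q0: "?Q P" if "zero_object T P" for P using zero_object_van[OF that] by simp
  have Q1: "?Q R" if "?Q P" "dist T P R N f g h" for P R f g h using van_mid[OF that(2)] that(1) by simp
  have "\<exists>P f. P \<in> Ob T \<and> ?Q P \<and> f \<in> Mor T P Z \<and> (\<forall>a\<in>Mor T N Z. \<exists>b\<in>Mor T N P. a = f \<star> b)"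
    by (rule right_approximation[where Q = ?Q, OF N Z fd[OF N Z]]) (erule Q0, erule (1) Q1)
  then obtain P f where P: "P \<in> Ob T" and v: "?Q P" and f: "f \<in> Mor T P Z"
    and fac: "\<forall>a\<in>Mor T N Z. \<exists>b\<in>Mor T N P. a = f \<star> b"
    by (elim exE conjE)
  obtain C g h where d: "dist T P Z C f g h" using dist_exists[OF P Z f] by blast
  note D = distD[OF d]
  have v1: "van N (sh T 1 P)"
    using v[rule_format, of "sh T (- 1) N"] NN N P by (simp add: van_sh_left sh_ob)
  have "van N C"
  proof (rule vanI[OF N D(3)])
    fix x assume x: "x \<in> Mor T N C"
    from lift_through[OF dist_rot[OF d] N v1 x] obtain y where y: "y \<in> Mor T N Z" "x = g \<star> y" by blast
    then obtain b where b: "b \<in> Mor T N P" "y = f \<star> b" using fac by blast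
    show "x = 0[N,C]"
      using y(2) b(2) comp_assoc[OF N D(1,2,3) b(1) D(4,5)] dist_comp_zero[OF d] comp_zero_left[OF N D(1,3) b(1)] by simp
  qed
  then show ?thesis using d v by blast
qed

text \<open>The devissage uses approximations: the cone of an \<open>M\<close>-approximation of
  \<open>Z\<close> is in degrees \<le> -1, and the approximating object shares the vanishing of
  \<open>M\<close>.\<close>

lemma van_all_le_if_van_M:
  assumes S: "S \<in> Ob T" and v: "\<And>i. i \<ge> d \<Longrightarrow> van S (sh T i M)" and Z: "le 0 Z" and i: "i \<ge> d"
  shows "van S (sh T i Z)"
proof (rule van_devissage[OF S _ _ Z i, of "\<lambda>W. W \<in> Ob T \<and> (\<forall>i\<ge>d. van S (sh T i W))"])
  fix Z assume Z: "le 0 Z"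
  have "van M (sh T 1 M)" using le_M by (simp add: le_def)
  from right_approximation_triangle[OF M_ob le_ob[OF Z] this]
  obtain P C f g h where d: "dist T P Z C f g h" and c: "van M C"
    and vP: "\<forall>W\<in>Ob T. (van W M \<longrightarrow> van W P) \<and> (van M W \<longrightarrow> van P W)" by blast
  note D = distD[OF d]
  have *: "van W (sh T j P)" if "van W (sh T j M)" "W \<in> Ob T" for W j
    using vP[rule_format, of "sh T (- j) W"] that D(1) M_ob by (simp add: van_sh_left sh_ob)
  have "le 0 P" unfolding le_def using * M_ob le_M D(1) by (auto simp: le_def)
  then have "le 0 C" using le_third[OF d Z] le_mono[of 0 P "0 + 1"] by simp
  then have "van M (sh T j C)" if "j > - 1" for j
    using that c D(3) by (cases "j = 0") (auto simp: le_def Shift_zero)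
  then have "le (- 1) C" using D(3) by (simp add: le_def)
  moreover have "\<forall>i\<ge>d. van S (sh T i P)" using * S v by blast
  ultimately show "\<exists>A B f g h. dist T A Z B f g h \<and> ((A \<in> Ob T \<and> (\<forall>i\<ge>d. van S (sh T i A))) \<or> le (- 1) A) \<and>
      ((B \<in> Ob T \<and> (\<forall>i\<ge>d. van S (sh T i B))) \<or> le (- 1) B)"
    using d D(1) by blast
qed auto

text \<open>Here the truncation triangles serve as the devissage.\<close>

lemma van_all_le_if_van_heart:
  assumes S: "S \<in> Ob T" and v: "\<And>L i. \<lbrakk>le 0 L; ge 0 L; i \<ge> d\<rbrakk> \<Longrightarrow> van S (sh T i L)" and Z: "le 0 Z" and i: "i \<ge> d"
  shows "van S (sh T i Z)"
proof (rule van_devissage[OF S _ _ Z i, of "\<lambda>W. le 0 W \<and> ge 0 W"])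
  fix Z assume "le 0 Z"
  from truncation_le[OF this]
  show "\<exists>A B f g h. dist T A Z B f g h \<and> (le 0 A \<and> ge 0 A \<or> le (- 1) A) \<and> (le 0 B \<and> ge 0 B \<or> le (- 1) B)"
    by blast
qed (use v in auto)

text \<open>For \<open>d \<ge> 1\<close> both sides amount to \<open>van S (sh T i Z)\<close> for
  all \<open>Z\<close> in the aisle and \<open>i \<ge> d\<close>; one side tests this on the heart,
  the other on \<open>M\<close>.\<close>

lemma proj_dim_le_iff:
  assumes S: "le 0 S"
  shows "proj_dim_le T M S (d - 1) \<longleftrightarrow> (\<forall>i\<ge>d. van S (sh T i M))"
proof
  assume p: "proj_dim_le T M S (d - 1)"
  show "\<forall>i\<ge>d. van S (sh T i M)"
  proof (cases "d - 1 < 0")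
    case True
    then have "zero_object T S" using p by (simp add: proj_dim_le_def)
    then show ?thesis using zero_object_van(1) sh_ob M_ob by blast
  next
    case False
    then have "van S (sh T i L)" if "le 0 L" "ge 0 L" "i \<ge> d" for L i
      using p that by (auto simp: proj_dim_le_def heart_iff)
    then show ?thesis using van_all_le_if_van_heart[OF le_ob[OF S] _ le_M] by blast
  qed
next
  assume v: "\<forall>i\<ge>d. van S (sh T i M)"
  have *: "van S (sh T i Z)" if "le 0 Z" "i \<ge> d" for Z i
    using van_all_le_if_van_M[OF le_ob[OF S] _ that] v by blast
  show "proj_dim_le T M S (d - 1)"
  proof (cases "d - 1 < 0")
    \<comment> \<open>For \<open>d \<le> 0\<close> the vanishing covers degree 0 of \<open>S\<close>
      itself, so \<open>S\<close> is a zero object, as the convention for negative dimensions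
      demands.\<close>
    case True
    then have "van S (sh T 0 S)" using *[OF S] by simp
    then show ?thesis using True le_ob[OF S] zero_object_iff by (simp add: proj_dim_le_def Shift_zero)
  next
    case False
    then show ?thesis using * by (auto simp: proj_dim_le_def heart_iff)
  qed
qed

end

section \<open>Serre duality as a statement about vanishing\<close>

context linear_category
begin

lemma Serre_functor_ob:
  assumes "Serre_functor K T \<nu>" "A \<in> Ob T"
  shows "on_ob \<nu> A \<in> Ob T"
proof -
  have "linear_endofunctor K T \<nu>"
    using assms(1) by (auto simp: Serre_functor_def autoequivalence_def quasi_inverse_def)
  then show ?thesis using assms(2) by (auto simp: linear_endofunctor_def)
qed

text \<open>\<open>T(A, B)\<close> has one element iff the dual of \<open>T(B, \<nu>A)\<close> has
  one, and by \<open>nonzero_functional\<close> this forces \<open>T(B, \<nu>A)\<close> to be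
  zero.\<close>

lemma Serre_van_iff:
  assumes ser: "Serre_functor K T \<nu>" and fd: "Hom_finite K T" and A: "A \<in> Ob T" and B: "B \<in> Ob T"
  shows "van A B \<longleftrightarrow> van B (on_ob \<nu> A)"
proof -
  note nA = Serre_functor_ob[OF ser A]
  define V where "V = Hom T B (on_ob \<nu> A)"
  obtain \<Phi> where "\<forall>X\<in>Ob T. \<forall>Y\<in>Ob T.
           \<Phi> X Y \<in> module_hom K (Hom T X Y) (dual_space K (Hom T Y (on_ob \<nu> X))) \<and>
           bij_betw (\<Phi> X Y) (Mor T X Y) (carrier (dual_space K (Hom T Y (on_ob \<nu> X))))"
    using ser unfolding Serre_functor_def by (elim conjE exE)
  then have bij: "bij_betw (\<Phi> A B) (Mor T A B) (extensional (carrier V) \<inter> module_hom K V (regular_module K))"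
    using A B by (simp add: dual_space_def V_def)
  interpret V: vectorspace K V unfolding V_def using Hom_vectorspace[OF B nA] .
  have van_V: "van B (on_ob \<nu> A) \<longleftrightarrow> carrier V = {\<zero>\<^bsub>V\<^esub>}" by (simp add: Hom_vanishes_def V_def)
  define \<zeta> where "\<zeta> = restrict (\<lambda>_. \<zero>\<^bsub>K\<^esub>) (carrier V)"
  have zeta: "\<zeta> \<in> extensional (carrier V) \<inter> module_hom K V (regular_module K)"
    by (simp add: \<zeta>_def module_hom_def regular_module_def)
  show ?thesis
  proof
    assume v: "van A B"
    show "van B (on_ob \<nu> A)"
    proof (rule ccontr)
      assume "\<not> van B (on_ob \<nu> A)"
      moreover have "V.fin_dim" using fd B nA by (simp add: Hom_finite_def V_def)
      ultimately obtain \<phi> x where \<phi>: "\<phi> \<in> extensional (carrier V) \<inter> module_hom K V (regular_module K)"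
        and x: "x \<in> carrier V" "\<phi> x \<noteq> \<zero>\<^bsub>K\<^esub>"
        using V.nonzero_functional van_V by blast
      \<comment> \<open>\<open>\<Phi> A B\<close> is onto, so \<open>\<phi>\<close> and the zero
        functional \<open>\<zeta>\<close> are both images of the only morphism
        \<open>A \<rightarrow> B\<close>.\<close>
      obtain a b where "a \<in> Mor T A B" "\<phi> = \<Phi> A B a" "b \<in> Mor T A B" "\<zeta> = \<Phi> A B b"
        using \<phi> zeta bij_betw_imp_surj_on[OF bij] by blast
      then have "\<phi> = \<zeta>" using vanD[OF v] by metis
      then show False using x by (simp add: \<zeta>_def)
    qed
  next
    assume v: "van B (on_ob \<nu> A)"
    have uniq: "\<phi> = \<zeta>" if "\<phi> \<in> extensional (carrier V) \<inter> module_hom K V (regular_module K)" for \<phi>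
    proof (rule extensionalityI[of _ "carrier V"])
      fix x assume x: "x \<in> carrier V"
      then have "x = \<zero>\<^bsub>V\<^esub>" using v van_V by blast
      have mh: "\<phi> \<in> module_hom K V (regular_module K)" using that by simp
      have cl: "\<phi> \<zero>\<^bsub>V\<^esub> \<in> carrier K" using mh by (auto simp: module_hom_def regular_module_def)
      have "\<phi> (\<zero>\<^bsub>V\<^esub> \<oplus>\<^bsub>V\<^esub> \<zero>\<^bsub>V\<^esub>) = \<phi> \<zero>\<^bsub>V\<^esub> \<oplus>\<^bsub>K\<^esub> \<phi> \<zero>\<^bsub>V\<^esub>"
        using module_hom_add[OF mh V.module.M.zero_closed V.module.M.zero_closed] by (simp add: regular_module_def)
      then have "\<phi> \<zero>\<^bsub>V\<^esub> = \<zero>\<^bsub>K\<^esub>" using cl by (simp add: add.l_cancel_one)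
      then show "\<phi> x = \<zeta> x" using x \<open>x = \<zero>\<^bsub>V\<^esub>\<close> by (simp add: \<zeta>_def)
    qed (use that zeta in auto)
    show "van A B"
    proof (rule vanI[OF A B])
      fix f assume f: "f \<in> Mor T A B"
      have "\<Phi> A B f = \<zeta>" "\<Phi> A B 0[A,B] = \<zeta>"
        using uniq bij_betwE[OF bij] f zero_closed[OF A B] by blast+
      then show "f = 0[A,B]" using bij_betw_imp_inj_on[OF bij] f zero_closed[OF A B] by (auto dest: inj_onD)
    qed
  qed
qed

end

section \<open>Left mutation\<close>

locale silting_left_mutation = silting_t_structure K T M
  for K :: "('k, 'r) ring_scheme" (structure) and T :: "('o, 'a, 'k, 'z) tri_cat_scheme" and M :: 'o +
  fixes X Y P Y0 X' N H S :: 'o and f g h :: 'a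
  assumes KS: "Krull_Schmidt T"
    and X_add: "X \<in> add_closure T M" and Y_add: "Y \<in> add_closure T M"
    and P_sum: "biproduct T [X, Y] P" and P_add: "add_closure T P = add_closure T M"
    and no_common: "\<And>Z. Z \<in> add_closure T X \<inter> add_closure T Y \<Longrightarrow> zero_object T Z"
    and approx: "left_approximation T (add_closure T Y) X Y0 f"
    and mut: "dist T X Y0 X' f g h"
    and N_sum: "biproduct T [X', Y] N"
    and is_H: "is_H0 T (aisle T M) (coaisle T M) X H"
    and top: "is_top T (heart T M) H S"
begin

lemma obs: "X \<in> Ob T" "Y \<in> Ob T" "Y0 \<in> Ob T" "X' \<in> Ob T" "P \<in> Ob T" "N \<in> Ob T"
  using distD[OF mut] biproduct_ob[OF P_sum] biproduct_ob[OF N_sum] by auto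

lemma Y0_add: "Y0 \<in> add_closure T Y" using approx by (simp add: left_approximation_def)

lemma add_van_to: "\<lbrakk>Q \<in> add_closure T R; R \<in> Ob T; W \<in> Ob T; van W (sh T i R)\<rbrakk> \<Longrightarrow> van W (sh T i Q)"
  using add_closure_van(1)[of Q R "sh T (- i) W"] add_closure_ob[of Q R]
  by (simp add: van_sh_left sh_ob)

lemma add_van_from: "\<lbrakk>Q \<in> add_closure T R; W \<in> Ob T; van R W\<rbrakk> \<Longrightarrow> van Q W"
  using add_closure_van(2)[of Q R W] by simp

lemma M_add: "M \<in> add_closure T P"
  using retract_add_closure[OF retract_refl[OF M_ob]] P_add by simp

lemma van_to_M:
  assumes "W \<in> Ob T" "van W (sh T i X)" "van W (sh T i Y)"
  shows "van W (sh T i M)"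
proof (rule add_van_to[OF M_add obs(5) assms(1)])
  have "van (sh T (- i) W) X" "van (sh T (- i) W) Y" using assms obs by (simp_all add: van_sh_left)
  then have "van (sh T (- i) W) P"
    by (intro biproduct_van_to[OF P_sum sh_ob[OF assms(1)]]) auto
  then show "van W (sh T i P)" using assms(1) obs by (simp add: van_sh_left)
qed

lemma van_from_M:
  assumes "W \<in> Ob T" "van X W" "van Y W"
  shows "van M W"
  by (rule add_van_from[OF M_add assms(1)], rule biproduct_van_from[OF P_sum assms(1)]) (use assms in auto)

lemma le_add: "Q \<in> add_closure T M \<Longrightarrow> le 0 Q"
  using add_van_to[OF _ M_ob M_ob] le_M add_closure_ob by (simp add: le_def)

text \<open>Projectivity of \<open>add M\<close>: by this, a morphism from \<open>Q\<close> lifts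
  along every morphism whose cone is in degrees \<le> -1.\<close>

lemma proj_van:
  assumes "Q \<in> add_closure T M" "le (- 1) C"
  shows "van Q C"
proof -
  have "van M (sh T 0 C)" using assms(2) unfolding le_def by simp
  then show ?thesis using add_van_from[OF assms(1) le_ob[OF assms(2)]] le_ob[OF assms(2)] by (simp add: Shift_zero)
qed

lemma van_between_add:
  assumes "Q \<in> add_closure T M" "R \<in> add_closure T M" "i > 0"
  shows "van Q (sh T i R)"
  using add_van_from[OF assms(1) sh_ob[OF le_ob[OF le_add[OF assms(2)]]]] le_add[OF assms(2)] assms(3) by (simp add: le_def)

lemma Y_Y: "i > 0 \<Longrightarrow> van Y (sh T i Y)" by (rule van_between_add[OF Y_add Y_add])

lemma van_N_to:
  assumes W: "W \<in> Ob T" and v: "van W (sh T i X')" "van W (sh T i Y)"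
  shows "van W (sh T i N)"
proof -
  have "van (sh T (- i) W) X'" "van (sh T (- i) W) Y" using assms obs by (simp_all add: van_sh_left)
  then have "van (sh T (- i) W) N"
    by (intro biproduct_van_to[OF N_sum sh_ob[OF W]]) auto
  then show ?thesis using W obs by (simp add: van_sh_left)
qed

lemma N_retracts: "retract X' N" "retract Y N"
  by (rule biproduct_retract[OF N_sum]; simp)+

lemma van_N_from:
  assumes W: "W \<in> Ob T"
  shows "van N W \<longleftrightarrow> van X' W \<and> van Y W"
proof
  show "van X' W \<and> van Y W" if "van N W"
    using retract_van(2)[OF N_retracts(1) W that] retract_van(2)[OF N_retracts(2) W that] by simp
  show "van N W" if "van X' W \<and> van Y W"
    by (rule biproduct_van_from[OF N_sum W]) (use that in auto)
qed

text \<open>Degrees above 1 come from the long exact sequence. In degree 1, a morphism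
  \<open>X'[-1] \<rightarrow> Y\<close> factors through \<open>k : X'[-1] \<rightarrow> X\<close>
  and then through the approximation \<open>f\<close>, while \<open>f \<star> k = 0\<close>.\<close>

lemma X'_Y: "i > 0 \<Longrightarrow> van X' (sh T i Y)"
proof (cases "i = 1")
  case False
  assume "i > 0"
  then show ?thesis
    using van_from_third[OF mut obs(2), of i] van_between_add[OF X_add Y_add, of "i - 1"]
      add_van_from[OF Y0_add sh_ob[OF obs(2)] Y_Y[of i]] False by simp
next
  case True
  have sY: "sh T 1 Y \<in> Ob T" using sh_ob[OF obs(2)] .
  obtain k where k: "dist T (sh T (- 1) X') X Y0 k f g" using dist_inv_rot[OF mut] by blast
  note Dk = distD[OF k]
  have "van (sh T (- 1) X') Y"
  proof (rule vanI[OF Dk(1) obs(2)])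
    fix x assume x: "x \<in> Mor T (sh T (- 1) X') Y"
    have "van (sh T (- 1) Y0) Y"
      using add_van_from[OF Y0_add sY Y_Y] obs by (simp add: van_sh_left)
    obtain m where m: "dist T (sh T (- 1) Y0) (sh T (- 1) X') X m k f" using dist_inv_rot[OF k] by blast
    from extend_through[OF m obs(2) \<open>van (sh T (- 1) Y0) Y\<close> x]
    obtain y where y: "y \<in> Mor T X Y" "x = y \<star> k" by blast
    have "Y \<in> add_closure T Y" using retract_add_closure[OF retract_refl[OF obs(2)]] .
    then obtain z where z: "z \<in> Mor T Y0 Y" "y = z \<star> f"
      using approx y(1) unfolding left_approximation_def by blast
    show "x = 0[sh T (- 1) X', Y]"
      using y(2) z(2) comp_assoc[OF Dk(1,2,3) obs(2) Dk(4,5) z(1)] dist_comp_zero[OF k] comp_zero_right[OF Dk(1,3) obs(2) z(1)] by simp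
  qed
  then show ?thesis using True obs by (simp add: van_sh_left)
qed

text \<open>With \<open>X'\<close> as target, degree \<open>i\<close> is controlled by degree
  \<open>i\<close> of \<open>Y0\<close> and degree \<open>i + 1\<close> of \<open>X\<close>.\<close>

lemma N_rigid: "i > 0 \<Longrightarrow> van N (sh T i N)"
proof -
  assume i: "i > 0"
  have Y0Y: "van Y0 (sh T j Y)" if "j > 0" for j
    using add_van_from[OF Y0_add sh_ob[OF obs(2)] Y_Y[OF that]] .
  have Y0X: "van Y0 (sh T j X)" if "j > 0" for j
    using add_van_from[OF Y0_add sh_ob[OF obs(1)] van_between_add[OF Y_add X_add that]] .
  have YX': "van Y (sh T i X')"
    using van_to_third[OF mut obs(2)] add_van_to[OF Y0_add obs(2) obs(2) Y_Y[OF i]] van_between_add[OF Y_add X_add, of "i + 1"] i by simp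
  have "van X' (sh T (i + 1) X)"
    using van_from_third[OF mut obs(1)] Y0X[of "i + 1"] van_between_add[OF X_add X_add, of i] i by simp
  then have "van X' (sh T i X')"
    using van_to_third[OF mut obs(4)] add_van_to[OF Y0_add obs(2) obs(4) X'_Y[OF i]] by simp
  then show ?thesis
    using YX' X'_Y[OF i] Y_Y[OF i] van_N_from[OF sh_ob[OF obs(6)]] van_N_to[OF obs(4)] van_N_to[OF obs(2)] by simp
qed

text \<open>The mutation triangle recovers \<open>X\<close> from \<open>X'[-1]\<close> and
  \<open>Y0\<close>, so a thick subcategory containing \<open>N\<close> contains \<open>X\<close>
  and \<open>Y\<close>, hence \<open>M\<close>.\<close>

lemma N_silt: "N \<in> silt T"
proof -
  have "M \<in> C" if C: "thick_subcategory T C" and N: "N \<in> C" for C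
  proof -
    have X': "X' \<in> C" using thick_summand[OF C N_sum N] .
    have Y: "Y \<in> C" using thick_retract[OF C N_retracts(2) N] .
    have Y0: "Y0 \<in> C" using add_closure_subset_thick[OF C Hom_fin Y Y0_add] .
    obtain k where k: "dist T (sh T (- 1) X') X Y0 k f g" using dist_inv_rot[OF mut] by blast
    have X: "X \<in> C" using thick_extension[OF C k thick_shift[OF C X'] Y0] .
    have "P \<in> C" by (rule thick_biproduct[OF C Hom_fin P_sum]) (use X Y in simp)
    then show "M \<in> C" using add_closure_subset_thick[OF C Hom_fin _ M_add] by simp
  qed
  then have "Ob T \<subseteq> thick T N" using thick_M unfolding thick_def by blast
  moreover have "thick_subcategory T (Ob T)"
    unfolding thick_subcategory_def iso_closed_def using zero_object_ob sh_ob distD biproduct_ob by auto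
  then have "thick T N \<subseteq> Ob T" unfolding thick_def using obs by blast
  ultimately show ?thesis using N_rigid obs by (auto simp: silt_def)
qed

section \<open>The cohomology \<open>H\<close> of \<open>X\<close> and its top\<close>

lemma H_quotient: "\<exists>C c u e. dist T C X H c u e \<and> le (- 1) C \<and> le 0 H \<and> ge 0 H"
proof -
  note X = le_add[OF X_add]
  obtain A B C a b e a' b' e' where A: "le 0 A" and B: "ge 0 B" and C: "le 0 C" and H: "ge 0 H"
    and d: "dist T A X (sh T (- 1) B) a b e" and d': "dist T (sh T 1 C) A H a' b' e'"
    using is_H unfolding is_H0_def aisle_eq coaisle_eq by (elim bexE imageE exE conjE) simp
  let ?B = "sh T (- 1) B"
  note D = distD[OF d] and D' = distD[OF d']
  \<comment> \<open>As \<open>X\<close> is already in degrees \<le> 0, the first truncation changes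
    nothing: \<open>?B\<close> turns out to be zero and \<open>a\<close> an isomorphism, along which
    the second triangle is transported to \<open>X\<close>.\<close>
  have b0: "b = 0[X, ?B]" using vanD[OF t_str_van[OF X B] D(5)] .
  then have "ident T ?B \<star> b = 0[X, ?B]" using ident_left[OF D(2,3) D(5)] by simp
  from exact_right[OF dist_rot[OF d] D(3) ident_closed[OF D(3)] this]
  obtain y where y: "y \<in> Mor T (sh T 1 A) ?B" "ident T ?B = y \<star> e" by blast
  have "van (sh T 1 A) ?B"
    using t_str_van[OF _ B, of "sh T 1 A"] le_sh[OF D(1), of 0 1] le_mono[OF A, of "0 + 1"] by simp
  then have "y = 0[sh T 1 A, ?B]" using vanD y(1) by blast
  then have "ident T ?B = 0[?B,?B]" using y(2) comp_zero_left[OF D(3) sh_ob[OF D(1)] D(3) D(6)] by simp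
  then have iso: "iso_arrow T A X a" using iso_if_third_zero[OF d zero_object_if_ident[OF D(3)]] by simp
  then obtain s where s: "s \<in> Mor T X A" "s \<star> a = ident T A" "a \<star> s = ident T X" by (rule iso_arrowE)
  have "dist T (sh T 1 C) X H (a \<star> a') (b' \<star> s) e'"
  proof (rule dist_iso[OF d'])
    show "iso_arrow T (sh T 1 C) (sh T 1 C) (ident T (sh T 1 C))" "iso_arrow T H H (ident T H)"
      by (rule iso_arrow_ident; fact D')+
    show "(a \<star> a') = (a \<star> a') \<star> ident T (sh T 1 C)"
      using ident_right[OF D'(1) D(2) comp_closed[OF D'(1,2) D(2) D'(4) D(4)]] by simp
    show "ident T H \<star> b' = (b' \<star> s) \<star> a"
      using comp_assoc[OF D(1,2,1) D'(3) D(4) s(1) D'(5)] s(2) ident_left[OF D'(2,3,5)] ident_right[OF D'(2,3,5)] by simp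
    show "sh_mor T 1 (ident T (sh T 1 C)) \<star> e' = e' \<star> ident T H"
      using sh_mor_ident[OF D'(1)] ident_left[OF D'(3) sh_ob[OF D'(1)] D'(6)] ident_right[OF D'(3) sh_ob[OF D'(1)] D'(6)] by simp
  qed (use D D' s iso comp_closed[OF D'(1,2) D(2) D'(4) D(4)] comp_closed[OF D(2,1) D'(3) s(1) D'(5)] in auto)
  moreover have C1: "le (- 1) (sh T 1 C)" using le_sh[OF le_ob[OF C], of "- 1" 1] C by simp
  moreover have "le 0 H" using le_third[OF d' A] le_mono[OF C1, of "0 + 1"] by simp
  ultimately show ?thesis using H by (intro exI conjI)
qed

lemma topE:
  obtains p Ss where "biproduct T Ss S" "\<And>S'. S' \<in> set Ss \<Longrightarrow> simple S'" "p \<in> Mor T H S" "le 0 S" "ge 0 S"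
    "\<And>Z a b. \<lbrakk>le 0 Z; ge 0 Z; a \<in> Mor T S Z; b \<in> Mor T S Z; a \<star> p = b \<star> p\<rbrakk> \<Longrightarrow> a = b"
    "\<And>S' q. \<lbrakk>semisimple_in T (heart T M) S'; epi_in T (heart T M) H S' q\<rbrakk> \<Longrightarrow> \<exists>r\<in>Mor T S S'. q = r \<star> p"
proof -
  obtain p Ss where 1: "S \<in> heart T M" "biproduct T Ss S" "\<forall>S'\<in>set Ss. simple S'" "epi_in T (heart T M) H S p"
    "\<forall>S' q. semisimple_in T (heart T M) S' \<and> epi_in T (heart T M) H S' q \<longrightarrow> (\<exists>r\<in>Mor T S S'. q = r \<star> p)"
    using top unfolding is_top_def semisimple_in_def[of T "heart T M" S] by (elim conjE exE)
  have 2: "p \<in> Mor T H S" "\<forall>Z\<in>heart T M. \<forall>a\<in>Mor T S Z. \<forall>b\<in>Mor T S Z. a \<star> p = b \<star> p \<longrightarrow> a = b"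
    using 1(4) unfolding epi_in_def by simp_all
  show thesis
  proof (rule that[of Ss p])
    show "a = b" if "le 0 Z" "ge 0 Z" "a \<in> Mor T S Z" "b \<in> Mor T S Z" "a \<star> p = b \<star> p" for Z a b
      using 2(2)[rule_format, of Z a b] that by (simp add: heart_iff)
  qed (use 1 2 in \<open>simp_all add: heart_iff\<close>)
qed

lemma S_heart: "le 0 S" "ge 0 S" "S \<in> Ob T"
  by (rule topE; simp add: le_ob)+

text \<open>A simple summand of \<open>S\<close> that is hit by \<open>W\<close> is hit by
  \<open>X\<close> too, through \<open>X \<rightarrow> H \<rightarrow> S \<rightarrow> S'\<close>.
  Two nonzero morphisms to one simple object are what the lifting arguments start from.\<close>

lemma nonzero_to_top:
  assumes W: "W \<in> Ob T" and x: "x \<in> Mor T W S" "x \<noteq> 0[W,S]"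
  shows "\<exists>S' y w. simple S' \<and> retract S' S \<and> y \<in> Mor T W S' \<and> y \<noteq> 0[W,S'] \<and> w \<in> Mor T X S' \<and> w \<noteq> 0[X,S']"
proof (rule topE)
  fix p Ss
  assume Ss: "biproduct T Ss S" "\<And>S'. S' \<in> set Ss \<Longrightarrow> simple S'" and p: "p \<in> Mor T H S"
    and epi: "\<And>Z a b. \<lbrakk>le 0 Z; ge 0 Z; a \<in> Mor T S Z; b \<in> Mor T S Z; a \<star> p = b \<star> p\<rbrakk> \<Longrightarrow> a = b"
  obtain S' i q where S': "S' \<in> set Ss" and i: "i \<in> Mor T S' S" and q: "q \<in> Mor T S S'"
    and qi: "q \<star> i = ident T S'" and nz: "q \<star> x \<noteq> 0[W,S']"
    using biproduct_nonzero_to[OF Ss(1) W x] by (elim bexE conjE)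
  note simp' = Ss(2)[OF S']
  note S'o = simpleD(3)[OF simp'] and So = S_heart(3)
  have rt: "retract S' S" using retractI[OF S'o So i q qi] .
  obtain C c u e where d: "dist T C X H c u e" and C: "le (- 1) C" and H: "le 0 H" "ge 0 H"
    using H_quotient by (elim exE conjE)
  note D = distD[OF d]
  have qp: "q \<star> p \<in> Mor T H S'" using comp_closed[OF D(3) So S'o p q] .
  have "q \<star> p \<noteq> 0[H,S']"
  proof
    assume "q \<star> p = 0[H,S']"
    then have "q \<star> p = 0[S,S'] \<star> p" using comp_zero_left[OF D(3) So S'o p] by simp
    from epi[OF simpleD(1,2)[OF simp'] q zero_closed[OF So S'o] this]
    have "ident T S' = 0[S',S']" using qi comp_zero_left[OF S'o So S'o i] by simp
    then show False using zero_object_if_ident[OF S'o] simpleD(4)[OF simp'] by blast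
  qed
  moreover have "van (sh T 1 C) S'"
    using van_le_ge[OF le_sh[OF D(1), of "- 1" 1] simpleD(2)[OF simp']] le_mono[OF C, of "- 1 + 1"] by simp
  ultimately have "(q \<star> p) \<star> u \<noteq> 0[X,S']"
    using epi_if_van[OF dist_rot[OF d] S'o _ qp zero_closed[OF D(3) S'o]] comp_zero_left[OF D(2,3) S'o D(5)] by metis
  then show ?thesis
    using simp' rt comp_closed[OF W So S'o x(1) q] nz comp_closed[OF D(2,3) S'o D(5) qp] by blast
qed

text \<open>The morphism \<open>w\<close> factors through \<open>H\<close>; the induced
  \<open>H \<rightarrow> S'\<close> is epi in the heart, so it factors through the top. Schur's
  lemma then identifies \<open>S'\<close> with a simple summand of \<open>S\<close>.\<close>

lemma simple_retract_of_top:
  assumes S': "simple S'" and w: "w \<in> Mor T X S'" "w \<noteq> 0[X,S']"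
  shows "retract S' S"
proof (rule topE)
  fix p Ss
  assume Ss: "biproduct T Ss S" "\<And>S'. S' \<in> set Ss \<Longrightarrow> simple S'" and p: "p \<in> Mor T H S"
    and univ: "\<And>S' q. \<lbrakk>semisimple_in T (heart T M) S'; epi_in T (heart T M) H S' q\<rbrakk> \<Longrightarrow> \<exists>r\<in>Mor T S S'. q = r \<star> p"
  note S'o = simpleD(3)[OF S'] and So = S_heart(3)
  obtain C c u e where d: "dist T C X H c u e" and C: "le (- 1) C" and H: "le 0 H" "ge 0 H"
    using H_quotient by (elim exE conjE)
  note D = distD[OF d]
  have "van C S'" using van_le_ge[OF C simpleD(2)[OF S']] by simp
  from extend_through[OF d S'o this w(1)] obtain q where q: "q \<in> Mor T H S'" "w = q \<star> u" by blast
  have q0: "q \<noteq> 0[H,S']" using q(2) w(2) comp_zero_left[OF D(2,3) S'o D(5)] by auto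
  obtain E a b where dq: "dist T H S' E q a b" using dist_exists[OF D(3) S'o q(1)] by blast
  have E: "le (- 1) E" using cone_to_simple[OF H(1) S' dq q0] .
  have "epi_in T (heart T M) H S' q"
    unfolding epi_in_def
  proof (intro conjI ballI impI)
    fix Z x y assume Z: "Z \<in> heart T M" and xy: "x \<in> Mor T S' Z" "y \<in> Mor T S' Z" "x \<star> q = y \<star> q"
    have Z0: "ge 0 Z" using Z by (simp add: heart_iff)
    show "x = y" using epi_if_van[OF dq ge_ob[OF Z0] van_le_ge[OF E Z0] xy] by simp
  qed (use H q simpleD(1,2)[OF S'] in \<open>simp_all add: heart_iff\<close>)
  moreover have "semisimple_in T (heart T M) S'"
    unfolding semisimple_in_def using biproduct_single[OF S'o] S' simpleD(1,2)[OF S'] by (auto simp: heart_iff)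
  ultimately obtain r where r: "r \<in> Mor T S S'" "q = r \<star> p" using univ by blast
  have "r \<noteq> 0[S,S']" using r(2) q0 comp_zero_left[OF D(3) So S'o p] by auto
  from biproduct_nonzero_from[OF Ss(1) S'o r(1) this] obtain S1 i where
    S1: "S1 \<in> set Ss" and i: "i \<in> Mor T S1 S" and ri: "r \<star> i \<noteq> 0[S1,S']" by blast
  note S1s = Ss(2)[OF S1]
  note S1o = simpleD(3)[OF S1s]
  have "iso_arrow T S1 S' (r \<star> i)" using simple_nonzero_iso[OF S1s S' comp_closed[OF S1o So S'o i r(1)] ri] .
  then obtain j where j: "j \<in> Mor T S' S1" "(r \<star> i) \<star> j = ident T S'" by (auto simp: iso_arrow_def)
  have "r \<star> (i \<star> j) = ident T S'" using comp_assoc[OF S'o S1o So S'o j(1) i r(1)] j(2) by simp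
  then show ?thesis using retractI[OF S'o So comp_closed[OF S'o S1o So j(1) i] r(1)] by blast
qed

text \<open>
  Otherwise \<open>Y\<close> and a summand \<open>A\<close> of \<open>X\<close> with local endomorphism ring map onto the same simple object.
  By projectivity the two maps factor through each other, which makes \<open>A\<close> a retract of \<open>Y\<close>.
\<close>

lemma van_Y_S: "van Y S"
proof (rule vanI[OF obs(2) S_heart(3)], rule ccontr)
  fix v assume "v \<in> Mor T Y S" "v \<noteq> 0[Y,S]"
  from nonzero_to_top[OF obs(2) this] obtain S' v w where S': "simple S'"
    and v: "v \<in> Mor T Y S'" "v \<noteq> 0[Y,S']" and w: "w \<in> Mor T X S'" "w \<noteq> 0[X,S']"
    by (elim exE conjE)
  note S'o = simpleD(3)[OF S']
  obtain Xs where Xs: "biproduct T Xs X" and loc: "\<And>Z. Z \<in> set Xs \<Longrightarrow> local_ring (End_ring T Z)"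
    using KS obs(1) unfolding Krull_Schmidt_def by blast
  obtain A i q where A: "A \<in> set Xs" and i: "i \<in> Mor T A X" and q: "q \<in> Mor T X A" and qi: "q \<star> i = ident T A"
    and wi: "w \<star> i \<noteq> 0[A,S']"
    using biproduct_nonzero_from[OF Xs S'o w] by (elim bexE conjE)
  have Ao: "A \<in> Ob T" using biproduct_ob(2)[OF Xs A] .
  have AX: "retract A X" using retractI[OF Ao obs(1) i q qi] .
  have u: "w \<star> i \<in> Mor T A S'" using comp_closed[OF Ao obs(1) S'o i w(1)] .
  have van_A: "van A C" if "le (- 1) C" for C
    using retract_van(2)[OF AX le_ob[OF that] proj_van[OF X_add that]] .
  have le_A: "le 0 A"
    unfolding le_def
  proof (intro conjI Ao allI impI)
    fix j :: int assume "j > 0"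
    then have "van (sh T (- j) M) X" using le_add[OF X_add] M_ob by (simp add: le_def van_sh_left)
    from retract_van(1)[OF AX sh_ob[OF M_ob] this] show "van M (sh T j A)" using Ao M_ob by (simp add: van_sh_left)
  qed
  obtain C a b where d: "dist T Y S' C v a b" using dist_exists[OF obs(2) S'o v(1)] by blast
  obtain s where s: "s \<in> Mor T A Y" "w \<star> i = v \<star> s"
    using lift_through[OF d Ao van_A[OF cone_to_simple[OF le_add[OF Y_add] S' d v(2)]] u] by blast
  obtain C' a' b' where d': "dist T A S' C' (w \<star> i) a' b'" using dist_exists[OF Ao S'o u] by blast
  obtain t where t: "t \<in> Mor T Y A" "v = (w \<star> i) \<star> t"
    using lift_through[OF d' obs(2) proj_van[OF Y_add cone_to_simple[OF le_A S' d' wi]] v(1)] by blast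
  have "retract A Y" using local_End_retract[OF loc[OF A] Ao obs(2) S'o u wi v(1) s t] .
  then have "zero_object T A" using no_common retract_add_closure AX by blast
  then have "van A S'" using zero_object_van(1) S'o by blast
  then show False using vanD u wi by blast
qed

text \<open>From a nonzero \<open>Z \<rightarrow> S\<close> one gets a nonzero
  \<open>X \<rightarrow> S'\<close> that lifts to \<open>Z\<close> by projectivity. The hypothesis
  extends the lift along \<open>f\<close> to \<open>Y0\<close>, which has no nonzero morphism to
  \<open>S'\<close>.\<close>

lemma van_top_if_van_X':
  assumes Z: "le 0 Z" and v: "van X' (sh T 1 Z)"
  shows "van Z S"
proof (rule vanI[OF le_ob[OF Z] S_heart(3)], rule ccontr)
  note Zo = le_ob[OF Z]
  fix x assume "x \<in> Mor T Z S" "x \<noteq> 0[Z,S]"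
  from nonzero_to_top[OF Zo this] obtain S' y w where S': "simple S'" and rt: "retract S' S"
    and y: "y \<in> Mor T Z S'" "y \<noteq> 0[Z,S']" and w: "w \<in> Mor T X S'" "w \<noteq> 0[X,S']"
    by (elim exE conjE)
  note S'o = simpleD(3)[OF S']
  obtain C a b where d: "dist T Z S' C y a b" using dist_exists[OF Zo S'o y(1)] by blast
  obtain z where z: "z \<in> Mor T X Z" "w = y \<star> z"
    using lift_through[OF d obs(1) proj_van[OF X_add cone_to_simple[OF Z S' d y(2)]] w(1)] by blast
  obtain k where k: "dist T (sh T (- 1) X') X Y0 k f g" using dist_inv_rot[OF mut] by blast
  have "van (sh T (- 1) X') Z" using v obs Zo by (simp add: van_sh_left)
  from extend_through[OF k Zo this z(1)] obtain z' where z': "z' \<in> Mor T Y0 Z" "z = z' \<star> f" by blast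
  note fm = distD(4)[OF mut]
  have "van Y0 S'" using add_van_from[OF Y0_add S'o retract_van(1)[OF rt obs(2) van_Y_S]] .
  then have "y \<star> z' = 0[Y0,S']" using vanD comp_closed[OF obs(3) Zo S'o z'(1) y(1)] by blast
  then have "w = 0[X,S']"
    using z(2) z'(2) comp_assoc[OF obs(1,3) Zo S'o fm z'(1) y(1)] comp_zero_left[OF obs(1,3) S'o fm] by simp
  then show False using w(2) by simp
qed

text \<open>By projectivity a simple quotient of \<open>L\<close> receives nothing from
  \<open>Y\<close>. Since \<open>M\<close> detects nonzero objects of the heart and belongs to
  \<open>add (X \<oplus> Y)\<close>, there is a nonzero morphism from \<open>X\<close> to
  it.\<close>

lemma quotient_in_top:
  assumes L: "le 0 L" "ge 0 L" "\<not> zero_object T L" and v: "van Y L"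
  shows "\<exists>S' \<phi>. simple S' \<and> \<phi> \<in> Mor T L S' \<and> \<phi> \<noteq> 0[L,S'] \<and> van Y S' \<and> retract S' S"
proof -
  obtain S' \<phi> where S': "simple S'" and p: "\<phi> \<in> Mor T L S'" "\<phi> \<noteq> 0[L,S']" using simple_quotient[OF L] by (elim exE conjE)
  note S'o = simpleD(3)[OF S']
  obtain C a b where d: "dist T L S' C \<phi> a b" using dist_exists[OF le_ob[OF L(1)] S'o p(1)] by blast
  have C: "van Y C" using proj_van[OF Y_add cone_to_simple[OF L(1) S' d p(2)]] .
  have Y: "van Y S'" by (rule van_mid(1)[OF d obs(2) v C])
  have "\<not> van X S'"
    using van_from_M[OF S'o _ Y] heart_zero_iff[OF simpleD(1,2)[OF S']] simpleD(4)[OF S'] by blast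
  then obtain w where "w \<in> Mor T X S'" "w \<noteq> 0[X,S']" using vanI[OF obs(1) S'o] by blast
  then show ?thesis using simple_retract_of_top[OF S'] S' p Y by blast
qed

text \<open>\<open>L\<close> is \<open>H^0\<close> of the cone \<open>C\<close> of the
  approximation. From \<open>van Y C\<close> and projectivity follows \<open>van Y L\<close>, which
  is what makes \<open>quotient_in_top\<close> applicable to \<open>L\<close>.\<close>

lemma Y_approximation:
  assumes Z: "le 0 Z"
  shows "\<exists>Q C a b c A L a' b' c'. dist T Q Z C a b c \<and> le 0 Q \<and> (\<forall>W\<in>Ob T. (van W Y \<longrightarrow> van W Q) \<and> (van Y W \<longrightarrow> van Q W)) \<and>
    le 0 C \<and> dist T A C L a' b' c' \<and> le (- 1) A \<and> le 0 L \<and> ge 0 L \<and> van Y L"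
proof -
  from right_approximation_triangle[OF obs(2) le_ob[OF Z] Y_Y[of 1]]
  obtain Q C a b c where d: "dist T Q Z C a b c" and YC: "van Y C"
    and Q: "\<forall>W\<in>Ob T. (van W Y \<longrightarrow> van W Q) \<and> (van Y W \<longrightarrow> van Q W)" by auto
  note D = distD[OF d]
  have "van M (sh T i Q)" if "i > 0" for i
  proof -
    have "van (sh T (- i) M) Y" using le_add[OF Y_add] that M_ob obs by (simp add: le_def van_sh_left)
    then have "van (sh T (- i) M) Q" using Q sh_ob[OF M_ob] by blast
    then show ?thesis using M_ob D(1) by (simp add: van_sh_left)
  qed
  then have leQ: "le 0 Q" using D(1) by (simp add: le_def)
  have leC: "le 0 C" using le_third[OF d Z] le_mono[OF leQ, of "0 + 1"] by simp
  obtain A L a' b' c' where t: "dist T A C L a' b' c'" and A: "le (- 1) A" and L: "le 0 L" "ge 0 L"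
    using truncation_le[OF leC] by (elim exE conjE)
  have "le (- 1) (sh T 1 A)" using le_sh[OF le_ob[OF A], of "- 1" 1] le_mono[OF A, of "- 1 + 1"] by simp
  then have "van Y L" using van_mid(1)[OF dist_rot[OF t] obs(2) YC] proj_van[OF Y_add] by blast
  then show ?thesis using d Q leQ leC t A L by blast
qed

text \<open>The cone \<open>C\<close> inherits \<open>van C S\<close>, so a nonzero \<open>L\<close>
  would contradict \<open>quotient_in_top\<close>. With \<open>L = 0\<close> one has
  \<open>T(X, C) = 0\<close>, hence \<open>T(X', C[1]) = 0\<close>; the approximating object
  contributes nothing, by \<open>X'_Y\<close>.\<close>

lemma van_X'_if_van_top:
  assumes Z: "le 0 Z" and v: "van Z S"
  shows "van X' (sh T 1 Z)"
proof -
  obtain Q C a b c A L a' b' c' where d: "dist T Q Z C a b c" and leQ: "le 0 Q"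
    and Q: "\<forall>W\<in>Ob T. (van W Y \<longrightarrow> van W Q) \<and> (van Y W \<longrightarrow> van Q W)" and leC: "le 0 C"
    and t: "dist T A C L a' b' c'" and A: "le (- 1) A" and L: "le 0 L" "ge 0 L" and YL: "van Y L"
    using Y_approximation[OF Z] by (elim exE conjE)
  note D = distD[OF d] and Dt = distD[OF t]
  have sQ: "le (- 1) (sh T 1 Q)" using le_sh[OF D(1), of "- 1" 1] leQ by simp
  have CS: "van C S" by (rule van_mid(2)[OF dist_rot[OF d] S_heart(3) v]) (rule van_le_ge[OF sQ S_heart(2)], simp)
  have "zero_object T L"
  proof (rule ccontr)
    assume "\<not> zero_object T L"
    from quotient_in_top[OF L this YL] obtain S' \<phi> where S': "simple S'" and p: "\<phi> \<in> Mor T L S'" "\<phi> \<noteq> 0[L,S']"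
      and rt: "retract S' S" by (elim exE conjE)
    note S'o = simpleD(3)[OF S']
    have "van C S'" using retract_van(1)[OF rt Dt(2) CS] .
    then have "\<phi> \<star> b' = 0[C,S']" using vanD comp_closed[OF Dt(2,3) S'o Dt(5) p(1)] by blast
    then have e: "\<phi> \<star> b' = 0[L,S'] \<star> b'" using comp_zero_left[OF Dt(2,3) S'o Dt(5)] by simp
    have sA: "le (- 1) (sh T 1 A)" using le_sh[OF Dt(1), of "- 1" 1] le_mono[OF A, of "- 1 + 1"] by simp
    have "van (sh T 1 A) S'" using van_le_ge[OF sA simpleD(2)[OF S']] by simp
    from epi_if_van[OF dist_rot[OF t] S'o this p(1) zero_closed[OF Dt(3) S'o] e] p(2) show False by simp
  qed
  then have XL: "van X L" using zero_object_van(2) obs(1) by blast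
  have XC: "van X (sh T 0 C)" using van_mid(1)[OF t obs(1) proj_van[OF X_add A] XL] Dt(2) by (simp add: Shift_zero)
  have "van Y (sh T 1 C)"
    using add_van_from[OF Y_add sh_ob[OF D(3)]] leC by (simp add: le_def)
  then have "van Y0 (sh T 1 C)" using add_van_from[OF Y0_add sh_ob[OF D(3)]] by blast
  then have X'C: "van X' (sh T 1 C)" using van_from_third[OF mut D(3), of 1] XC by simp
  have "van (sh T (- 1) X') Y" using X'_Y[of 1] obs by (simp add: van_sh_left)
  then have "van (sh T (- 1) X') Q" using Q sh_ob[OF obs(4)] by blast
  then have "van X' (sh T 1 Q)" using obs D(1) by (simp add: van_sh_left)
  then show ?thesis using van_to_mid[OF d obs(4)] X'C by blast
qed

text \<open>\<open>L\<close> has a simple quotient that is a retract of \<open>S\<close>; its kernel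
  is again in the heart, receives nothing from \<open>Y\<close> and has smaller
  \<open>dimM\<close>.\<close>

lemma van_S_filtered:
  assumes "le 0 L" "ge 0 L" "van Y L" and SS: "van S (sh T d S)"
  shows "van S (sh T d L)"
  using assms(1-3)
proof (induction "dimM L" arbitrary: L rule: less_induct)
  case less
  note L = less.prems
  note Lo = le_ob[OF L(1)]
  show ?case
  proof (cases "zero_object T L")
    case True
    then show ?thesis using zero_object_van(2)[OF zero_object_shift S_heart(3)] by blast
  next
    case False
    obtain S' \<phi> where S': "simple S'" and p: "\<phi> \<in> Mor T L S'" "\<phi> \<noteq> 0[L,S']" and rt: "retract S' S"
      using quotient_in_top[OF L(1,2) False L(3)] by (elim exE conjE)
    note S'o = simpleD(3)[OF S']
    obtain C a b where dl: "dist T L S' C \<phi> a b" using dist_exists[OF Lo S'o p(1)] by blast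
    have C: "le (- 1) C" using cone_to_simple[OF L(1) S' dl p(2)] .
    let ?F = "sh T (- 1) C"
    obtain k where k: "dist T ?F L S' k \<phi> a" using dist_inv_rot[OF dl] by blast
    note D = distD[OF k]
    have F: "le 0 ?F" using le_sh[OF le_ob[OF C], of 0 "- 1"] C by simp
    have F': "ge 0 ?F" using ge_first[OF k L(2)] ge_mono[OF simpleD(2)[OF S'], of "0 - 1"] by simp
    have "van Y (sh T (- 1) S')"
      using van_le_ge[OF le_add[OF Y_add] ge_sh[OF S'o, of 1 "- 1"]] simpleD(2)[OF S'] by simp
    then have "van Y (sh T 0 ?F)" using van_to_first[OF k obs(2), of 0] L(3) Lo by (simp add: Shift_zero)
    then have YF: "van Y ?F" using D(1) by (simp add: Shift_zero)
    have "dimM ?F < dimM L"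
      using dimM_add[OF k F simpleD(2)[OF S']] dimM_pos[OF simpleD(1,2,4)[OF S']] by simp
    then have "van S (sh T d ?F)" using less.hyps F F' YF by blast
    moreover have "van (sh T (- d) S) S'"
      using retract_van(1)[OF rt sh_ob[OF S_heart(3)]] SS S_heart(3) by (simp add: van_sh_left)
    then have "van S (sh T d S')" using S_heart(3) S'o by (simp add: van_sh_left)
    ultimately show ?thesis using van_to_mid[OF k S_heart(3)] by blast
  qed
qed

text \<open>\<open>X\<close> is assembled from three pieces: \<open>Q\<close>, which inherits the
  vanishing of \<open>Y\<close>; \<open>L\<close>, which is treated by
  \<open>van_S_filtered\<close>; and \<open>A\<close> in degrees \<le> -1, for which degree
  \<open>d\<close> is degree \<open>d + 1\<close> of \<open>A[-1]\<close>.\<close>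

lemma van_S_X:
  assumes Y: "van S (sh T d Y)" and SS: "van S (sh T d S)" and M: "\<And>i. i > d \<Longrightarrow> van S (sh T i M)"
  shows "van S (sh T d X)"
proof -
  obtain Q C a b c A L a' b' c' where d: "dist T Q X C a b c"
    and Q: "\<forall>W\<in>Ob T. (van W Y \<longrightarrow> van W Q) \<and> (van Y W \<longrightarrow> van Q W)"
    and t: "dist T A C L a' b' c'" and A: "le (- 1) A" and L: "le 0 L" "ge 0 L" and YL: "van Y L"
    using Y_approximation[OF le_add[OF X_add]] by (elim exE conjE)
  have So: "S \<in> Ob T" using S_heart(3) .
  have A': "le 0 (sh T (- 1) A)" using le_sh[OF le_ob[OF A], of 0 "- 1"] A by simp
  have "van S (sh T (d + 1) (sh T (- 1) A))"
    by (rule van_all_le_if_van_M[OF So _ A', of "d + 1"]) (use M in auto)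
  then have "van S (sh T d A)" using le_ob[OF A] by (simp add: sh_sh)
  then have C: "van S (sh T d C)" using van_to_mid[OF t So] van_S_filtered[OF L YL SS] by blast
  have "van (sh T (- d) S) Y" using Y So obs(2) by (simp add: van_sh_left)
  then have "van (sh T (- d) S) Q" using Q sh_ob[OF So] by blast
  then have "van S (sh T d Q)" using So distD(1)[OF d] by (simp add: van_sh_left)
  then show ?thesis using van_to_mid[OF d So] C by blast
qed

text \<open>The mutation triangle bounds \<open>T(X, Z[i])\<close> by \<open>T(Y0, Z[i])\<close> and
  \<open>T(X', Z[i + 1])\<close>.\<close>

lemma le_if_N:
  assumes Z: "Z \<in> Ob T" and v: "\<And>i. i > 0 \<Longrightarrow> van N (sh T i Z)"
  shows "le 0 Z"
proof -
  have v': "van X' (sh T i Z) \<and> van Y (sh T i Z)" if "i > 0" for i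
    using v[OF that] van_N_from[OF sh_ob[OF Z]] by blast
  have "van X (sh T i Z)" if "i > 0" for i
    using van_from_first[OF mut Z, of i] add_van_from[OF Y0_add sh_ob[OF Z]] v'[of i] v'[of "i + 1"] that by simp
  then show ?thesis using van_from_M[OF sh_ob[OF Z]] v' Z by (simp add: le_def)
qed

end

section \<open>Vanishing against the quasi-inverse of \<open>nu_d\<close>\<close>

context triangulated_category
begin

text \<open>The quasi-inverse gives \<open>\<nu>(GZ[-d]) \<cong> Z\<close>, so Serre duality yields
  the second claim; duality for \<open>A\<close> followed by the second claim yields the third. No
  shift is ever moved across \<open>\<nu>\<close>.\<close>

lemma nu_d_inverse_van_iff:
  assumes ser: "Serre_functor K T \<nu>" and fd: "Hom_finite K T" and qi: "quasi_inverse K T (nu_d T \<nu> d) G"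
    and Z: "Z \<in> Ob T"
  shows nu_d_inverse_ob: "on_ob G Z \<in> Ob T"
    and nu_d_inverse_van_from: "Q \<in> Ob T \<Longrightarrow> van (on_ob G Z) (sh T d Q) \<longleftrightarrow> van Q Z"
    and nu_d_inverse_van_to: "A \<in> Ob T \<Longrightarrow> van A (sh T i (on_ob G Z)) \<longleftrightarrow> van (on_ob \<nu> A) (sh T (i + d) Z)"
proof -
  have "on_ob G \<in> Ob T \<rightarrow> Ob T"
    using qi unfolding quasi_inverse_def linear_endofunctor_def by simp
  then show GZ: "on_ob G Z \<in> Ob T" using Z by blast
  have sGZ: "sh T (- d) (on_ob G Z) \<in> Ob T" by (rule sh_ob[OF GZ])
  let ?Z' = "on_ob \<nu> (sh T (- d) (on_ob G Z))"
  have Z': "?Z' \<in> Ob T" by (rule Serre_functor_ob[OF ser sGZ])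
  have "naturally_isomorphic T (comp_fun (nu_d T \<nu> d) G) id_fun"
    using qi unfolding quasi_inverse_def by simp
  then obtain \<eta> where "iso_arrow T ?Z' Z (\<eta> Z)"
    using Z unfolding naturally_isomorphic_def by (auto simp: comp_fun_def nu_d_def id_fun_def)
  note r = iso_arrow_retract[OF Z' Z this]
  show *: "van (on_ob G Z) (sh T d Q) \<longleftrightarrow> van Q Z" if Q: "Q \<in> Ob T" for Q
  proof -
    have "van Q Z \<longleftrightarrow> van Q ?Z'" using retract_van(1)[OF r(1) Q] retract_van(1)[OF r(2) Q] by blast
    also have "\<dots> \<longleftrightarrow> van (sh T (- d) (on_ob G Z)) Q" using Serre_van_iff[OF ser fd sGZ Q] by simp
    also have "\<dots> \<longleftrightarrow> van (on_ob G Z) (sh T d Q)" using van_sh_left[OF GZ Q, of "- d"] by simp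
    finally show ?thesis by simp
  qed
  show "van A (sh T i (on_ob G Z)) \<longleftrightarrow> van (on_ob \<nu> A) (sh T (i + d) Z)" if A: "A \<in> Ob T"
  proof -
    have nA: "on_ob \<nu> A \<in> Ob T" by (rule Serre_functor_ob[OF ser A])
    have "van A (sh T i (on_ob G Z)) \<longleftrightarrow> van (sh T i (on_ob G Z)) (on_ob \<nu> A)"
      by (rule Serre_van_iff[OF ser fd A sh_ob[OF GZ]])
    also have "\<dots> \<longleftrightarrow> van (on_ob G Z) (sh T (- i) (on_ob \<nu> A))" by (rule van_sh_left[OF GZ nA])
    also have "sh T (- i) (on_ob \<nu> A) = sh T d (sh T (- i - d) (on_ob \<nu> A))" using nA by (simp add: sh_sh)
    also have "van (on_ob G Z) \<dots> \<longleftrightarrow> van (sh T (- i - d) (on_ob \<nu> A)) Z" by (rule *[OF sh_ob[OF nA]])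
    also have "\<dots> \<longleftrightarrow> van (on_ob \<nu> A) (sh T (i + d) Z)" using van_sh_left[OF nA Z, of "- i - d"] by (simp add: add.commute)
    finally show ?thesis .
  qed
qed

end

section \<open>The three conditions of the equivalence\<close>

context silting_left_mutation
begin

context
  fixes \<nu> G :: "('o, 'a) endofun" and d :: int
  assumes serre: "Serre_functor K T \<nu>" and quasi_inv: "quasi_inverse K T (nu_d T \<nu> d) G"
    and M_silt_d: "M \<in> silt_d T G"
begin

lemmas G_ob = nu_d_inverse_ob[OF serre Hom_fin quasi_inv]
lemmas G_van_from = nu_d_inverse_van_from[OF serre Hom_fin quasi_inv]
lemmas G_van_to = nu_d_inverse_van_to[OF serre Hom_fin quasi_inv]

lemma le_GM: "le 0 (on_ob G M)"
  using M_silt_d G_ob[OF M_ob] by (simp add: silt_d_def silt_ge_def le_def)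

text \<open>As \<open>GM\<close> is in the aisle, the vanishing for \<open>X'\<close> in degrees
  above 1 follows from that for \<open>X\<close> and \<open>Y0\<close>; degree 1 is all that
  remains.\<close>

lemma N_ge_GM_iff: "silt_ge T N (on_ob G M) \<longleftrightarrow> van X' (sh T 1 (on_ob G M))"
proof
  note GM = le_ob[OF le_GM]
  show "van X' (sh T 1 (on_ob G M))" if "silt_ge T N (on_ob G M)"
    using that van_N_from[OF sh_ob[OF GM]] by (simp add: silt_ge_def)
  assume v: "van X' (sh T 1 (on_ob G M))"
  have A: "van A (sh T i (on_ob G M))" if "A \<in> add_closure T M" "i > 0" for A i
    using add_van_from[OF that(1) sh_ob[OF GM]] le_GM that(2) by (simp add: le_def)
  have "van X' (sh T i (on_ob G M))" if i: "i > 0" for i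
  proof (cases "i = 1")
    case True then show ?thesis using v by simp
  next
    case False
    then show ?thesis
      using van_from_third[OF mut GM, of i] add_van_from[OF Y0_add sh_ob[OF GM] A[OF Y_add i]] A[OF X_add, of "i - 1"] i by simp
  qed
  then show "silt_ge T N (on_ob G M)"
    using A[OF Y_add] van_N_from[OF sh_ob[OF GM]] by (simp add: silt_ge_def)
qed

text \<open>Dually, \<open>T(GM, S[d - i])\<close> vanishes: \<open>GM\<close> is in degrees \<le> 0
  and \<open>S[d - i]\<close> in degrees \<ge> 1.\<close>

lemma van_S_M: "i > d \<Longrightarrow> van S (sh T i M)"
proof -
  assume i: "i > d"
  note So = S_heart(3)
  have "ge 1 (sh T (d - i) S)" using ge_sh[OF So, of 1 "d - i"] ge_mono[OF S_heart(2)] i by simp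
  then have "van (on_ob G M) (sh T d (sh T (- i) S))"
    using van_le_ge[OF le_GM] So by (simp add: sh_sh)
  then have "van (sh T (- i) S) M" using G_van_from[OF M_ob sh_ob[OF So]] by blast
  then show ?thesis using So M_ob by (simp add: van_sh_left)
qed

lemma van_S_shift_iff:
  assumes Z: "Z \<in> Ob T"
  shows "van S (sh T d Z) \<longleftrightarrow> van (on_ob G Z) S"
  using G_van_from[OF Z sh_ob[OF S_heart(3)], of "- d"] S_heart(3) Z by (simp add: sh_sh Shift_zero van_sh_left)

text \<open>Degrees above \<open>d\<close> are settled by \<open>van_S_M\<close>, so the bound
  \<open>d - 1\<close> hinges on degree \<open>d\<close> alone.\<close>

lemma proj_dim_top_iff: "proj_dim_le T M S (d - 1) \<longleftrightarrow> van (on_ob G M) S"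
  unfolding proj_dim_le_iff[OF S_heart(1)] van_S_shift_iff[OF M_ob, symmetric]
  using van_S_M by (metis order.order_iff_strict)

lemma mutation_ge_iff_proj_dim: "silt_ge T N (on_ob G M) \<longleftrightarrow> proj_dim_le T M S (d - 1)"
  unfolding N_ge_GM_iff proj_dim_top_iff
  using van_top_if_van_X'[OF le_GM] van_X'_if_van_top[OF le_GM] by blast

lemma silt_d_if_proj_dim:
  assumes p: "proj_dim_le T M S (d - 1)"
  shows "N \<in> silt_d T G \<and> van S (sh T d S)"
proof
  show "van S (sh T d S)"
    using van_all_le_if_van_M[OF S_heart(3) _ S_heart(1), of d d] p proj_dim_le_iff[OF S_heart(1)] by simp
  have "silt_ge T N (on_ob G M)" using p mutation_ge_iff_proj_dim by simp
  \<comment> \<open>Duality removes \<open>G\<close> from the second argument. As \<open>G\<close>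
    is not known to preserve triangles, only in this form can the target pass from \<open>M\<close>
    to \<open>Y0\<close>, \<open>X'\<close> and finally \<open>N\<close>.\<close>
  then have V: "van (on_ob \<nu> N) (sh T (i + d) M)" if "i > 0" for i
    using G_van_to[OF M_ob obs(6), of i] that by (simp add: silt_ge_def)
  note nN = Serre_functor_ob[OF serre obs(6)]
  have A: "van (on_ob \<nu> N) (sh T (i + d) A)" if "A \<in> add_closure T M" "i > 0" for A i
    using add_van_to[OF that(1) M_ob nN V[OF that(2)]] .
  have "van (on_ob \<nu> N) (sh T (i + d) N)" if i: "i > 0" for i
  proof (rule van_N_to[OF nN])
    show "van (on_ob \<nu> N) (sh T (i + d) Y)" by (rule A[OF Y_add i])
    then have "van (on_ob \<nu> N) (sh T (i + d) Y0)" by (rule add_van_to[OF Y0_add obs(2) nN])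
    then show "van (on_ob \<nu> N) (sh T (i + d) X')"
      using van_to_third[OF mut nN] A[OF X_add, of "i + 1"] i by (simp add: ac_simps)
  qed
  then show "N \<in> silt_d T G"
    using N_silt G_van_to[OF obs(6,6)] by (simp add: silt_d_def silt_ge_def)
qed

text \<open>The aisle condition on \<open>GN\<close> that \<open>van_top_if_van_X'\<close> asks for
  is supplied by \<open>le_if_N\<close>. Since \<open>Y\<close> is a retract of \<open>N\<close>,
  degree \<open>d\<close> is settled for \<open>Y\<close>, and \<open>van_S_X\<close> adds
  \<open>X\<close>.\<close>

lemma proj_dim_if_silt_d:
  assumes N: "N \<in> silt_d T G" and SS: "van S (sh T d S)"
  shows "proj_dim_le T M S (d - 1)"
proof -
  note GN = G_ob[OF obs(6)] and So = S_heart(3)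
  have ge: "van N (sh T i (on_ob G N))" if "i > 0" for i
    using N that by (simp add: silt_d_def silt_ge_def)
  have le: "le 0 (on_ob G N)" by (rule le_if_N[OF GN ge])
  have "van X' (sh T 1 (on_ob G N))" using ge[of 1] van_N_from[OF sh_ob[OF GN]] by simp
  then have "van S (sh T d N)" using van_top_if_van_X'[OF le] van_S_shift_iff[OF obs(6)] by simp
  then have "van (sh T (- d) S) N" using So obs(6) by (simp add: van_sh_left)
  then have "van (sh T (- d) S) Y" by (rule retract_van(1)[OF N_retracts(2) sh_ob[OF So]])
  then have SY: "van S (sh T d Y)" using So obs(2) by (simp add: van_sh_left)
  have "van S (sh T d M)" by (rule van_to_M[OF So van_S_X[OF SY SS van_S_M] SY])
  then show ?thesis using proj_dim_top_iff van_S_shift_iff[OF M_ob] by simp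
qed

end

end

theorem theorem4p2:
  fixes K :: "'k ring"
    and T :: "('o, 'a, 'k) tri_cat"
    and \<nu> \<nu>d_inv :: "('o, 'a) endofun"
    and d :: int
    and M X H S N :: 'o
  assumes "triangulated_category K T"
    and silting: "M \<in> silt T"
    and T0: "Hom_finite K T" "Krull_Schmidt T"
    and T1: "Serre_functor K T \<nu>"
    and \<nu>d_inv: "quasi_inverse K T (nu_d T \<nu> d) \<nu>d_inv"
    and T2: "t_structure T (aisle T M) (coaisle T M)"
    and T3: "M \<in> silt_d T \<nu>d_inv"
    and X: "X \<in> add_closure T M"
    and H: "is_H0 T (aisle T M) (coaisle T M) X H"
    and S: "is_top T (heart T M) H S"
    and N: "is_left_mutation T M X N"
  shows "(silt_ge T N (on_ob \<nu>d_inv M) \<longleftrightarrow> proj_dim_le T M S (d - 1)) \<and>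
         (proj_dim_le T M S (d - 1) \<longleftrightarrow> N \<in> silt_d T \<nu>d_inv \<and> Hom_vanishes T S (sh T d S))"
proof -
  obtain Y P Y0 X' f g h where m: "Y \<in> add_closure T M" "biproduct T [X, Y] P" "add_closure T P = add_closure T M"
    "\<forall>Z \<in> add_closure T X \<inter> add_closure T Y. zero_object T Z"
    "left_approximation T (add_closure T Y) X Y0 f" "dist T X Y0 X' f g h" "biproduct T [X', Y] N"
    using N unfolding is_left_mutation_def by (elim exE conjE)
  interpret silting_left_mutation K T M X Y P Y0 X' N H S f g h
    by (intro silting_left_mutation.intro silting_left_mutation_axioms.intro silting_t_structure.intro
        silting_t_structure_axioms.intro assms m) (use m(4) in blast)
  show ?thesis
    using mutation_ge_iff_proj_dim[OF T1 \<nu>d_inv T3] silt_d_if_proj_dim[OF T1 \<nu>d_inv T3]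
      proj_dim_if_silt_d[OF T1 \<nu>d_inv T3] by blast
qed

end
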